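(* For every $\mu$-complete Tychonoff $k_{\mathbb R}$-space $X$ the following conditions are equivalent: (1) $X$ is a topological sum of cosmic $k_\omega$-spaces; (2) the free topological semilattice $\mathsf{SL}(X)$ of $X$ is a topological sum of cosmic $k_\omega$-spaces; (3) $X$ is a $\bar\aleph_k$-space and $\mathsf{SL}(X)$ is a $k$-space; (4) $X$ is a $\bar\aleph_k$-space and $\mathsf{SL}(X)$ contains no strong $\mathrm{Fin}^\omega$-fan.
   Context: A topological semilattice is a topological space with a continuous associative commutative binary operation which is idempotent ($xx=x$). The free topological semilattice of $X$ is a topological semilattice $\mathsf{SL}(X)$ with a continuous map $\delta_X:X\to\mathsf{SL}(X)$ such that for every continuous map $f:X\to Y$ to a topological semilattice $Y$ there is a unique continuous semilattice homomorphism $\bar f:\mathsf{SL}(X)\to Y$ with $f=\bar f\circ\delta_X$. A topological sum is a disjoint topological union. "Regular" includes $T_1$. A family $\mathcal N$ of subsets of a space $Y$ is a network if for each $y\in Y$ and neighborhood $O_y$ of $y$ there is $N\in\mathcal N$ with $y\in N\subset O_y$; it is a $k$-network if for each open $U\subset Y$ and compact $K\subset U$ there is a finite $\mathcal F\subset\mathcal N$ with $K\subset\bigcup\mathcal F\subset U$; it is compact-countable if each compact subset of $Y$ meets at most countably many members of $\mathcal N$. A regular space is cosmic if it has a countable network and a $\bar\aleph_k$-space if it has a compact-countable $k$-network consisting of closed sets. $Y$ is a $k$-space if $A\subset Y$ is closed whenever $A\cap K$ is closed in $K$ for every compact $K\subset Y$. $Y$ is a $k_\omega$-space if it has a countable cover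 $\mathcal K$ by compact subsets such that $F\subset Y$ is closed iff $F\cap K$ is closed in $K$ for all $K\in\mathcal K$. $Y$ is a $k_{\mathbb R}$-space if every function $f:Y\to\mathbb R$ whose restriction to each compact subset of $Y$ is continuous is continuous. A subset $B\subset Y$ is bounded if every locally finite family of open subsets of $Y$ each meeting $B$ is finite; $Y$ is $\mu$-complete if each closed bounded subset of $Y$ is compact. A family $(F_n)_{n\in\omega}$ of subsets of $Y$ is locally finite if each point of $Y$ has a neighborhood meeting $F_n$ for only finitely many $n$; it is compact-finite if each compact subset of $Y$ meets $F_n$ for only finitely many $n$. A set $U\subset Y$ is $\mathbb R$-open if for each $y\in U$ there is a continuous $f:Y\to[0,1]$ with $f(y)=1$ and $f(Y\setminus U)\subset\{0\}$. A $\mathrm{Fin}^\omega$-fan in $Y$ is a family $(F_n)_{n\in\omega}$ of finite subsets of $Y$ that is compact-finite but not locally finite; it is strong if each $F_n$ has an $\mathbb R$-open neighborhood $U_n\supset F_n$ such that $(U_n)_{n\in\omega}$ is compact-finite. *)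

theory Defs
  imports "HOL-Analysis.Analysis"
begin

section \<open>Classes of spaces\<close>

text \<open>The library's \<^const>\<open>regular_space\<close> and \<^const>\<open>completely_regular_space\<close> carry no
  separation axiom of their own, so T1 is added.\<close>

definition regular_T1_space :: "'a topology \<Rightarrow> bool" where
  "regular_T1_space Y \<longleftrightarrow> regular_space Y \<and> t1_space Y"

definition Tychonoff_space :: "'a topology \<Rightarrow> bool" where
  "Tychonoff_space Y \<longleftrightarrow> completely_regular_space Y \<and> t1_space Y"

definition network_in :: "'a topology \<Rightarrow> 'a set set \<Rightarrow> bool" where
  "network_in Y \<N> \<longleftrightarrow> (\<forall>N\<in>\<N>. N \<subseteq> topspace Y) \<and>
     (\<forall>y U. openin Y U \<and> y \<in> U \<longrightarrow> (\<exists>N\<in>\<N>. y \<in> N \<and> N \<subseteq> U))"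

definition k_network_in :: "'a topology \<Rightarrow> 'a set set \<Rightarrow> bool" where
  "k_network_in Y \<N> \<longleftrightarrow> (\<forall>N\<in>\<N>. N \<subseteq> topspace Y) \<and>
     (\<forall>U K. openin Y U \<and> compactin Y K \<and> K \<subseteq> U \<longrightarrow>
        (\<exists>\<F>. finite \<F> \<and> \<F> \<subseteq> \<N> \<and> K \<subseteq> \<Union>\<F> \<and> \<Union>\<F> \<subseteq> U))"

definition compact_countable_in :: "'a topology \<Rightarrow> 'a set set \<Rightarrow> bool" where
  "compact_countable_in Y \<N> \<longleftrightarrow>
     (\<forall>K. compactin Y K \<longrightarrow> countable {N \<in> \<N>. N \<inter> K \<noteq> {}})"

definition cosmic_space :: "'a topology \<Rightarrow> bool" where
  "cosmic_space Y \<longleftrightarrow> regular_T1_space Y \<and> (\<exists>\<N>. countable \<N> \<and> network_in Y \<N>)"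

definition aleph_bar_k_space :: "'a topology \<Rightarrow> bool" where
  "aleph_bar_k_space Y \<longleftrightarrow> regular_T1_space Y \<and>
     (\<exists>\<N>. k_network_in Y \<N> \<and> compact_countable_in Y \<N> \<and> (\<forall>N\<in>\<N>. closedin Y N))"

definition k_omega_space :: "'a topology \<Rightarrow> bool" where
  "k_omega_space Y \<longleftrightarrow>
     (\<exists>\<K>. countable \<K> \<and> (\<forall>K\<in>\<K>. compactin Y K) \<and> \<Union>\<K> = topspace Y \<and>
        (\<forall>F. F \<subseteq> topspace Y \<longrightarrow>
           (closedin Y F \<longleftrightarrow> (\<forall>K\<in>\<K>. closedin (subtopology Y K) (F \<inter> K)))))"

definition cosmic_k_omega_space :: "'a topology \<Rightarrow> bool" where
  "cosmic_k_omega_space Y \<longleftrightarrow> cosmic_space Y \<and> k_omega_space Y"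

definition k_R_space :: "'a topology \<Rightarrow> bool" where
  "k_R_space Y \<longleftrightarrow>
     (\<forall>f :: 'a \<Rightarrow> real.
        (\<forall>K. compactin Y K \<longrightarrow> continuous_map (subtopology Y K) euclideanreal f) \<longrightarrow>
        continuous_map Y euclideanreal f)"

definition bounded_in :: "'a topology \<Rightarrow> 'a set \<Rightarrow> bool" where
  "bounded_in Y B \<longleftrightarrow> B \<subseteq> topspace Y \<and>
     (\<forall>\<U>. locally_finite_in Y \<U> \<and> (\<forall>U\<in>\<U>. openin Y U \<and> U \<inter> B \<noteq> {}) \<longrightarrow> finite \<U>)"

definition mu_complete_space :: "'a topology \<Rightarrow> bool" where
  "mu_complete_space Y \<longleftrightarrow> (\<forall>B. closedin Y B \<and> bounded_in Y B \<longrightarrow> compactin Y B)"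

text \<open>A sum decomposition of \<open>Y\<close> has at most as many nonempty summands as \<open>Y\<close> has points, and
  each summand is homeomorphic to a subspace of \<open>Y\<close>; so taking both the indices and the points
  of the summands from the type of the points of \<open>Y\<close> is no restriction (for a property \<open>P\<close>
  invariant under homeomorphisms).\<close>

definition topological_sum_of :: "('a topology \<Rightarrow> bool) \<Rightarrow> 'a topology \<Rightarrow> bool" where
  "topological_sum_of P Y \<longleftrightarrow>
     (\<exists>(I :: 'a set) (Z :: 'a \<Rightarrow> 'a topology).
        (\<forall>i\<in>I. P (Z i)) \<and> Y homeomorphic_space (sum_topology Z I))"


section \<open>Fans\<close>

text \<open>Families indexed by \<open>\<omega>\<close> are treated as indexed families (the same set may occur for several
  indices), whence \<^const>\<open>locally_finite_in\<close>, which is about sets of sets, is not used here.\<close>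

definition locally_finite_seq :: "'a topology \<Rightarrow> (nat \<Rightarrow> 'a set) \<Rightarrow> bool" where
  "locally_finite_seq Y F \<longleftrightarrow>
     (\<forall>y\<in>topspace Y. \<exists>V. openin Y V \<and> y \<in> V \<and> finite {n. F n \<inter> V \<noteq> {}})"

definition compact_finite_seq :: "'a topology \<Rightarrow> (nat \<Rightarrow> 'a set) \<Rightarrow> bool" where
  "compact_finite_seq Y F \<longleftrightarrow> (\<forall>K. compactin Y K \<longrightarrow> finite {n. F n \<inter> K \<noteq> {}})"

definition R_open_in :: "'a topology \<Rightarrow> 'a set \<Rightarrow> bool" where
  "R_open_in Y U \<longleftrightarrow> U \<subseteq> topspace Y \<and>
     (\<forall>y\<in>U. \<exists>f :: 'a \<Rightarrow> real. continuous_map Y (top_of_set {0..1}) f \<and>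
        f y = 1 \<and> f ` (topspace Y - U) \<subseteq> {0})"

definition Fin_omega_fan :: "'a topology \<Rightarrow> (nat \<Rightarrow> 'a set) \<Rightarrow> bool" where
  "Fin_omega_fan Y F \<longleftrightarrow>
     (\<forall>n. finite (F n) \<and> F n \<subseteq> topspace Y) \<and> compact_finite_seq Y F \<and> \<not> locally_finite_seq Y F"

definition strong_Fin_omega_fan :: "'a topology \<Rightarrow> (nat \<Rightarrow> 'a set) \<Rightarrow> bool" where
  "strong_Fin_omega_fan Y F \<longleftrightarrow> Fin_omega_fan Y F \<and>
     (\<exists>U. (\<forall>n. R_open_in Y (U n) \<and> F n \<subseteq> U n) \<and> compact_finite_seq Y U)"


section \<open>Free topological semilattices\<close>

definition topological_semilattice :: "'s topology \<Rightarrow> ('s \<Rightarrow> 's \<Rightarrow> 's) \<Rightarrow> bool" where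
  "topological_semilattice S m \<longleftrightarrow>
     continuous_map (prod_topology S S) S (\<lambda>(x, y). m x y) \<and>
     (\<forall>x\<in>topspace S. \<forall>y\<in>topspace S. \<forall>z\<in>topspace S. m (m x y) z = m x (m y z)) \<and>
     (\<forall>x\<in>topspace S. \<forall>y\<in>topspace S. m x y = m y x) \<and>
     (\<forall>x\<in>topspace S. m x x = x)"

definition continuous_semilattice_hom ::
    "'s topology \<Rightarrow> ('s \<Rightarrow> 's \<Rightarrow> 's) \<Rightarrow> 't topology \<Rightarrow> ('t \<Rightarrow> 't \<Rightarrow> 't) \<Rightarrow> ('s \<Rightarrow> 't) \<Rightarrow> bool" where
  "continuous_semilattice_hom S m T n h \<longleftrightarrow> continuous_map S T h \<and>
     (\<forall>x\<in>topspace S. \<forall>y\<in>topspace S. h (m x y) = n (h x) (h y))"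

text \<open>Every continuous map \<open>f\<close> from \<open>X\<close> to \<open>Y\<close> factors through \<open>\<delta>\<close> by a continuous homomorphism,
  unique as a map on the points of \<open>S\<close> (HOL functions are also defined elsewhere).\<close>

definition unique_factorization ::
    "'a topology \<Rightarrow> 's topology \<Rightarrow> ('s \<Rightarrow> 's \<Rightarrow> 's) \<Rightarrow> ('a \<Rightarrow> 's) \<Rightarrow>
     'c topology \<Rightarrow> ('c \<Rightarrow> 'c \<Rightarrow> 'c) \<Rightarrow> ('a \<Rightarrow> 'c) \<Rightarrow> bool" where
  "unique_factorization X S m \<delta> Y n f \<longleftrightarrow>
     (\<exists>h. continuous_semilattice_hom S m Y n h \<and> (\<forall>x\<in>topspace X. f x = h (\<delta> x)) \<and>
        (\<forall>h'. continuous_semilattice_hom S m Y n h' \<and> (\<forall>x\<in>topspace X. f x = h' (\<delta> x)) \<longrightarrow>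
           (\<forall>s\<in>topspace S. h' s = h s)))"

text \<open>A definition cannot quantify over the type of the points of \<open>Y\<close>. Here they are
  taken from the type \<open>'a set\<close>; theorem \<open>free_topological_semilattice_universal\<close> below shows that
  the universal property then holds for \<open>Y\<close> over every type, and
  \<open>free_topological_semilattice_exists\<close> that the notion is not vacuous.\<close>

definition free_topological_semilattice ::
    "'a topology \<Rightarrow> 's topology \<Rightarrow> ('s \<Rightarrow> 's \<Rightarrow> 's) \<Rightarrow> ('a \<Rightarrow> 's) \<Rightarrow> bool" where
  "free_topological_semilattice X S m \<delta> \<longleftrightarrow>
     topological_semilattice S m \<and> continuous_map X S \<delta> \<and>
     (\<forall>(Y :: 'a set topology) n f.
        topological_semilattice Y n \<and> continuous_map X Y f \<longrightarrow> unique_factorization X S m \<delta> Y n f)"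


subsection \<open>The universal property over all types, and existence\<close>

lemma topological_semilatticeD:
  assumes "topological_semilattice S m"
  shows "continuous_map (prod_topology S S) S (\<lambda>(x, y). m x y)"
    and "\<And>x y. x \<in> topspace S \<Longrightarrow> y \<in> topspace S \<Longrightarrow> m x y \<in> topspace S"
    and "\<And>x y z. x \<in> topspace S \<Longrightarrow> y \<in> topspace S \<Longrightarrow> z \<in> topspace S \<Longrightarrow>
           m (m x y) z = m x (m y z)"
    and "\<And>x y. x \<in> topspace S \<Longrightarrow> y \<in> topspace S \<Longrightarrow> m x y = m y x"
    and "\<And>x. x \<in> topspace S \<Longrightarrow> m x x = x"
proof -
  show c: "continuous_map (prod_topology S S) S (\<lambda>(x, y). m x y)"
    using assms by (simp add: topological_semilattice_def)
  show "m x y \<in> topspace S" if "x \<in> topspace S" "y \<in> topspace S" for x y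
    using continuous_map_funspace[OF c] that by (auto simp: Pi_iff)
qed (use assms in \<open>auto simp: topological_semilattice_def\<close>)

definition fin_subsets :: "'a set \<Rightarrow> 'a set set" where
  "fin_subsets A = {F. finite F \<and> F \<noteq> {} \<and> F \<subseteq> A}"

lemma fin_subsets_simps:
  "x \<in> A \<Longrightarrow> {x} \<in> fin_subsets A"
  "F \<in> fin_subsets A \<Longrightarrow> G \<in> fin_subsets A \<Longrightarrow> F \<union> G \<in> fin_subsets A"
  by (auto simp: fin_subsets_def)

lemma fin_subsets_induct [consumes 1, case_names singleton union]:
  assumes "F \<in> fin_subsets A"
    and "\<And>x. x \<in> A \<Longrightarrow> P {x}"
    and "\<And>x G. x \<in> A \<Longrightarrow> G \<in> fin_subsets A \<Longrightarrow> P G \<Longrightarrow> P ({x} \<union> G)"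
  shows "P F"
proof -
  have "finite F" "F \<noteq> {}" "F \<subseteq> A" using assms(1) by (auto simp: fin_subsets_def)
  then show ?thesis
  proof (induction F rule: finite_ne_induct)
    case (singleton x)
    then show ?case using assms(2) by auto
  next
    case (insert x F)
    then have "F \<in> fin_subsets A" by (auto simp: fin_subsets_def)
    then show ?case using assms(3)[of x F] insert by auto
  qed
qed

lemma semilattice_extension:
  assumes S: "topological_semilattice Y n" and f: "\<And>x. x \<in> A \<Longrightarrow> f x \<in> topspace Y"
  shows "\<exists>h. (\<forall>F\<in>fin_subsets A. h F \<in> topspace Y) \<and> (\<forall>x\<in>A. h {x} = f x) \<and>
    (\<forall>F\<in>fin_subsets A. \<forall>G\<in>fin_subsets A. h (F \<union> G) = n (h F) (h G))"
proof -
  note D = topological_semilatticeD(2-5)[OF S]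
  define glb where "glb F z \<longleftrightarrow> z \<in> topspace Y \<and> (\<forall>x\<in>F. n z (f x) = z) \<and>
      (\<forall>w\<in>topspace Y. (\<forall>x\<in>F. n w (f x) = w) \<longrightarrow> n w z = w)" for F z
  have uniq: "z = z'" if "glb F z" "glb F z'" for F z z'
    using that D(3)[of z z'] by (auto simp: glb_def)
  have glb1: "glb {x} (f x)" if "x \<in> A" for x
    using that f D by (auto simp: glb_def)
  have glbU: "glb (F \<union> G) (n y z)" if "F \<subseteq> A" "G \<subseteq> A" "glb F y" "glb G z" for F G y z
  proof -
    have y: "y \<in> topspace Y" and z: "z \<in> topspace Y" using that by (auto simp: glb_def)
    have 1: "n (n y z) (f x) = n y z" if "x \<in> F" for x
    proof -
      have fx: "f x \<in> topspace Y" using that \<open>F \<subseteq> A\<close> f by auto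
      have "n (n y z) (f x) = n (n z y) (f x)" using D(3) y z by metis
      also have "\<dots> = n z (n y (f x))" using D(2) y z fx by metis
      also have "\<dots> = n z y" using \<open>glb F y\<close> that by (auto simp: glb_def)
      finally show ?thesis using D(3) y z by metis
    qed
    have 2: "n (n y z) (f x) = n y z" if "x \<in> G" for x
    proof -
      have fx: "f x \<in> topspace Y" using that \<open>G \<subseteq> A\<close> f by auto
      have "n (n y z) (f x) = n y (n z (f x))" using D(2) y z fx by metis
      then show ?thesis using \<open>glb G z\<close> that by (auto simp: glb_def)
    qed
    have 3: "n w (n y z) = w" if "w \<in> topspace Y" "\<forall>x\<in>F\<union>G. n w (f x) = w" for w
    proof -
      have "n w y = w" "n w z = w" using that \<open>glb F y\<close> \<open>glb G z\<close> by (auto simp: glb_def)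
      then show ?thesis using D(2)[of w y z] that y z by auto
    qed
    show ?thesis unfolding glb_def using 1 2 3 D(1)[OF y z] by auto
  qed
  have ex: "\<exists>z. glb F z" if "F \<in> fin_subsets A" for F
    using that
  proof (induction rule: fin_subsets_induct)
    case (singleton x)
    then show ?case using glb1 by blast
  next
    case (union x G)
    then show ?case using glbU[of "{x}" G] glb1[of x] by (auto simp: fin_subsets_def)
  qed
  define h where "h F = (SOME z. glb F z)" for F
  have h: "glb F (h F)" if "F \<in> fin_subsets A" for F
    using someI_ex[OF ex[OF that]] by (simp add: h_def)
  show ?thesis
  proof (intro exI[of _ h] conjI ballI)
    show "h F \<in> topspace Y" if "F \<in> fin_subsets A" for F
      using h[OF that] by (simp add: glb_def)
    show "h {x} = f x" if "x \<in> A" for x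
      using uniq h glb1 that fin_subsets_simps(1) by metis
    show "h (F \<union> G) = n (h F) (h G)" if "F \<in> fin_subsets A" "G \<in> fin_subsets A" for F G
      using uniq[OF h[OF fin_subsets_simps(2)[OF that]] glbU] h that by (auto simp: fin_subsets_def)
  qed
qed

lemma pullback_semilattice:
  assumes S: "topological_semilattice Y n"
    and h: "\<And>F. F \<in> C \<Longrightarrow> h F \<in> topspace Y"
    and C: "\<And>F G. F \<in> C \<Longrightarrow> G \<in> C \<Longrightarrow> p F G \<in> C \<and> h (p F G) = n (h F) (h G)"
    and p: "\<And>F G H. F \<in> C \<Longrightarrow> G \<in> C \<Longrightarrow> H \<in> C \<Longrightarrow> p (p F G) H = p F (p G H)"
      "\<And>F G. F \<in> C \<Longrightarrow> G \<in> C \<Longrightarrow> p F G = p G F" "\<And>F. F \<in> C \<Longrightarrow> p F F = F"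
  shows "topspace (pullback_topology C h Y) = C"
    and "topological_semilattice (pullback_topology C h Y) p"
    and "continuous_semilattice_hom (pullback_topology C h Y) p Y n h"
proof -
  let ?P = "pullback_topology C h Y"
  show tp: "topspace ?P = C" using h by (auto simp: topspace_pullback_topology)
  have "continuous_map ?P Y (id \<circ> h)"
    by (rule continuous_map_pullback) simp
  then have ch: "continuous_map ?P Y h" by (simp only: id_comp)
  have "continuous_map (prod_topology ?P ?P) (prod_topology Y Y) (\<lambda>z. (h (fst z), h (snd z)))"
    using ch by (auto simp: continuous_map_pairedI continuous_map_of_fst continuous_map_of_snd
        o_def intro!: continuous_map_pairedI
        continuous_map_compose[OF continuous_map_fst ch, unfolded o_def]
        continuous_map_compose[OF continuous_map_snd ch, unfolded o_def])
  from continuous_map_compose[OF this topological_semilatticeD(1)[OF S]]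
  have "continuous_map (prod_topology ?P ?P) Y (\<lambda>z. n (h (fst z)) (h (snd z)))"
    by (simp add: o_def)
  then have "continuous_map (prod_topology ?P ?P) Y (h \<circ> (\<lambda>(F, G). p F G))"
    by (rule continuous_map_eq) (use tp C in auto)
  then have "continuous_map (prod_topology ?P ?P) ?P (\<lambda>(F, G). p F G)"
    by (rule continuous_map_pullback') (use tp C in auto)
  then show "topological_semilattice ?P p"
    unfolding topological_semilattice_def tp using p by auto
  show "continuous_semilattice_hom ?P p Y n h"
    unfolding continuous_semilattice_hom_def tp using ch C by auto
qed

lemma pullback_fin_subsets:
  assumes S: "topological_semilattice Y n" and f: "continuous_map X Y f"
  obtains h where "topspace (pullback_topology (fin_subsets (topspace X)) h Y) = fin_subsets (topspace X)"
    and "topological_semilattice (pullback_topology (fin_subsets (topspace X)) h Y) (\<union>)"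
    and "continuous_map X (pullback_topology (fin_subsets (topspace X)) h Y) (\<lambda>x. {x})"
    and "continuous_semilattice_hom (pullback_topology (fin_subsets (topspace X)) h Y) (\<union>) Y n h"
    and "\<And>x. x \<in> topspace X \<Longrightarrow> h {x} = f x"
proof -
  have fx: "f x \<in> topspace Y" if "x \<in> topspace X" for x
    using continuous_map_funspace[OF f] that by auto
  obtain h where *: "(\<forall>F\<in>fin_subsets (topspace X). h F \<in> topspace Y) \<and>
      (\<forall>x\<in>topspace X. h {x} = f x) \<and>
      (\<forall>F\<in>fin_subsets (topspace X). \<forall>G\<in>fin_subsets (topspace X). h (F \<union> G) = n (h F) (h G))"
    using semilattice_extension[where A = "topspace X" and f = f, OF S fx] by (rule exE)
  then have h: "h F \<in> topspace Y" if "F \<in> fin_subsets (topspace X)" for F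
    using that by blast
  have h1: "h {x} = f x" if "x \<in> topspace X" for x
    using * that by blast
  have cl: "F \<union> G \<in> fin_subsets (topspace X) \<and> h (F \<union> G) = n (h F) (h G)"
    if "F \<in> fin_subsets (topspace X)" "G \<in> fin_subsets (topspace X)" for F G
    using that * fin_subsets_simps(2) by blast
  note P = pullback_semilattice[OF S, of "fin_subsets (topspace X)" h "(\<union>)",
      OF h cl Un_assoc Un_commute Un_absorb]
  have "continuous_map X Y (h \<circ> (\<lambda>x. {x}))"
    using f by (rule continuous_map_eq) (simp add: h1)
  then have "continuous_map X (pullback_topology (fin_subsets (topspace X)) h Y) (\<lambda>x. {x})"
    by (rule continuous_map_pullback') (auto simp: fin_subsets_def)
  from that[OF P(1) P(2) this P(3) h1] show ?thesis by simp
qed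

inductive_set sl_generated :: "('s \<Rightarrow> 's \<Rightarrow> 's) \<Rightarrow> 's set \<Rightarrow> 's set" for m B where
  gen: "b \<in> B \<Longrightarrow> b \<in> sl_generated m B"
| mult: "s \<in> sl_generated m B \<Longrightarrow> t \<in> sl_generated m B \<Longrightarrow> m s t \<in> sl_generated m B"

lemma hom_compose:
  assumes "continuous_semilattice_hom S m T n g" "continuous_semilattice_hom T n U k h"
  shows "continuous_semilattice_hom S m U k (h \<circ> g)"
  using assms continuous_map_funspace[of S T g]
  unfolding continuous_semilattice_hom_def by (auto simp: Pi_iff intro: continuous_map_compose)

lemma free_generated:
  fixes X :: "'a topology"
  assumes "free_topological_semilattice X S m \<delta>"
  shows "topspace S = sl_generated m (\<delta> ` topspace X)"
proof
  let ?G = "sl_generated m (\<delta> ` topspace X)"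
  have S: "topological_semilattice S m" and d: "continuous_map X S \<delta>"
    using assms by (auto simp: free_topological_semilattice_def)
  note D = topological_semilatticeD(2-5)[OF S]
  have dx: "\<delta> x \<in> topspace S" if "x \<in> topspace X" for x
    using continuous_map_funspace[OF d] that by auto
  have GS: "s \<in> topspace S" if "s \<in> ?G" for s
    using that by induction (auto intro: dx D(1))
  then show "?G \<subseteq> topspace S" by auto
  show "topspace S \<subseteq> ?G"
  proof
    fix s assume s: "s \<in> topspace S"
    let ?B = "{{}, UNIV} :: 'a set set"
    define I where "I = pullback_topology ?B (\<lambda>_. ()) (discrete_topology UNIV)"
    have tI: "topspace I = ?B" by (auto simp: I_def topspace_pullback_topology)
    have cI: "continuous_map Z I g" if "g ` topspace Z \<subseteq> ?B" for Z :: "'z topology" and g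
      unfolding I_def by (rule continuous_map_pullback') (use that in auto)
    have "continuous_map (prod_topology I I) I (\<lambda>(x, y). x \<inter> y)"
      by (rule cI) (auto simp: tI)
    then have semI: "topological_semilattice I (\<inter>)"
      unfolding topological_semilattice_def by auto
    define a where "a t = (if m s t = s then UNIV else {} :: 'a set)" for t
    define b where
      "b t = (if \<exists>p\<in>?G. m s p = s \<and> m p t = p then UNIV else {} :: 'a set)" for t
    have a_iff: "m s (m t u) = s \<longleftrightarrow> m s t = s \<and> m s u = s"
      if "s \<in> topspace S" "t \<in> topspace S" "u \<in> topspace S" for s t u
      by (smt (verit) D that)
    have "a (m t u) = a t \<inter> a u" if "t \<in> topspace S" "u \<in> topspace S" for t u
      using a_iff[OF s that] by (auto simp: a_def)
    moreover have "continuous_map S I a" by (rule cI) (auto simp: a_def)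
    ultimately have ha: "continuous_semilattice_hom S m I (\<inter>) a"
      unfolding continuous_semilattice_hom_def by simp
    have b_iff: "(\<exists>p\<in>?G. m s p = s \<and> m p (m t u) = p) \<longleftrightarrow>
        (\<exists>p\<in>?G. m s p = s \<and> m p t = p) \<and> (\<exists>p\<in>?G. m s p = s \<and> m p u = p)" (is "?L \<longleftrightarrow> ?R1 \<and> ?R2")
      if t: "t \<in> topspace S" and u: "u \<in> topspace S" for t u
    proof
      assume ?L
      then show "?R1 \<and> ?R2" using a_iff[OF GS t u] by blast
    next
      assume "?R1 \<and> ?R2"
      then obtain p q where pq: "p \<in> ?G" "q \<in> ?G" "m s p = s" "m p t = p" "m s q = s" "m q u = q"
        by blast
      have p: "p \<in> topspace S" and q: "q \<in> topspace S" using pq GS by auto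
      have 1: "m s (m p q) = s" using a_iff[OF s p q] pq by simp
      have "m (m p q) t = m p q" using D(2)[of q p t] D(3)[of p q] D(2) p q t pq by metis
      moreover have "m (m p q) u = m p q" using D(2)[of p q u] p q u pq by metis
      ultimately have "m (m p q) (m t u) = m p q" using a_iff[OF D(1)[OF p q] t u] by simp
      with 1 show ?L using sl_generated.mult[OF pq(1,2)] by blast
    qed
    have "b (m t u) = b t \<inter> b u" if "t \<in> topspace S" "u \<in> topspace S" for t u
      using b_iff[OF that] by (auto simp: b_def)
    moreover have "continuous_map S I b" by (rule cI) (auto simp: b_def)
    ultimately have hb: "continuous_semilattice_hom S m I (\<inter>) b"
      unfolding continuous_semilattice_hom_def by simp
    have ab: "a (\<delta> x) = b (\<delta> x)" if "x \<in> topspace X" for x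
    proof -
      have g: "\<delta> x \<in> ?G" using that by (auto intro: sl_generated.gen)
      have "m s (\<delta> x) = s" if "p \<in> ?G" "m s p = s" "m p (\<delta> x) = p" for p
        using D(2)[of s p "\<delta> x"] that GS g s by metis
      then show ?thesis using g D(4)[OF GS[OF g]] by (auto simp: a_def b_def)
    qed
    have "continuous_map X I (a \<circ> \<delta>)"
      by (rule cI) (auto simp: a_def)
    then have "unique_factorization X S m \<delta> I (\<inter>) (a \<circ> \<delta>)"
      using assms semI by (auto simp: free_topological_semilattice_def)
    then obtain h where "\<And>h'. continuous_semilattice_hom S m I (\<inter>) h' \<Longrightarrow>
        (\<And>x. x \<in> topspace X \<Longrightarrow> a (\<delta> x) = h' (\<delta> x)) \<Longrightarrow> h' s = h s"
      using s unfolding unique_factorization_def by (metis comp_apply)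
    from this[OF ha] this[OF hb] ab have "a s = b s" by simp
    then have "\<exists>p\<in>?G. m s p = s \<and> m p s = p"
      using D(4)[OF s] by (auto simp: a_def b_def split: if_splits)
    then obtain p where "p \<in> ?G" "m s p = s" "m p s = p" by blast
    then show "s \<in> ?G" using D(3)[OF s GS] by metis
  qed
qed

theorem free_topological_semilattice_universal:
  fixes Y :: "'c topology"
  assumes F: "free_topological_semilattice X S m \<delta>"
    and Y: "topological_semilattice Y n" and f: "continuous_map X Y f"
  shows "unique_factorization X S m \<delta> Y n f"
proof -
  obtain h where h: "topological_semilattice (pullback_topology (fin_subsets (topspace X)) h Y) (\<union>)"
    "continuous_map X (pullback_topology (fin_subsets (topspace X)) h Y) (\<lambda>x. {x})"
    "continuous_semilattice_hom (pullback_topology (fin_subsets (topspace X)) h Y) (\<union>) Y n h"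
    "\<And>x. x \<in> topspace X \<Longrightarrow> h {x} = f x"
    using pullback_fin_subsets[OF Y f] by metis
  from F h(1,2) obtain g
    where g: "continuous_semilattice_hom S m (pullback_topology (fin_subsets (topspace X)) h Y) (\<union>) g"
      "\<And>x. x \<in> topspace X \<Longrightarrow> {x} = g (\<delta> x)"
    unfolding free_topological_semilattice_def unique_factorization_def by metis
  have 1: "continuous_semilattice_hom S m Y n (h \<circ> g)" by (rule hom_compose[OF g(1) h(3)])
  have 2: "f x = (h \<circ> g) (\<delta> x)" if "x \<in> topspace X" for x
    using h(4) g(2) that by (metis comp_apply)
  have "h' s = (h \<circ> g) s"
    if h': "continuous_semilattice_hom S m Y n h'" "\<forall>x\<in>topspace X. f x = h' (\<delta> x)"
      and s: "s \<in> topspace S" for h' s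
  proof -
    have G: "topspace S = sl_generated m (\<delta> ` topspace X)" by (rule free_generated[OF F])
    have "s \<in> sl_generated m (\<delta> ` topspace X)" using s G by simp
    then show ?thesis
    proof induction
      case (gen b)
      then show ?case using 2 h'(2) by force
    next
      case (mult s t)
      then have "s \<in> topspace S" "t \<in> topspace S" by (simp_all add: G)
      then show ?case using mult.IH 1 h'(1) unfolding continuous_semilattice_hom_def by metis
    qed
  qed
  with 1 2 show ?thesis unfolding unique_factorization_def by blast
qed

theorem free_topological_semilattice_exists:
  fixes X :: "'a topology"
  shows "\<exists>(S :: 'a set topology) m \<delta>. free_topological_semilattice X S m \<delta>"
proof -
  let ?C = "fin_subsets (topspace X)"
  define \<T> where "\<T> = {T. topspace T = ?C \<and> topological_semilattice T (\<union>) \<and>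
      continuous_map X T (\<lambda>x. {x})}"
  define S where "S = topology_generated_by {U. \<exists>T\<in>\<T>. openin T U}"
  have finer: "openin S U" if "T \<in> \<T>" "openin T U" for T U
    unfolding S_def by (rule topology_generated_by_Basis) (use that in auto)
  have uT: "unique_factorization X S (\<union>) (\<lambda>x. {x}) Y n f"
    if tS: "topspace S = ?C"
      and Y: "topological_semilattice Y n" and f: "continuous_map X Y f"
    for Y :: "'a set topology" and n f
  proof -
    obtain h where h: "topspace (pullback_topology ?C h Y) = ?C"
      "topological_semilattice (pullback_topology ?C h Y) (\<union>)"
      "continuous_map X (pullback_topology ?C h Y) (\<lambda>x. {x})"
      "continuous_semilattice_hom (pullback_topology ?C h Y) (\<union>) Y n h"
      "\<And>x. x \<in> topspace X \<Longrightarrow> h {x} = f x"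
      using pullback_fin_subsets[OF Y f] by metis
    let ?P = "pullback_topology ?C h Y"
    have "?P \<in> \<T>" using h by (simp add: \<T>_def)
    then have "continuous_map S ?P id"
      using finer h(1) tS topology_finer_continuous_id[of ?P S] by auto
    then have "continuous_semilattice_hom S (\<union>) ?P (\<union>) id"
      by (simp add: continuous_semilattice_hom_def)
    from hom_compose[OF this h(4)] have hom: "continuous_semilattice_hom S (\<union>) Y n h" by simp
    have "h' s = h s" if h': "continuous_semilattice_hom S (\<union>) Y n h'"
      "\<forall>x\<in>topspace X. f x = h' {x}" and s: "s \<in> topspace S" for h' s
    proof -
      have "s \<in> ?C" using s tS by simp
      then show ?thesis
      proof (induction rule: fin_subsets_induct)
        case (singleton x)
        then show ?case using h' h(5) by simp
      next
        case (union x G)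
        then have "{x} \<in> topspace S" "G \<in> topspace S" using tS fin_subsets_simps by auto
        moreover have "h' {x} = h {x}" using union h' h(5) by simp
        ultimately show ?case
          using hom h'(1) union.IH unfolding continuous_semilattice_hom_def by metis
      qed
    qed
    then show ?thesis unfolding unique_factorization_def using hom h(5) by metis
  qed
  have tS: "topspace S = ?C"
  proof -
    have Y: "topological_semilattice (discrete_topology {()}) (\<lambda>_ _. ())"
      by (auto simp: topological_semilattice_def case_prod_unfold)
    have f: "continuous_map X (discrete_topology {()}) (\<lambda>_. ())" by auto
    obtain h where h: "topspace (pullback_topology ?C h (discrete_topology {()})) = ?C"
      "topological_semilattice (pullback_topology ?C h (discrete_topology {()})) (\<union>)"
      "continuous_map X (pullback_topology ?C h (discrete_topology {()})) (\<lambda>x. {x})"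
      using pullback_fin_subsets[OF Y f] by metis
    then have "pullback_topology ?C h (discrete_topology {()}) \<in> \<T>" by (simp add: \<T>_def)
    then have "?C \<subseteq> topspace S"
      using finer h(1) openin_subset openin_topspace by metis
    moreover have "topspace S \<subseteq> ?C"
      unfolding S_def topology_generated_by_topspace \<T>_def by (auto dest: openin_subset)
    ultimately show ?thesis by blast
  qed
  have "continuous_map (prod_topology S S) S (\<lambda>(F, G). F \<union> G)"
    unfolding S_def
  proof (rule continuous_on_generated_topo, fold S_def)
    fix U assume "U \<in> {U. \<exists>T\<in>\<T>. openin T U}"
    then obtain T where T: "T \<in> \<T>" "openin T U" by auto
    then have tT: "topspace T = ?C" by (simp add: \<T>_def)
    have id: "continuous_map S T id"
      using finer[OF T(1)] tT tS topology_finer_continuous_id[of T S] by auto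
    have "continuous_map (prod_topology S S) (prod_topology T T) (\<lambda>z. (id (fst z), id (snd z)))"
      by (intro continuous_map_pairedI
        continuous_map_compose[OF continuous_map_fst id, unfolded o_def]
        continuous_map_compose[OF continuous_map_snd id, unfolded o_def])
    moreover have "continuous_map (prod_topology T T) T (\<lambda>(F, G). F \<union> G)"
      using T(1) topological_semilatticeD(1) by (fastforce simp: \<T>_def)
    ultimately have "continuous_map (prod_topology S S) T ((\<lambda>(F, G). F \<union> G) \<circ> (\<lambda>z. (id (fst z), id (snd z))))"
      by (rule continuous_map_compose)
    then have "continuous_map (prod_topology S S) T (\<lambda>(F, G). F \<union> G)"
      by (simp add: o_def case_prod_unfold)
    then show "openin (prod_topology S S) ((\<lambda>(F, G). F \<union> G) -` U \<inter> topspace (prod_topology S S))"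
      using T(2) by (simp add: continuous_map_alt)
  next
    show "(\<lambda>(F, G). F \<union> G) ` topspace (prod_topology S S) \<subseteq> \<Union>{U. \<exists>T\<in>\<T>. openin T U}"
      using tS fin_subsets_simps(2) unfolding S_def topology_generated_by_topspace by auto
  qed
  then have "topological_semilattice S (\<union>)"
    unfolding topological_semilattice_def by auto
  moreover have "continuous_map X S (\<lambda>x. {x})"
    unfolding S_def
  proof (rule continuous_on_generated_topo)
    fix U assume "U \<in> {U. \<exists>T\<in>\<T>. openin T U}"
    then show "openin X ((\<lambda>x. {x}) -` U \<inter> topspace X)"
      by (auto simp: \<T>_def continuous_map_alt)
  next
    show "(\<lambda>x. {x}) ` topspace X \<subseteq> \<Union>{U. \<exists>T\<in>\<T>. openin T U}"
      using tS fin_subsets_simps(1) unfolding S_def topology_generated_by_topspace by auto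
  qed
  ultimately have "free_topological_semilattice X S (\<union>) (\<lambda>x. {x})"
    using uT[OF tS] unfolding free_topological_semilattice_def by blast
  then show ?thesis by blast
qed

end

theory Submission
  imports Defs
begin

text \<open>The free topological semilattice of \<open>X\<close> is realised on the finite nonempty subsets of \<open>X\<close>, with the
  finest topology making union and singletons continuous.

  If \<open>X\<close> splits into clopen cosmic \<open>k\<^sub>\<omega>\<close>-pieces, the semilattice splits according to the set of pieces met
  by a finite set, and over a clopen \<open>k\<^sub>\<omega>\<close>-piece exhausted by compact sets \<open>K n\<close> it is exhausted by the
  compact sets of all \<open>F \<subseteq> K n\<close> with at most \<open>n + 1\<close> points. In the converse direction \<open>X\<close> is a closed
  subspace of the semilattice. A \<open>T\<^sub>1\<close> \<open>k\<close>-space contains no \<open>Fin\<^sup>\<omega>\<close>-fan at all.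

  If the semilattice has no strong fan, then the compact members of a compact-countable closed
  \<open>k\<close>-network (closed under intersection) again form a \<open>k\<close>-network: otherwise closed non-compact sets
  \<open>R n\<close> shrink to a point \<open>z\<close>, \<open>\<mu>\<close>-completeness yields points \<open>x n i \<in> R n\<close> that are discrete in \<open>i\<close>, and
  the sets \<open>{x n i} \<union> {x i 0, \<dots>, x i n}\<close> form a strong fan accumulating at \<open>{z}\<close>. A compact-countable
  family of compact sets is star-countable, so the unions of its chain components are the pieces
  sought; they are clopen and \<open>k\<^sub>\<omega>\<close> because \<open>X\<close> is a \<open>k\<^sub>\<real>\<close>-space.\<close>

section \<open>Clopen partitions into cosmic spaces with compact exhaustions\<close>

text \<open>The open sets of the free semilattice have no explicit description, and this shapes most
  of the work. A set is shown open by exhibiting a coarser topology that still makes union and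
  singletons continuous; Vietoris-type sets, balls of pseudometrics for which union is Lipschitz,
  and direct limits of compact sets all enter in this way. The two halves of a fan member have
  different tasks. For fixed \<open>n\<close> the points \<open>x n i\<close> leave every compact
  set as \<open>i\<close> grows. For growing \<open>n\<close> the points
  \<open>x i 0, \<dots>, x i n\<close> lie in so many disjoint open sets that a compact part of the
  semilattice cannot follow. Local finiteness still fails at \<open>{z}\<close>: every neighbourhood
  of \<open>{z}\<close> contains all sets of at most \<open>n + 1\<close> points close to
  \<open>z\<close>, where closeness depends on \<open>n\<close>, and \<open>i\<close> is chosen
  after \<open>n\<close>. In the last step the difficulty is that the k_R property speaks about real
  functions only, so open sets must be found as sets where a glued function is positive.\<close>

lemma homeomorphic_cosmic_space:
  assumes "Y homeomorphic_space Z" and "cosmic_space Y"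
  shows "cosmic_space Z"
proof -
  obtain f g where fg: "homeomorphic_maps Y Z f g" using assms(1) homeomorphic_space_def by blast
  obtain \<N> where \<N>: "countable \<N>" "network_in Y \<N>" using assms(2) cosmic_space_def by blast
  have f: "homeomorphic_map Y Z f" using fg homeomorphic_maps_map by blast
  have "network_in Z ((`) f ` \<N>)"
    unfolding network_in_def
  proof (intro conjI allI impI ballI)
    fix N assume "N \<in> (`) f ` \<N>"
    then show "N \<subseteq> topspace Z"
      using \<N>(2) homeomorphic_imp_surjective_map[OF f] unfolding network_in_def by blast
  next
    fix y U assume U: "openin Z U \<and> y \<in> U"
    then have y: "y \<in> topspace Z" using openin_subset by blast
    have gy: "g y \<in> topspace Y" "f (g y) = y"
      using y fg unfolding homeomorphic_maps_def continuous_map_def by auto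
    have "openin Y {x \<in> topspace Y. f x \<in> U}"
      using U fg openin_continuous_map_preimage unfolding homeomorphic_maps_def by blast
    with gy U \<N>(2) obtain N where "N \<in> \<N>" "g y \<in> N" "N \<subseteq> {x \<in> topspace Y. f x \<in> U}"
      unfolding network_in_def by (metis (mono_tags, lifting) mem_Collect_eq)
    with gy(2) show "\<exists>N\<in>(`) f ` \<N>. y \<in> N \<and> N \<subseteq> U"
      by (intro bexI[of _ "f ` N"]) force+
  qed
  moreover have "regular_T1_space Z"
    using assms homeomorphic_regular_space homeomorphic_t1_space
    unfolding cosmic_space_def regular_T1_space_def by blast
  ultimately show ?thesis
    using \<N>(1) unfolding cosmic_space_def by blast
qed

lemma cosmic_space_imp_Hausdorff: "cosmic_space Y \<Longrightarrow> Hausdorff_space Y"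
  unfolding cosmic_space_def regular_T1_space_def using regular_t1_imp_Hausdorff_space by blast

lemma cosmic_space_subtopology:
  assumes "cosmic_space Y" shows "cosmic_space (subtopology Y A)"
proof -
  obtain \<N> where \<N>: "countable \<N>" "network_in Y \<N>" using assms cosmic_space_def by blast
  have "network_in (subtopology Y A) ((\<lambda>N. N \<inter> A) ` \<N>)"
    unfolding network_in_def
  proof (intro conjI allI impI ballI)
    fix N assume "N \<in> (\<lambda>N. N \<inter> A) ` \<N>"
    then show "N \<subseteq> topspace (subtopology Y A)"
      using \<N>(2) unfolding network_in_def by auto
  next
    fix y U assume U: "openin (subtopology Y A) U \<and> y \<in> U"
    then obtain V where "openin Y V" "U = V \<inter> A" by (auto simp: openin_subtopology)
    with U \<N>(2) obtain N where "N \<in> \<N>" "y \<in> N" "N \<subseteq> V" unfolding network_in_def by blast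
    then show "\<exists>N\<in>(\<lambda>N. N \<inter> A) ` \<N>. y \<in> N \<and> N \<subseteq> U"
      using U \<open>U = V \<inter> A\<close> by (intro bexI[of _ "N \<inter> A"]) auto
  qed
  then show ?thesis
    using \<N>(1) assms unfolding cosmic_space_def regular_T1_space_def
    by (meson countable_image regular_space_subtopology t1_space_subtopology)
qed

text \<open>Monotone sequential form of the k_omega property. Closedness of the traces is asked in
  \<open>Y\<close> itself and not in the compact subspaces; for Hausdorff spaces this is the same,
  and it avoids nested subtopologies.\<close>

definition compact_exhaustion :: "'a topology \<Rightarrow> (nat \<Rightarrow> 'a set) \<Rightarrow> bool" where
  "compact_exhaustion Y K \<longleftrightarrow> (\<forall>n. compactin Y (K n)) \<and> incseq K \<and> (\<Union>n. K n) = topspace Y \<and>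
     (\<forall>F. F \<subseteq> topspace Y \<and> (\<forall>n. closedin Y (F \<inter> K n)) \<longrightarrow> closedin Y F)"

lemma compact_exhaustionD:
  assumes "compact_exhaustion Y K"
  shows "compactin Y (K n)" and "incseq K" and "(\<Union>n. K n) = topspace Y"
    and "\<And>F. F \<subseteq> topspace Y \<Longrightarrow> (\<And>n. closedin Y (F \<inter> K n)) \<Longrightarrow> closedin Y F"
  using assms unfolding compact_exhaustion_def by blast+

lemma compact_exhaustion_openin:
  assumes K: "compact_exhaustion Y K" and H: "Hausdorff_space Y" and U: "U \<subseteq> topspace Y"
    and op: "\<And>n. openin (subtopology Y (K n)) (U \<inter> K n)"
  shows "openin Y U"
proof -
  note D = compact_exhaustionD[OF K]
  have "closedin Y (topspace Y - U)"
  proof (rule D(4))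
    fix n
    have "closedin (subtopology Y (K n)) (topspace (subtopology Y (K n)) - U \<inter> K n)"
      using op by blast
    moreover have "topspace (subtopology Y (K n)) - U \<inter> K n = (topspace Y - U) \<inter> K n" by auto
    ultimately show "closedin Y ((topspace Y - U) \<inter> K n)"
      using compactin_imp_closedin[OF H D(1)] closedin_closed_subtopology by metis
  qed auto
  then show ?thesis using U by (simp add: openin_closedin_eq)
qed

lemma k_omega_space_iff_exhaustion:
  assumes H: "Hausdorff_space Y"
  shows "k_omega_space Y \<longleftrightarrow> (\<exists>K. compact_exhaustion Y K)"
proof
  assume "k_omega_space Y"
  then obtain \<K> where \<K>: "countable \<K>" "\<And>K. K \<in> \<K> \<Longrightarrow> compactin Y K" "\<Union>\<K> = topspace Y"
    "\<And>F. F \<subseteq> topspace Y \<Longrightarrow> closedin Y F \<longleftrightarrow> (\<forall>K\<in>\<K>. closedin (subtopology Y K) (F \<inter> K))"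
    unfolding k_omega_space_def by metis
  \<comment> \<open>The empty set is adjoined so that the family is nonempty and the enumeration has
    exactly this range.\<close>
  define e where "e = from_nat_into (insert {} \<K>)"
  have e: "range e = insert {} \<K>" unfolding e_def using \<K>(1) by (simp add: range_from_nat_into)
  have ce: "compactin Y (e n)" for n
    using \<K>(2) e by (metis compactin_empty insertE rangeI)
  define L where "L n = (\<Union>i\<le>n. e i)" for n
  have cL: "compactin Y (L n)" for n unfolding L_def by (rule compactin_Union) (use ce in auto)
  have "(\<Union>n. L n) = \<Union>(range e)" unfolding L_def by auto
  then have UL: "(\<Union>n. L n) = topspace Y" using e \<K>(3) by auto
  have "closedin Y F" if F: "F \<subseteq> topspace Y" "\<And>n. closedin Y (F \<inter> L n)" for F
  proof -
    have "closedin (subtopology Y K) (F \<inter> K)" if "K \<in> \<K>" for K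
    proof -
      obtain n where n: "K = e n" using e \<open>K \<in> \<K>\<close> by (metis insertI2 rangeE)
      have "F \<inter> K = F \<inter> L n \<inter> K" unfolding L_def n by auto
      then show ?thesis using F(2)[of n] by (auto simp: closedin_subtopology)
    qed
    then show ?thesis using \<K>(4)[OF F(1)] by blast
  qed
  then have "compact_exhaustion Y L"
    unfolding compact_exhaustion_def using cL UL
    by (auto simp: L_def incseq_def) (meson atMost_iff order_trans)
  then show "\<exists>K. compact_exhaustion Y K" by blast
next
  assume "\<exists>K. compact_exhaustion Y K"
  then obtain K where K: "compact_exhaustion Y K" by blast
  note D = compact_exhaustionD[OF K]
  have "closedin Y F \<longleftrightarrow> (\<forall>A\<in>range K. closedin (subtopology Y A) (F \<inter> A))"
    if "F \<subseteq> topspace Y" for F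
  proof
    assume "closedin Y F"
    then show "\<forall>A\<in>range K. closedin (subtopology Y A) (F \<inter> A)"
      by (auto simp: closedin_subtopology)
  next
    assume "\<forall>A\<in>range K. closedin (subtopology Y A) (F \<inter> A)"
    then have "closedin Y (F \<inter> K n)" for n
      using compactin_imp_closedin[OF H D(1)] closedin_closed_subtopology by blast
    then show "closedin Y F" using D(4) that by blast
  qed
  then show "k_omega_space Y"
    unfolding k_omega_space_def
  proof (intro exI[of _ "range K"] conjI)
    show "\<Union>(range K) = topspace Y" by (rule D(3))
  qed (use D(1) in auto)
qed

lemma homeomorphic_compact_exhaustion:
  assumes f: "homeomorphic_map Y Z f" and K: "compact_exhaustion Y K"
  shows "compact_exhaustion Z (\<lambda>n. f ` K n)"
proof -
  note D = compact_exhaustionD[OF K]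
  have ft: "f ` topspace Y = topspace Z" by (rule homeomorphic_imp_surjective_map[OF f])
  have inj: "inj_on f (topspace Y)" using f homeomorphic_imp_injective_map by blast
  have sub: "K n \<subseteq> topspace Y" for n using D(1) compactin_subset_topspace by blast
  have "closedin Z F" if F: "F \<subseteq> topspace Z" "\<And>n. closedin Z (F \<inter> f ` K n)" for F
  proof -
    obtain G where G: "G \<subseteq> topspace Y" "F = f ` G" using F(1) ft by (metis subset_imageE)
    have "closedin Y (G \<inter> K n)" for n
    proof -
      have "f ` (G \<inter> K n) = F \<inter> f ` K n"
        unfolding G(2) by (rule inj_on_image_Int[OF inj G(1) sub])
      moreover have "G \<inter> K n \<subseteq> topspace Y" using G by auto
      ultimately show ?thesis
        using homeomorphic_map_closedness[OF f, of "G \<inter> K n"] F(2)[of n] by simp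
    qed
    then have "closedin Y G" using D(4) G(1) by blast
    then show ?thesis using homeomorphic_map_closedness_eq[OF f] G by metis
  qed
  moreover have "compactin Z (f ` K n)" for n
    using D(1) homeomorphic_map_compactness_eq[OF f] by blast
  moreover have "(\<Union>n. f ` K n) = topspace Z" using D(3) ft by (metis image_UN)
  moreover have "incseq (\<lambda>n. f ` K n)" using D(2) by (auto simp: incseq_def)
  ultimately show ?thesis unfolding compact_exhaustion_def by blast
qed

lemma cosmic_k_omega_space_iff:
  "cosmic_k_omega_space Y \<longleftrightarrow> cosmic_space Y \<and> (\<exists>K. compact_exhaustion Y K)"
  unfolding cosmic_k_omega_space_def
  using k_omega_space_iff_exhaustion cosmic_space_imp_Hausdorff by blast

lemma homeomorphic_cosmic_k_omega_space:
  assumes h: "Y homeomorphic_space Z" and Y: "cosmic_k_omega_space Y"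
  shows "cosmic_k_omega_space Z"
  using assms homeomorphic_compact_exhaustion homeomorphic_cosmic_space
  unfolding cosmic_k_omega_space_iff homeomorphic_space by metis

lemma cosmic_k_omega_space_closed_subtopology:
  assumes Y: "cosmic_k_omega_space Y" and C: "closedin Y C"
  shows "cosmic_k_omega_space (subtopology Y C)"
proof -
  obtain K where K: "compact_exhaustion Y K" using Y cosmic_k_omega_space_iff by blast
  note D = compact_exhaustionD[OF K]
  have CY: "C \<subseteq> topspace Y" using C closedin_subset by blast
  have "compactin (subtopology Y C) (C \<inter> K n)" for n
    using C D(1) by (auto simp: compactin_subtopology closed_Int_compactin)
  moreover have "incseq (\<lambda>n. C \<inter> K n)" using D(2) by (auto simp: incseq_def)
  moreover have "(\<Union>n. C \<inter> K n) = topspace (subtopology Y C)"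
    using D(3) CY by auto
  moreover have "closedin (subtopology Y C) F"
    if F: "F \<subseteq> topspace (subtopology Y C)" "\<And>n. closedin (subtopology Y C) (F \<inter> (C \<inter> K n))" for F
  proof -
    have FC: "F \<subseteq> C" using F(1) by auto
    then have "F \<inter> (C \<inter> K n) = F \<inter> K n" for n by auto
    then have "closedin Y (F \<inter> K n)" for n
      using F(2)[of n] closedin_closed_subtopology[OF C] by metis
    then have "closedin Y F" using D(4)[of F] FC CY by auto
    then show ?thesis using closedin_closed_subtopology[OF C] FC by auto
  qed
  ultimately have "compact_exhaustion (subtopology Y C) (\<lambda>n. C \<inter> K n)"
    unfolding compact_exhaustion_def by blast
  then show ?thesis
    using Y cosmic_space_subtopology unfolding cosmic_k_omega_space_iff by blast
qed

section \<open>Clopen partitions as internal topological sums\<close>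

text \<open>Pieces inside the space pass to subspaces and to the semilattice without relabelling
  points. Excluding the empty piece lets every piece be indexed by one of its own points, as the
  index type of \<open>topological_sum_of\<close> demands.\<close>

definition cosmic_k_omega_partition :: "'a topology \<Rightarrow> 'a set set \<Rightarrow> bool" where
  "cosmic_k_omega_partition Y \<U> \<longleftrightarrow> disjoint \<U> \<and> \<Union>\<U> = topspace Y \<and> {} \<notin> \<U> \<and>
     (\<forall>U\<in>\<U>. openin Y U \<and> cosmic_k_omega_space (subtopology Y U))"

lemma cosmic_k_omega_partitionD:
  assumes "cosmic_k_omega_partition Y \<U>"
  shows "disjoint \<U>" "\<Union>\<U> = topspace Y" "{} \<notin> \<U>" "\<And>U. U \<in> \<U> \<Longrightarrow> openin Y U"
    "\<And>U. U \<in> \<U> \<Longrightarrow> cosmic_k_omega_space (subtopology Y U)"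
    "\<And>\<V>. \<V> \<subseteq> \<U> \<Longrightarrow> closedin Y (\<Union>\<V>)"
proof -
  note * = assms[unfolded cosmic_k_omega_partition_def]
  show "disjoint \<U>" "\<Union>\<U> = topspace Y" "{} \<notin> \<U>" "\<And>U. U \<in> \<U> \<Longrightarrow> openin Y U"
    "\<And>U. U \<in> \<U> \<Longrightarrow> cosmic_k_omega_space (subtopology Y U)" using * by blast+
  fix \<V> assume V: "\<V> \<subseteq> \<U>"
  have "topspace Y - \<Union>\<V> = \<Union>(\<U> - \<V>)"
  proof
    show "\<Union>(\<U> - \<V>) \<subseteq> topspace Y - \<Union>\<V>"
    proof
      fix x assume "x \<in> \<Union>(\<U> - \<V>)"
      then obtain U where U: "U \<in> \<U>" "U \<notin> \<V>" "x \<in> U" by blast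
      have "x \<notin> W" if "W \<in> \<V>" for W
        using disjointD[OF conjunct1[OF *] U(1), of W] U that V by blast
      then show "x \<in> topspace Y - \<Union>\<V>" using U * by blast
    qed
  qed (use * in blast)
  moreover have "openin Y (\<Union>(\<U> - \<V>))" using * by (intro openin_Union) auto
  moreover have "\<Union>\<V> \<subseteq> topspace Y" using * V by blast
  ultimately show "closedin Y (\<Union>\<V>)" by (simp add: closedin_def)
qed

lemma homeomorphic_cosmic_k_omega_partition:
  assumes h: "Y homeomorphic_space Z" and Y: "cosmic_k_omega_partition Y \<U>"
  shows "\<exists>\<V>. cosmic_k_omega_partition Z \<V>"
proof -
  obtain f where f: "homeomorphic_map Y Z f" using h homeomorphic_space by blast
  have ft: "f ` topspace Y = topspace Z" by (rule homeomorphic_imp_surjective_map[OF f])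
  have inj: "inj_on f (topspace Y)" using f homeomorphic_imp_injective_map by blast
  note D = cosmic_k_omega_partitionD[OF Y]
  have "cosmic_k_omega_partition Z ((`) f ` \<U>)"
    unfolding cosmic_k_omega_partition_def
  proof (intro conjI ballI)
    show "disjoint ((`) f ` \<U>)"
      using D(1,2) inj by (simp add: disjoint_image)
    show "\<Union>((`) f ` \<U>) = topspace Z" using D(2) ft by (metis image_Union)
    show "{} \<notin> (`) f ` \<U>" using D(3) by auto
    fix V assume "V \<in> (`) f ` \<U>"
    then obtain U where U: "U \<in> \<U>" "V = f ` U" by auto
    show "openin Z V" using D(4)[OF U(1)] U(2) f homeomorphic_map_openness_eq by blast
    have "f ` (topspace Y \<inter> U) = topspace Z \<inter> V"
      using U D(2) ft by blast
    from homeomorphic_map_subtopologies[OF f this]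
    have "subtopology Y U homeomorphic_space subtopology Z V"
      unfolding homeomorphic_space by blast
    then show "cosmic_k_omega_space (subtopology Z V)"
      using D(5)[OF U(1)] homeomorphic_cosmic_k_omega_space by blast
  qed
  then show ?thesis by blast
qed

lemma topological_sum_of_cosmic_k_omega_iff:
  "topological_sum_of cosmic_k_omega_space Y \<longleftrightarrow> (\<exists>\<U>. cosmic_k_omega_partition Y \<U>)"
proof
  assume "topological_sum_of cosmic_k_omega_space Y"
  then obtain I :: "'a set" and Z :: "'a \<Rightarrow> 'a topology" where
    Z: "\<And>i. i \<in> I \<Longrightarrow> cosmic_k_omega_space (Z i)" and h: "Y homeomorphic_space sum_topology Z I"
    unfolding topological_sum_of_def by blast
  \<comment> \<open>The pieces are the fibres over the indices; empty fibres are removed below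
    because a partition admits no empty piece.\<close>
  define P where "P i = {i} \<times> topspace (Z i)" for i
  have P: "P i = Pair i ` topspace (Z i)" for i unfolding P_def by auto
  have "cosmic_k_omega_partition (sum_topology Z I) (P ` I - {{}})"
    unfolding cosmic_k_omega_partition_def
  proof (intro conjI ballI)
    show "disjoint (P ` I - {{}})" by (auto simp: disjoint_def P_def)
    show "\<Union>(P ` I - {{}}) = topspace (sum_topology Z I)"
    proof
      show "topspace (sum_topology Z I) \<subseteq> \<Union>(P ` I - {{}})"
      proof
        fix z assume "z \<in> topspace (sum_topology Z I)"
        then have "fst z \<in> I" "z \<in> P (fst z)" unfolding P_def by auto
        then show "z \<in> \<Union>(P ` I - {{}})" by blast
      qed
    qed (auto simp: P_def)
    show "{} \<notin> P ` I - {{}}" by auto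
    fix U assume "U \<in> P ` I - {{}}"
    then obtain i where i: "i \<in> I" "U = P i" by auto
    show "openin (sum_topology Z I) U"
      using open_map_component_injection[OF i(1), of Z] i(2) unfolding open_map_def P by auto
    have "Z i homeomorphic_space subtopology (sum_topology Z I) U"
      using embedding_map_imp_homeomorphic_space[OF embedding_map_component_injection[OF i(1), of Z]]
      unfolding i(2) P .
    then show "cosmic_k_omega_space (subtopology (sum_topology Z I) U)"
      using Z[OF i(1)] homeomorphic_cosmic_k_omega_space by blast
  qed
  then show "\<exists>\<U>. cosmic_k_omega_partition Y \<U>"
    using homeomorphic_cosmic_k_omega_partition h homeomorphic_space_sym by blast
next
  assume "\<exists>\<U>. cosmic_k_omega_partition Y \<U>"
  then obtain \<U> where \<U>: "cosmic_k_omega_partition Y \<U>" by blast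
  note D = cosmic_k_omega_partitionD[OF \<U>]
  define pc where "pc y = (THE U. U \<in> \<U> \<and> y \<in> U)" for y
  have pc: "pc y = U" if "U \<in> \<U>" "y \<in> U" for y U
    unfolding pc_def by (rule the_equality) (use that D(1) in \<open>auto simp: disjoint_def\<close>)
  \<comment> \<open>Indices have to be points of \<open>Y\<close>, so a piece is indexed by a chosen
    element of itself; disjointness lets \<open>pc\<close> recover the piece from that
    element.\<close>
  define c where "c U = (SOME y. y \<in> U)" for U :: "'a set"
  have c: "c U \<in> U" if "U \<in> \<U>" for U
    unfolding c_def using D(3) that by (metis ex_in_conv someI)
  define I where "I = c ` \<U>"
  define Z where "Z i = subtopology Y (pc i)" for i
  have sub: "U \<subseteq> topspace Y" if "U \<in> \<U>" for U using D(4)[OF that] openin_subset by blast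
  have Zc: "Z (c U) = subtopology Y U" if "U \<in> \<U>" for U
    using pc[OF that c[OF that]] by (simp add: Z_def)
  have "homeomorphic_map (sum_topology Z I) Y snd"
  proof (rule bijective_open_imp_homeomorphic_map)
    have *: "{x. (c U, x) \<in> {z \<in> Sigma I (topspace \<circ> Z). snd z \<in> V}} = U \<inter> V" if "U \<in> \<U>" for U V
      using Zc[OF that] sub[OF that] that by (auto simp: I_def)
    show "continuous_map (sum_topology Z I) Y snd"
      unfolding continuous_map_def topspace_sum_topology openin_sum_topology
    proof (intro conjI allI impI ballI)
      show "snd \<in> Sigma I (topspace \<circ> Z) \<rightarrow> topspace Y" by (auto simp: Z_def)
      fix V i assume V: "openin Y V" and i: "i \<in> I"
      obtain U where U: "U \<in> \<U>" "i = c U" using i by (auto simp: I_def)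
      show "openin (Z i) {x. (i, x) \<in> {z \<in> Sigma I (topspace \<circ> Z). snd z \<in> V}}"
        unfolding U(2) *[OF U(1)] Zc[OF U(1)] using V by (rule openin_subtopology_Int2)
    qed auto
    show "open_map (sum_topology Z I) Y snd"
      unfolding open_map_def
    proof (intro allI impI)
      fix W assume W: "openin (sum_topology Z I) W"
      have "snd ` W = (\<Union>i\<in>I. {x. (i,x) \<in> W})"
        using openin_subset[OF W] by force
      moreover have "openin Y {x. (i,x) \<in> W}" if i: "i \<in> I" for i
      proof -
        obtain U where U: "U \<in> \<U>" "i = c U" using i by (auto simp: I_def)
        have "openin (subtopology Y U) {x. (i,x) \<in> W}"
          using W i Zc[OF U(1)] U(2) unfolding openin_sum_topology by auto
        then show ?thesis using D(4)[OF U(1)] openin_trans_full by blast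
      qed
      ultimately show "openin Y (snd ` W)" by auto
    qed
    show "snd ` topspace (sum_topology Z I) = topspace Y"
    proof
      show "topspace Y \<subseteq> snd ` topspace (sum_topology Z I)"
      proof
        fix y assume "y \<in> topspace Y"
        then obtain U where U: "U \<in> \<U>" "y \<in> U" using D(2) by blast
        then have "(c U, y) \<in> topspace (sum_topology Z I)"
          using Zc[OF U(1)] sub[OF U(1)] by (auto simp: I_def)
        then show "y \<in> snd ` topspace (sum_topology Z I)" by force
      qed
    qed (auto simp: Z_def)
    have "i = c (pc x)" if "i \<in> I" "x \<in> topspace (Z i)" for i x
      using that pc Zc sub unfolding I_def by auto
    then show "inj_on snd (topspace (sum_topology Z I))"
      by (auto simp: inj_on_def)
  qed
  then have "Y homeomorphic_space sum_topology Z I"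
    using homeomorphic_space homeomorphic_space_sym by blast
  moreover have "cosmic_k_omega_space (Z i)" if "i \<in> I" for i
    using that Zc D(5) by (auto simp: I_def)
  ultimately show "topological_sum_of cosmic_k_omega_space Y"
    unfolding topological_sum_of_def by blast
qed

section \<open>Separation and products along compact exhaustions\<close>

text \<open>Compact Hausdorff stages are normal, so Tietze's theorem extends a function from one
  stage to the next together with the value 0 on the new part of \<open>F\<close>. The stages need
  not determine the topology of \<open>Y\<close>, hence continuity is claimed on each
  \<open>K n\<close> only; it becomes global later, either through an exhaustion or through the k_R
  property.\<close>

lemma separating_function_along_compacts:
  assumes H: "Hausdorff_space Y" and K: "\<And>n::nat. compactin Y (K n)" and inc: "incseq K"
    and F: "\<And>n. closedin Y (F \<inter> K n)" and x: "x \<in> topspace Y" "x \<notin> F"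
  obtains f :: "'a \<Rightarrow> real" where "\<And>n. continuous_map (subtopology Y (K n)) euclideanreal f"
    and "\<And>n y. y \<in> K n \<Longrightarrow> f y \<in> {0..1}" and "\<And>n y. y \<in> F \<inter> K n \<Longrightarrow> f y = 0" and "f x = 1"
proof -
  \<comment> \<open>\<open>x\<close> is adjoined to every stage and the stages are shifted by one,
    so the construction starts on \<open>{x}\<close>, where the constant 1 meets all requirements
    because \<open>x\<close> is not in \<open>F\<close>.\<close>
  define L where "L n = insert x (case n of 0 \<Rightarrow> {} | Suc m \<Rightarrow> K m)" for n
  have L: "compactin Y (L n)" for n
  proof -
    have "L n = {x} \<union> (case n of 0 \<Rightarrow> {} | Suc m \<Rightarrow> K m)" unfolding L_def by simp
    moreover have "compactin Y (case n of 0 \<Rightarrow> {} | Suc m \<Rightarrow> K m)" using K by (cases n) auto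
    ultimately show ?thesis using compactin_Un[of Y "{x}"] x by simp
  qed
  have LK: "L n \<subseteq> L (Suc n)" for n
  proof (cases n)
    case (Suc m)
    then show ?thesis using incseqD[OF inc, of m "Suc m"] by (auto simp: L_def)
  qed (simp add: L_def)
  have cL: "closedin Y (L n)" for n using compactin_imp_closedin[OF H L] .
  have FL: "F \<inter> L n = (case n of 0 \<Rightarrow> {} | Suc m \<Rightarrow> F \<inter> K m)" for n
    using x by (cases n) (auto simp: L_def)
  have cF: "closedin Y (F \<inter> L n)" for n unfolding FL using F by (cases n) auto
  define P where "P n f \<longleftrightarrow> continuous_map (subtopology Y (L n)) euclideanreal f \<and> f ` L n \<subseteq> {0..1} \<and>
      (\<forall>y\<in>F \<inter> L n. f y = 0) \<and> f x = 1" for n and f :: "'a \<Rightarrow> real"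
  have "\<exists>f. \<forall>n. P n (f n) \<and> (\<forall>y\<in>L n. f (Suc n) y = f n y)"
  proof (rule dependent_nat_choice)
    have "P 0 (\<lambda>_. 1)" unfolding P_def using x by (auto simp: L_def)
    then show "\<exists>f. P 0 f" by blast
  next
    fix f n assume f: "P n f"
    let ?Z = "subtopology Y (L (Suc n))"
    have "compact_space ?Z" "Hausdorff_space ?Z"
      using L[of "Suc n"] H by (simp_all add: compactin_subspace Hausdorff_space_subtopology)
    then have norm: "normal_space ?Z" using compact_Hausdorff_or_regular_imp_normal_space by blast
    \<comment> \<open>The old function and the value 0 are prescribed on two closed sets; they agree
      on the overlap because the old function already vanishes on
      \<open>F \<inter> L n\<close>.\<close>
    let ?C = "L n \<union> (F \<inter> L (Suc n))"
    define g where "g y = (if y \<in> L n then f y else 0)" for y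
    have CL: "?C \<subseteq> L (Suc n)" using LK by blast
    have "closedin Y ?C" using cL cF by blast
    then have clC: "closedin ?Z ?C" using CL closedin_closed_subtopology[OF cL] by blast
    have sub: "subtopology ?Z ?C = subtopology Y ?C"
      using CL by (simp add: subtopology_subtopology Int_absorb1)
    have "continuous_map (subtopology Y ?C) euclideanreal g"
    proof (rule pasting_lemma_closed[where I = "{True, False}" and
          T = "\<lambda>b. if b then L n else F \<inter> L (Suc n)" and f = "\<lambda>b. if b then f else (\<lambda>_. 0)"])
      fix b assume "b \<in> {True, False}"
      show "closedin (subtopology Y ?C) (if b then L n else F \<inter> L (Suc n))"
        using closedin_closed_subtopology[OF \<open>closedin Y ?C\<close>] cL cF by auto
      have "subtopology (subtopology Y ?C) (L n) = subtopology Y (L n)"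
        by (simp add: subtopology_subtopology Int_absorb1)
      then show "continuous_map (subtopology (subtopology Y ?C) (if b then L n else F \<inter> L (Suc n)))
          euclideanreal (if b then f else (\<lambda>_. 0))"
        using f unfolding P_def by auto
    next
      fix b b' y
      assume "b \<in> {True, False}" "b' \<in> {True, False}" "y \<in> topspace (subtopology Y ?C) \<inter>
          (if b then L n else F \<inter> L (Suc n)) \<inter> (if b' then L n else F \<inter> L (Suc n))"
      then show "(if b then f else (\<lambda>_. 0)) y = (if b' then f else (\<lambda>_. 0)) y"
        using f unfolding P_def by (auto split: if_splits)
    next
      fix y assume "y \<in> topspace (subtopology Y ?C)"
      then have y: "y \<in> ?C" by simp
      show "\<exists>j. j \<in> {True, False} \<and> y \<in> (if j then L n else F \<inter> L (Suc n)) \<and>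
          g y = (if j then f else (\<lambda>_. 0)) y"
      proof (cases "y \<in> L n")
        case True
        then show ?thesis by (intro exI[of _ True]) (simp add: g_def)
      next
        case False
        then show ?thesis using y by (intro exI[of _ False]) (simp add: g_def)
      qed
    qed simp
    then have cg: "continuous_map (subtopology ?Z ?C) euclideanreal g" unfolding sub .
    have g01: "g ` ?C \<subseteq> {0..1}" using f unfolding P_def g_def by auto
    obtain h where h: "continuous_map ?Z euclideanreal h" "\<And>y. y \<in> ?C \<Longrightarrow> h y = g y"
      "h ` topspace ?Z \<subseteq> {0..1}"
      by (rule Tietze_extension_closed_real_interval[OF norm clC cg g01]) auto
    have "topspace ?Z = L (Suc n)" using compactin_subset_topspace[OF L] by auto
    moreover have "h y = 0" if "y \<in> F \<inter> L (Suc n)" for y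
      using h(2)[of y] that f unfolding P_def g_def by auto
    moreover have "h x = 1" using h(2)[of x] f unfolding P_def g_def by (auto simp: L_def)
    ultimately have "P (Suc n) h" using h unfolding P_def by simp
    moreover have "\<forall>y\<in>L n. h y = f y" using h(2) by (simp add: g_def)
    ultimately show "\<exists>h. P (Suc n) h \<and> (\<forall>y\<in>L n. h y = f y)" by blast
  qed
  then obtain f where f: "\<And>n. P n (f n)" "\<And>n y. y \<in> L n \<Longrightarrow> f (Suc n) y = f n y" by metis
  have mono: "L m \<subseteq> L n" if "m \<le> n" for m n using lift_Suc_mono_le[of L, OF LK that] .
  have agree: "f n y = f m y" if "m \<le> n" "y \<in> L m" for m n y
    using that(1)
  proof (induction n rule: dec_induct)
    case (step n)
    then show ?case using f(2)[of y n] mono[of m n] that(2) by auto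
  qed simp
  \<comment> \<open>Later functions agree with earlier ones on earlier stages, so the value at the
    first stage containing \<open>y\<close> defines a common extension.\<close>
  define g where "g y = f (LEAST n. y \<in> L n) y" for y
  have g: "g y = f n y" if "y \<in> L n" for y n
    unfolding g_def by (rule agree[symmetric]) (use that in \<open>auto intro: Least_le LeastI\<close>)
  have KL: "K n \<subseteq> L (Suc n)" for n by (auto simp: L_def)
  have "continuous_map (subtopology Y (K n)) euclideanreal g" for n
  proof -
    have "continuous_map (subtopology Y (L (Suc n))) euclideanreal g"
      by (rule continuous_map_eq[of _ _ "f (Suc n)"]) (use f(1)[of "Suc n"] g in \<open>auto simp: P_def\<close>)
    then show ?thesis using KL continuous_map_from_subtopology_mono by blast
  qed
  moreover have "g y \<in> {0..1}" if "y \<in> K n" for n y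
  proof -
    have "y \<in> L (Suc n)" using KL that by blast
    then show ?thesis using g f(1)[of "Suc n"] unfolding P_def by auto
  qed
  moreover have "g y = 0" if "y \<in> F \<inter> K n" for n y
  proof -
    have y: "y \<in> F \<inter> L (Suc n)" using KL that by blast
    then have "f (Suc n) y = 0" using f(1)[of "Suc n"] unfolding P_def by blast
    then show ?thesis using g[of y "Suc n"] y by simp
  qed
  moreover have "g x = 1" using g[of x 0] f(1)[of 0] unfolding P_def by (simp add: L_def)
  ultimately show thesis using that by blast
qed

text \<open>Around a point of \<open>W\<close> a compact box is enlarged stage by stage inside
  \<open>W\<close>, each box lying in the relative interior of the next; the union of all boxes is
  an open box. This makes union continuous for the direct limit topology in
  \<open>compact_exhaustion_T\<close>; products of k-spaces in general do not behave so
  well.\<close>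

lemma compact_exhaustion_prod_openin:
  assumes K: "compact_exhaustion Y K" and H: "Hausdorff_space Y"
    and WY: "W \<subseteq> topspace Y \<times> topspace Y"
    and W: "\<And>n. openin (prod_topology (subtopology Y (K n)) (subtopology Y (K n))) (W \<inter> K n \<times> K n)"
  shows "openin (prod_topology Y Y) W"
  unfolding openin_prod_topology_alt
proof (intro allI impI)
  fix x y assume xy: "(x, y) \<in> W"
  note D = compact_exhaustionD[OF K]
  have mono: "K m \<subseteq> K n" if "m \<le> n" for m n using D(2) that by (simp add: incseqD)
  have "x \<in> (\<Union>n. K n)" "y \<in> (\<Union>n. K n)" unfolding D(3) using xy WY by auto
  then obtain i j where "x \<in> K i" "y \<in> K j" by blast
  then have xyK: "x \<in> K (i + j)" "y \<in> K (i + j)" using mono[of i "i+j"] mono[of j "i+j"] by auto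
  \<comment> \<open>Earlier stages are skipped so that the starting box
    \<open>{x} \<times> {y}\<close> lies in stage 0.\<close>
  define L where "L n = K (i + j + n)" for n
  have Lmono: "L m \<subseteq> L n" if "m \<le> n" for m n unfolding L_def by (rule mono) (use that in simp)
  define P where "P n p \<longleftrightarrow> compactin Y (fst p) \<and> compactin Y (snd p) \<and> fst p \<subseteq> L n \<and> snd p \<subseteq> L n \<and>
     x \<in> fst p \<and> y \<in> snd p \<and> fst p \<times> snd p \<subseteq> W" for n p
  \<comment> \<open>The open sets live in all of \<open>Y\<close>, but only their traces on the next
    stage have to stay inside the next box.\<close>
  define Q where "Q n p q \<longleftrightarrow> (\<exists>U V. openin Y U \<and> openin Y V \<and> fst p \<subseteq> U \<and> snd p \<subseteq> V \<and>
     U \<inter> L (Suc n) \<subseteq> fst q \<and> V \<inter> L (Suc n) \<subseteq> snd q)" for n and p q :: "'a set \<times> 'a set"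
  have "\<exists>f. \<forall>n. P n (f n) \<and> Q n (f n) (f (Suc n))"
  proof (rule dependent_nat_choice)
    have "x \<in> topspace Y" "y \<in> topspace Y" using xy WY by auto
    then have "P 0 ({x}, {y})" unfolding P_def L_def using xyK xy by simp
    then show "\<exists>p. P 0 p" by blast
  next
    fix p n assume p: "P n p"
    let ?Z = "subtopology Y (L (Suc n))"
    have cH: "compact_space ?Z" "Hausdorff_space ?Z"
      using D(1) H unfolding L_def by (simp_all add: compactin_subspace Hausdorff_space_subtopology)
    then have norm: "normal_space ?Z" using compact_Hausdorff_or_regular_imp_normal_space by blast
    have pL: "fst p \<subseteq> L (Suc n)" "snd p \<subseteq> L (Suc n)" using p Lmono[of n "Suc n"] unfolding P_def by auto
    have cp: "compactin ?Z (fst p)" "compactin ?Z (snd p)"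
      using p pL unfolding P_def compactin_subtopology by auto
    have sub: "fst p \<times> snd p \<subseteq> W \<inter> L (Suc n) \<times> L (Suc n)" using p pL unfolding P_def by auto
    \<comment> \<open>Wallace's theorem puts a relatively open box between the compact box and
      \<open>W\<close>; normality of the compact stage then fits a larger compact box with enough
      interior in between.\<close>
    obtain U V where UV: "openin ?Z U" "openin ?Z V" "fst p \<subseteq> U" "snd p \<subseteq> V"
      "U \<times> V \<subseteq> W \<inter> L (Suc n) \<times> L (Suc n)"
      using Wallace_theorem_prod_topology[OF cp W[of "i + j + Suc n", folded L_def] sub] by blast
    have shrink: "\<exists>A U'. closedin ?Z A \<and> openin ?Z U' \<and> B \<subseteq> U' \<and> U' \<subseteq> A \<and> A \<subseteq> U"
      if "compactin ?Z B" "openin ?Z U" "B \<subseteq> U" for B U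
    proof -
      have "closedin ?Z B" using compactin_imp_closedin[OF cH(2) that(1)] .
      moreover have "closedin ?Z (topspace ?Z - U)" using that(2) by blast
      moreover have "disjnt B (topspace ?Z - U)" using that(3) by (auto simp: disjnt_def)
      ultimately obtain U' V' where *: "openin ?Z U'" "openin ?Z V'" "B \<subseteq> U'" "topspace ?Z - U \<subseteq> V'" "disjnt U' V'"
        using norm unfolding normal_space_def by meson
      have "closedin ?Z (topspace ?Z - V')" using *(2) by blast
      moreover have "U' \<subseteq> topspace ?Z - V'" using *(5) openin_subset[OF *(1)] by (auto simp: disjnt_def)
      moreover have "topspace ?Z - V' \<subseteq> U" using *(4) by blast
      ultimately show ?thesis using *(1,3) by blast
    qed
    obtain A U' where A: "closedin ?Z A" "openin ?Z U'" "fst p \<subseteq> U'" "U' \<subseteq> A" "A \<subseteq> U"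
      using shrink[OF cp(1) UV(1,3)] by blast
    obtain B V' where B: "closedin ?Z B" "openin ?Z V'" "snd p \<subseteq> V'" "V' \<subseteq> B" "B \<subseteq> V"
      using shrink[OF cp(2) UV(2,4)] by blast
    have "compactin ?Z A" "compactin ?Z B"
      using A(1) B(1) cH(1) closedin_compact_space by blast+
    then have AB: "compactin Y A" "A \<subseteq> L (Suc n)" "compactin Y B" "B \<subseteq> L (Suc n)"
      unfolding compactin_subtopology by auto
    have AW: "A \<times> B \<subseteq> W" using A(5) B(5) UV(5) by blast
    have xA: "x \<in> A" "y \<in> B" using p A B unfolding P_def by blast+
    have "P (Suc n) (A, B)" unfolding P_def using AB AW xA by simp
    moreover have "Q n p (A, B)"
    proof -
      obtain U1 V1 where "openin Y U1" "U' = U1 \<inter> L (Suc n)" "openin Y V1" "V' = V1 \<inter> L (Suc n)"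
        using A(2) B(2) unfolding openin_subtopology by blast
      then show ?thesis using A(3,4) B(3,4) unfolding Q_def fst_conv snd_conv by blast
    qed
    ultimately show "\<exists>q. P (Suc n) q \<and> Q n p q" by blast
  qed
  then obtain f where f: "\<And>n. P n (f n)" "\<And>n. Q n (f n) (f (Suc n))" by blast
  \<comment> \<open>A point of the union that lies in \<open>K m\<close> belongs to
    \<open>A (n + m)\<close> for some \<open>n\<close>, and the next set
    \<open>A (Suc (n + m))\<close> contains a neighbourhood of it relative to
    \<open>K m\<close>.\<close>
  have op: "openin Y (\<Union>n. A n)"
    if AL: "\<And>n. A n \<subseteq> L n" and AU: "\<And>n. \<exists>U. openin Y U \<and> A n \<subseteq> U \<and> U \<inter> L (Suc n) \<subseteq> A (Suc n)" for A
  proof (rule compact_exhaustion_openin[OF K H])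
    show "(\<Union>n. A n) \<subseteq> topspace Y"
      using AL compactin_subset_topspace[OF D(1)] unfolding L_def by blast
    have "A n \<subseteq> A (Suc n)" for n
    proof -
      obtain U where "A n \<subseteq> U" "U \<inter> L (Suc n) \<subseteq> A (Suc n)" using AU[of n] by auto
      moreover have "A n \<subseteq> L (Suc n)" using AL[of n] Lmono[of n "Suc n"] by simp
      ultimately show ?thesis by auto
    qed
    then have Amono: "A m \<subseteq> A n" if "m \<le> n" for m n by (rule lift_Suc_mono_le[OF _ that])
    fix m
    show "openin (subtopology Y (K m)) ((\<Union>n. A n) \<inter> K m)"
    proof (subst openin_subopen, intro ballI)
      fix z assume z: "z \<in> (\<Union>n. A n) \<inter> K m"
      then obtain n where "z \<in> A n" by blast
      then have zA: "z \<in> A (n + m)" using Amono[of n "n+m"] by auto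
      obtain U where U: "openin Y U" "A (n + m) \<subseteq> U" "U \<inter> L (Suc (n + m)) \<subseteq> A (Suc (n + m))"
        using AU by blast
      have "K m \<subseteq> L (Suc (n + m))" unfolding L_def by (rule mono) simp
      then have "U \<inter> K m \<subseteq> (\<Union>n. A n) \<inter> K m" using U(3) by blast
      moreover have "z \<in> U \<inter> K m" using zA U(2) z by blast
      moreover have "openin (subtopology Y (K m)) (U \<inter> K m)" using U(1) by (rule openin_subtopology_Int)
      ultimately show "\<exists>O'. openin (subtopology Y (K m)) O' \<and> z \<in> O' \<and> O' \<subseteq> (\<Union>n. A n) \<inter> K m" by blast
    qed
  qed
  have "openin Y (\<Union>n. fst (f n))"
  proof (rule op)
    show "fst (f n) \<subseteq> L n" for n using f(1)[of n] unfolding P_def by blast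
    show "\<exists>U. openin Y U \<and> fst (f n) \<subseteq> U \<and> U \<inter> L (Suc n) \<subseteq> fst (f (Suc n))" for n
      using f(2)[of n] unfolding Q_def by blast
  qed
  moreover have "openin Y (\<Union>n. snd (f n))"
  proof (rule op)
    show "snd (f n) \<subseteq> L n" for n using f(1)[of n] unfolding P_def by blast
    show "\<exists>U. openin Y U \<and> snd (f n) \<subseteq> U \<and> U \<inter> L (Suc n) \<subseteq> snd (f (Suc n))" for n
      using f(2)[of n] unfolding Q_def by blast
  qed
  moreover have "x \<in> (\<Union>n. fst (f n))" "y \<in> (\<Union>n. snd (f n))"
    using f(1)[of 0] unfolding P_def by blast+
  moreover have "(\<Union>n. fst (f n)) \<times> (\<Union>n. snd (f n)) \<subseteq> W"
  proof clarify
    fix a b m n assume ab: "a \<in> fst (f m)" "b \<in> snd (f n)"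
    have "fst (f n) \<subseteq> fst (f (Suc n))" "snd (f n) \<subseteq> snd (f (Suc n))" for n
    proof -
      obtain U V where "fst (f n) \<subseteq> U" "snd (f n) \<subseteq> V" "U \<inter> L (Suc n) \<subseteq> fst (f (Suc n))"
        "V \<inter> L (Suc n) \<subseteq> snd (f (Suc n))"
        using f(2)[of n] unfolding Q_def by auto
      moreover have "fst (f n) \<subseteq> L (Suc n)" "snd (f n) \<subseteq> L (Suc n)"
        using f(1)[of n] Lmono[of n "Suc n"] unfolding P_def by auto
      ultimately show "fst (f n) \<subseteq> fst (f (Suc n))" "snd (f n) \<subseteq> snd (f (Suc n))" by auto
    qed
    then have "fst (f m) \<subseteq> fst (f (m + n))" "snd (f n) \<subseteq> snd (f (m + n))"
      using lift_Suc_mono_le[of "\<lambda>n. fst (f n)"] lift_Suc_mono_le[of "\<lambda>n. snd (f n)"] by auto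
    then show "(a, b) \<in> W" using ab f(1)[of "m + n"] unfolding P_def by blast
  qed
  ultimately show "\<exists>U V. openin Y U \<and> openin Y V \<and> x \<in> U \<and> y \<in> V \<and> U \<times> V \<subseteq> W" by blast
qed

text \<open>Otherwise points \<open>c n\<close> of \<open>C\<close> outside \<open>K n\<close> form
  an infinite set meeting each stage in a finite set. All its subsets are then closed, so it has no
  accumulation point, against compactness of \<open>C\<close>.\<close>

lemma compact_exhaustion_absorbs:
  assumes K: "compact_exhaustion Y K" and H: "Hausdorff_space Y" and C: "compactin Y C"
  obtains n where "C \<subseteq> K n"
proof (rule ccontr)
  assume "\<not> thesis"
  then have "\<forall>n. \<exists>c. c \<in> C \<and> c \<notin> K n" using that by blast
  then obtain c where c: "\<And>n. c n \<in> C" "\<And>n. c n \<notin> K n" by metis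
  note D = compact_exhaustionD[OF K]
  have mono: "K m \<subseteq> K n" if "m \<le> n" for m n using D(2) that by (simp add: incseqD)
  have CY: "C \<subseteq> topspace Y" using C compactin_subset_topspace by blast
  have cl: "closedin Y E" if E: "E \<subseteq> range c" for E
  proof (rule D(4))
    show "E \<subseteq> topspace Y" using that c CY by blast
    fix n
    have "E \<inter> K n \<subseteq> c ` {..<n}"
    proof
      fix z assume z: "z \<in> E \<inter> K n"
      then obtain i where i: "z = c i" using E by blast
      then have "i < n" using z c(2)[of i] mono[of n i] by (metis IntD2 linorder_not_less subsetD)
      then show "z \<in> c ` {..<n}" using i by simp
    qed
    then have "finite (E \<inter> K n)" using finite_subset by blast
    moreover have "E \<inter> K n \<subseteq> topspace Y" using \<open>E \<subseteq> topspace Y\<close> by blast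
    ultimately show "closedin Y (E \<inter> K n)"
      using Hausdorff_imp_t1_space[OF H] t1_space_closedin_finite by blast
  qed
  have inf: "infinite (range c)"
  proof
    assume fin: "finite (range c)"
    have "\<forall>z\<in>range c. \<exists>n. z \<in> K n" using D(3) c(1) CY by blast
    then obtain k where k: "\<And>z. z \<in> range c \<Longrightarrow> z \<in> K (k z)" by metis
    define N where "N = Max (k ` range c)"
    have "k (c N) \<le> N" unfolding N_def using fin by simp
    then show False using k[of "c N"] c(2)[of N] mono by blast
  qed
  have "C \<inter> Y derived_set_of (range c) \<noteq> {}"
    by (rule compactin_imp_Bolzano_Weierstrass[OF C]) (use inf c in auto)
  then obtain z where z: "z \<in> Y derived_set_of (range c)" by blast
  then have zY: "z \<in> topspace Y" by (simp add: derived_set_of_def)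
  have "openin Y (topspace Y - (range c - {z}))" using cl[of "range c - {z}"] by blast
  moreover have "z \<in> topspace Y - (range c - {z})" using zY by blast
  ultimately have "\<exists>w. w \<noteq> z \<and> w \<in> range c \<and> w \<in> topspace Y - (range c - {z})"
    using z unfolding in_derived_set_of by (elim conjE allE impE) (rule conjI)
  then show False by blast
qed

section \<open>Countable closed k-networks on compact sets of cosmic spaces\<close>

text \<open>Any two disjoint closures of network members are separated by fixed open sets
  \<open>W p\<close> and \<open>V p\<close>. The complements in \<open>K\<close> of finite unions of
  sets \<open>V p\<close> are countably many closed sets, and each contains the intersection of the
  corresponding \<open>W p\<close>. Given \<open>z\<close> in \<open>U\<close>, the compact set
  \<open>K - U\<close> is covered by finitely many \<open>V p\<close> with \<open>z\<close> in
  \<open>W p\<close>, so a complement of this kind is a neighbourhood of \<open>z\<close> in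
  \<open>K\<close> inside \<open>U\<close>.\<close>

lemma compact_countable_k_network:
  assumes Y: "cosmic_space Y" and K: "compactin Y K"
  obtains \<M> where "countable \<M>" and "\<And>M. M \<in> \<M> \<Longrightarrow> closedin Y M" and "\<And>M. M \<in> \<M> \<Longrightarrow> M \<subseteq> K"
    and "\<And>C U. compactin Y C \<Longrightarrow> C \<subseteq> K \<Longrightarrow> openin Y U \<Longrightarrow> C \<subseteq> U \<Longrightarrow>
      \<exists>\<F>. finite \<F> \<and> \<F> \<subseteq> \<M> \<and> C \<subseteq> \<Union>\<F> \<and> \<Union>\<F> \<subseteq> U"
proof -
  let ?Z = "subtopology Y K"
  have H: "Hausdorff_space Y" by (rule cosmic_space_imp_Hausdorff[OF Y])
  have KY: "K \<subseteq> topspace Y" using K compactin_subset_topspace by blast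
  then have tZ: "topspace ?Z = K" by auto
  have clK: "closedin Y K" by (rule compactin_imp_closedin[OF H K])
  obtain \<N> where \<N>: "countable \<N>" "network_in ?Z \<N>"
    using cosmic_space_subtopology[OF Y] unfolding cosmic_space_def by blast
  have HZ: "Hausdorff_space ?Z" using H Hausdorff_space_subtopology by blast
  have cZ: "compact_space ?Z" using K compactin_subspace by blast
  have reg: "regular_space ?Z" using cZ HZ compact_Hausdorff_imp_regular_space by blast
  have norm: "normal_space ?Z" using cZ HZ compact_Hausdorff_or_regular_imp_normal_space by blast
  define \<C> where "\<C> = (\<lambda>N. ?Z closure_of N) ` \<N>"
  have cC: "countable \<C>" unfolding \<C>_def using \<N>(1) by simp
  have clC: "closedin ?Z N" if "N \<in> \<C>" for N using that unfolding \<C>_def by auto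
  have netC: "\<exists>N\<in>\<C>. z \<in> N \<and> N \<subseteq> U" if U: "openin ?Z U" "z \<in> U" for z U
  proof -
    obtain V D where VD: "openin ?Z V" "closedin ?Z D" "z \<in> V" "V \<subseteq> D" "D \<subseteq> U"
      using reg U unfolding neighbourhood_base_of_closedin[symmetric] neighbourhood_base_of by meson
    obtain N where N: "N \<in> \<N>" "z \<in> N" "N \<subseteq> V" using \<N>(2) VD unfolding network_in_def by meson
    have "N \<subseteq> topspace ?Z" using \<N>(2) N(1) unfolding network_in_def by blast
    then have "z \<in> ?Z closure_of N" using closure_of_subset N(2) by blast
    moreover have "?Z closure_of N \<subseteq> U" using closure_of_minimal[OF _ VD(2)] N(3) VD by blast
    ultimately show ?thesis using N(1) unfolding \<C>_def by blast
  qed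
  define D where "D = {p\<in>\<C>\<times>\<C>. disjnt (fst p) (snd p)}"
  have "\<forall>p\<in>D. \<exists>W V. openin ?Z W \<and> openin ?Z V \<and>
      fst p \<subseteq> W \<and> snd p \<subseteq> V \<and> disjnt W V"
  proof
    fix p assume "p \<in> D"
    then have "closedin ?Z (fst p)" "closedin ?Z (snd p)" "disjnt (fst p) (snd p)"
      using clC unfolding D_def by auto
    then show "\<exists>W V. openin ?Z W \<and> openin ?Z V \<and> fst p \<subseteq> W \<and> snd p \<subseteq> V \<and> disjnt W V"
      using norm unfolding normal_space_def by simp
  qed
  then obtain W where "\<forall>p\<in>D. \<exists>V. openin ?Z (W p) \<and> openin ?Z V \<and> fst p \<subseteq> W p \<and> snd p \<subseteq> V \<and> disjnt (W p) V"
    by (rule bchoice[THEN exE])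
  then obtain V where "\<forall>p\<in>D. openin ?Z (W p) \<and> openin ?Z (V p) \<and> fst p \<subseteq> W p \<and> snd p \<subseteq> V p \<and> disjnt (W p) (V p)"
    by (rule bchoice[THEN exE])
  then have WVD: "openin ?Z (W p)" "openin ?Z (V p)" "fst p \<subseteq> W p" "snd p \<subseteq> V p" "disjnt (W p) (V p)"
    if "p \<in> D" for p
    using that by auto
  have cD: "countable D" 
  proof (rule countable_subset)
    show "D \<subseteq> \<C> \<times> \<C>" unfolding D_def by blast
    show "countable (\<C> \<times> \<C>)" using cC by simp
  qed
  define \<M> where "\<M> = (\<lambda>E. K - \<Union>(V ` E)) ` {E. finite E \<and> E \<subseteq> D}"
  have "countable \<M>" unfolding \<M>_def
    using cD by (intro countable_image) (simp add: countable_Collect_finite_subset)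
  moreover have "closedin Y M" if M: "M \<in> \<M>" for M
  proof -
    obtain E where E: "E \<subseteq> D" "M = topspace ?Z - \<Union>(V ` E)" using M tZ unfolding \<M>_def by auto
    have "openin ?Z (\<Union>(V ` E))" by (rule openin_Union) (use WVD E in auto)
    then have "closedin ?Z M" unfolding E(2) by blast
    then show ?thesis using closedin_closed_subtopology[OF clK] by blast
  qed
  moreover have "M \<subseteq> K" if "M \<in> \<M>" for M using that unfolding \<M>_def by auto
  moreover have "\<exists>\<F>. finite \<F> \<and> \<F> \<subseteq> \<M> \<and> C \<subseteq> \<Union>\<F> \<and> \<Union>\<F> \<subseteq> U"
    if C: "compactin Y C" "C \<subseteq> K" and U: "openin Y U" "C \<subseteq> U" for C U
  proof -
    have loc: "\<exists>M P. M \<in> \<M> \<and> openin ?Z P \<and> z \<in> P \<and> P \<subseteq> M \<and> M \<subseteq> U" if z: "z \<in> C" for z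
    proof -
      have cKU: "compactin ?Z (K - U)"
      proof -
        have "closedin Y (K - U)" using clK U(1) by (simp add: closedin_diff)
        then have "compactin Y (K - U)" using closed_compactin[OF K] by blast
        then show ?thesis by (simp add: compactin_subtopology)
      qed
      have "\<exists>p. p \<in> D \<and> z \<in> fst p \<and> y \<in> snd p" if y: "y \<in> K - U" for y
      proof -
        have "y \<noteq> z" "y \<in> topspace ?Z" "z \<in> topspace ?Z" using y z U C tZ by auto
        then obtain A B where AB: "openin ?Z A" "openin ?Z B" "z \<in> A" "y \<in> B" "disjnt A B"
          using HZ unfolding Hausdorff_space_def by metis
        obtain N N' where N: "N \<in> \<C>" "z \<in> N" "N \<subseteq> A" "N' \<in> \<C>" "y \<in> N'" "N' \<subseteq> B"
          using netC[OF AB(1,3)] netC[OF AB(2,4)] by blast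
        have "disjnt N N'" using N AB(5) by (auto simp: disjnt_def)
        then have "(N, N') \<in> D" using N unfolding D_def by simp
        then show ?thesis using N(2,5) by (intro exI[of _ "(N, N')"]) simp
      qed
      then have cov: "K - U \<subseteq> \<Union>(V ` {p\<in>D. z \<in> fst p})" using WVD(4) by blast
      moreover have "\<forall>B\<in>V ` {p\<in>D. z \<in> fst p}. openin ?Z B" using WVD by blast
      ultimately obtain \<G> where \<G>: "finite \<G>" "\<G> \<subseteq> V ` {p\<in>D. z \<in> fst p}" "K - U \<subseteq> \<Union>\<G>"
        using cKU unfolding compactin_def by meson
      then obtain E where E: "finite E" "E \<subseteq> {p\<in>D. z \<in> fst p}" "\<G> = V ` E"
        by (meson finite_subset_image)
      \<comment> \<open>The intersection with the whole space takes care of an empty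
        \<open>E\<close>, whose intersection would be the whole type.\<close>
      define P where "P = topspace ?Z \<inter> \<Inter>(W ` E)"
      have "openin ?Z P"
      proof (cases "E = {}")
        case True
        then have "P = topspace ?Z" unfolding P_def by simp
        then show ?thesis by (metis openin_topspace)
      next
        case False
        then have "openin ?Z (\<Inter>(W ` E))" using E WVD(1) by (intro openin_Inter) auto
        then show ?thesis unfolding P_def by blast
      qed
      moreover have "z \<in> P" using z C tZ E WVD(3) unfolding P_def by blast
      moreover have "P \<subseteq> K - \<Union>(V ` E)" using E WVD(5) tZ unfolding P_def disjnt_def by blast
      moreover have "K - \<Union>(V ` E) \<subseteq> U" using \<G>(3) E(3) by blast
      moreover have "K - \<Union>(V ` E) \<in> \<M>" unfolding \<M>_def using E by blast
      ultimately show ?thesis by blast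
    qed
    then obtain M P where MP: "\<And>z. z \<in> C \<Longrightarrow> M z \<in> \<M> \<and> openin ?Z (P z) \<and> z \<in> P z \<and> P z \<subseteq> M z \<and> M z \<subseteq> U"
      by metis
    have "compactin ?Z C" using C by (simp add: compactin_subtopology)
    moreover have "\<forall>B\<in>P ` C. openin ?Z B" "C \<subseteq> \<Union>(P ` C)" using MP by blast+
    ultimately obtain \<G> where \<G>: "finite \<G>" "\<G> \<subseteq> P ` C" "C \<subseteq> \<Union>\<G>"
      unfolding compactin_def by meson
    then obtain E where E: "finite E" "E \<subseteq> C" "\<G> = P ` E" by (meson finite_subset_image)
    have "C \<subseteq> \<Union>(M ` E)" using \<G>(3) E MP by blast
    moreover have "\<Union>(M ` E) \<subseteq> U" "M ` E \<subseteq> \<M>" using E MP by blast+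
    moreover have "finite (M ` E)" using E(1) by simp
    ultimately show ?thesis by (intro exI[of _ "M ` E"]) simp
  qed
  ultimately show thesis by (rule that)
qed

section \<open>The finest semilattice topology on finite sets\<close>

text \<open>The condition \<open>finest\<close> replaces the universal property by a comparison of
  topologies on one fixed carrier, so no target semilattices have to be quantified over.\<close>

locale free_fin_semilattice =
  fixes X :: "'a topology" and T :: "'a set topology"
  assumes topspace_T: "topspace T = fin_subsets (topspace X)"
    and semilattice_T: "topological_semilattice T (\<union>)"
    and continuous_singleton: "continuous_map X T (\<lambda>x. {x})"
    and finest: "\<And>T' U. topological_semilattice T' (\<union>) \<Longrightarrow> topspace T' = fin_subsets (topspace X) \<Longrightarrow>
      continuous_map X T' (\<lambda>x. {x}) \<Longrightarrow> openin T' U \<Longrightarrow> openin T U"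

text \<open>\<open>T\<close> is the pullback of \<open>S\<close> along the homomorphism
  \<open>h\<close> that extends \<open>\<delta>\<close> to finite sets. For every competing topology
  \<open>T'\<close> the factorization of the singleton map yields \<open>g\<close> with
  \<open>g (h A) = A\<close>, so the identity from \<open>T\<close> to \<open>T'\<close> is
  continuous. For \<open>T' = T\<close> this \<open>g\<close> is inverse to \<open>h\<close>,
  because the image of \<open>\<delta>\<close> generates \<open>S\<close>.\<close>

lemma free_topological_semilattice_homeomorphic:
  assumes F: "free_topological_semilattice X S m \<delta>"
  obtains T where "free_fin_semilattice X T" and "S homeomorphic_space T"
proof -
  let ?C = "fin_subsets (topspace X)"
  have S: "topological_semilattice S m" and d: "continuous_map X S \<delta>"
    using F by (auto simp: free_topological_semilattice_def)
  obtain h where h: "topspace (pullback_topology ?C h S) = ?C"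
    "topological_semilattice (pullback_topology ?C h S) (\<union>)"
    "continuous_map X (pullback_topology ?C h S) (\<lambda>x. {x})"
    "continuous_semilattice_hom (pullback_topology ?C h S) (\<union>) S m h"
    "\<And>x. x \<in> topspace X \<Longrightarrow> h {x} = \<delta> x"
    using pullback_fin_subsets[OF S d] by metis
  define T where "T = pullback_topology ?C h S"
  note hT = h[folded T_def]
  have ch: "continuous_map T S h"
    and hU: "\<And>A B. A \<in> ?C \<Longrightarrow> B \<in> ?C \<Longrightarrow> h (A \<union> B) = m (h A) (h B)"
    using hT(1,4) unfolding continuous_semilattice_hom_def by auto
  have hS: "h A \<in> topspace S" if "A \<in> ?C" for A
    using continuous_map_funspace[OF ch] that hT(1) by auto
  have ex: "\<exists>g. continuous_map S T' g \<and> (\<forall>A\<in>?C. g (h A) = A) \<and>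
      (\<forall>x\<in>topspace X. g (\<delta> x) = {x}) \<and>
      (\<forall>s\<in>topspace S. \<forall>t\<in>topspace S. g (m s t) = g s \<union> g t)"
    if T': "topological_semilattice T' (\<union>)" "continuous_map X T' (\<lambda>x. {x})" for T' :: "'a set topology"
  proof -
    have "unique_factorization X S m \<delta> T' (\<union>) (\<lambda>x. {x})"
      by (rule free_topological_semilattice_universal[OF F T'])
    then obtain g where g: "continuous_semilattice_hom S m T' (\<union>) g"
      "\<And>x. x \<in> topspace X \<Longrightarrow> {x} = g (\<delta> x)"
      unfolding unique_factorization_def by metis
    have "g (h A) = A" if "A \<in> ?C" for A
      using that
    proof (induction rule: fin_subsets_induct)
      case (singleton x)
      then show ?case using hT(5) g(2) by simp
    next
      case (union x G)
      have x: "{x} \<in> ?C" by (rule fin_subsets_simps(1)[OF union(1)])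
      have "g (h ({x} \<union> G)) = g (h {x}) \<union> g (h G)"
        using g(1) hS[OF x] hS[OF union(2)] hU[OF x union(2)] unfolding continuous_semilattice_hom_def
        by simp
      then show ?case using hT(5) g(2) union by simp
    qed
    then show ?thesis using g unfolding continuous_semilattice_hom_def by metis
  qed
  have "free_fin_semilattice X T"
  proof
    fix T' U assume T': "topological_semilattice T' (\<union>)" "continuous_map X T' (\<lambda>x. {x})"
      and tT': "topspace T' = ?C" and U: "openin T' U"
    obtain g where g: "continuous_map S T' g" "\<And>A. A \<in> ?C \<Longrightarrow> g (h A) = A"
      using ex[OF T'] by (elim exE conjE) auto
    have "continuous_map T T' (g \<circ> h)" by (rule continuous_map_compose[OF ch g(1)])
    then have "openin T {A \<in> topspace T. (g \<circ> h) A \<in> U}" using U openin_continuous_map_preimage by blast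
    moreover have "{A \<in> topspace T. (g \<circ> h) A \<in> U} = U"
      using g(2) openin_subset[OF U] tT' hT(1) by auto
    ultimately show "openin T U" by simp
  qed (use hT in auto)
  moreover obtain g where g: "continuous_map S T g" "\<forall>A\<in>?C. g (h A) = A"
    "\<forall>x\<in>topspace X. g (\<delta> x) = {x}"
    "\<forall>s\<in>topspace S. \<forall>t\<in>topspace S. g (m s t) = g s \<union> g t"
    using ex[OF hT(2,3)] by (elim exE conjE) auto
  have G: "topspace S = sl_generated m (\<delta> ` topspace X)" by (rule free_generated[OF F])
  have "h (g s) = s" if "s \<in> sl_generated m (\<delta> ` topspace X)" for s
    using that
  proof induction
    case (gen b)
    then show ?case using g(3) hT(5) by auto
  next
    case (mult s t)
    then have st: "s \<in> topspace S" "t \<in> topspace S" using G by auto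
    then have "g s \<in> ?C" "g t \<in> ?C" using continuous_map_funspace[OF g(1)] hT(1) by auto
    then show ?case using mult.IH g(4) st hU by simp
  qed
  then have "homeomorphic_maps S T g h"
    unfolding homeomorphic_maps_def using g ch hT(1) G by simp
  then have "S homeomorphic_space T" using homeomorphic_space_def by blast
  ultimately show ?thesis using that by blast
qed

context free_fin_semilattice
begin

lemma union_nhds:
  assumes W: "openin T W" "F \<union> G \<in> W" and "F \<in> fin_subsets (topspace X)" "G \<in> fin_subsets (topspace X)"
  obtains W1 W2 where "openin T W1" "openin T W2" "F \<in> W1" "G \<in> W2"
    "\<And>F' G'. F' \<in> W1 \<Longrightarrow> G' \<in> W2 \<Longrightarrow> F' \<union> G' \<in> W"
proof -
  have "continuous_map (prod_topology T T) T (\<lambda>(x, y). x \<union> y)"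
    by (rule topological_semilatticeD(1)[OF semilattice_T])
  from openin_continuous_map_preimage[OF this W(1)]
  have "openin (prod_topology T T) {z \<in> topspace (prod_topology T T). (\<lambda>(x, y). x \<union> y) z \<in> W}" .
  moreover have "(F, G) \<in> {z \<in> topspace (prod_topology T T). (\<lambda>(x, y). x \<union> y) z \<in> W}"
    using assms topspace_T by auto
  ultimately obtain W1 W2 where "openin T W1" "openin T W2" "F \<in> W1" "G \<in> W2"
    and sub: "W1 \<times> W2 \<subseteq> {z \<in> topspace (prod_topology T T). (\<lambda>(x, y). x \<union> y) z \<in> W}"
    unfolding openin_prod_topology_alt by (elim allE impE exE conjE) auto
  moreover have "F' \<union> G' \<in> W" if "F' \<in> W1" "G' \<in> W2" for F' G' using that sub by auto
  ultimately show thesis using that by blast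
qed

lemma openin_T_subbase:
  assumes sub: "\<And>B. B \<in> \<B> \<Longrightarrow> B \<subseteq> fin_subsets (topspace X)"
    and un: "\<And>B F G. B \<in> \<B> \<Longrightarrow> F \<in> fin_subsets (topspace X) \<Longrightarrow> G \<in> fin_subsets (topspace X) \<Longrightarrow>
      F \<union> G \<in> B \<Longrightarrow> \<exists>B1\<in>insert (fin_subsets (topspace X)) \<B>. \<exists>B2\<in>insert (fin_subsets (topspace X)) \<B>.
        F \<in> B1 \<and> G \<in> B2 \<and> (\<forall>F'\<in>B1. \<forall>G'\<in>B2. F' \<union> G' \<in> B)"
    and sing: "\<And>B. B \<in> \<B> \<Longrightarrow> openin X {x \<in> topspace X. {x} \<in> B}"
    and B: "B \<in> \<B>"
  shows "openin T B"
proof -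
  let ?C = "fin_subsets (topspace X)"
  define T' where "T' = topology_generated_by (insert ?C \<B>)"
  have op: "openin T' B" if "B \<in> insert ?C \<B>" for B
    unfolding T'_def by (rule topology_generated_by_Basis[OF that])
  have tT': "topspace T' = ?C"
    unfolding T'_def topology_generated_by_topspace using sub by auto
  have "continuous_map (prod_topology T' T') T' (\<lambda>(F, G). F \<union> G)"
    unfolding T'_def
  proof (rule continuous_on_generated_topo, fold T'_def)
    fix B assume B: "B \<in> insert ?C \<B>"
    show "openin (prod_topology T' T') ((\<lambda>(F, G). F \<union> G) -` B \<inter> topspace (prod_topology T' T'))"
      unfolding openin_prod_topology_alt
    proof (intro allI impI)
      fix F G assume FG: "(F, G) \<in> (\<lambda>(F, G). F \<union> G) -` B \<inter> topspace (prod_topology T' T')"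
      then have FG': "F \<in> ?C" "G \<in> ?C" "F \<union> G \<in> B" using tT' by auto
      have "\<exists>B1\<in>insert ?C \<B>. \<exists>B2\<in>insert ?C \<B>. F \<in> B1 \<and> G \<in> B2 \<and> (\<forall>F'\<in>B1. \<forall>G'\<in>B2. F' \<union> G' \<in> B)"
      proof (cases "B \<in> \<B>")
        case True
        then show ?thesis using un FG' by blast
      next
        case False
        then have "B = ?C" using B by auto
        then show ?thesis using FG' fin_subsets_simps(2) by blast
      qed
      then obtain B1 B2 where *: "B1 \<in> insert ?C \<B>" "B2 \<in> insert ?C \<B>" "F \<in> B1" "G \<in> B2"
        "\<forall>F'\<in>B1. \<forall>G'\<in>B2. F' \<union> G' \<in> B" by blast
      have "B1 \<subseteq> topspace T'" "B2 \<subseteq> topspace T'"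
        using openin_subset[OF op[OF *(1)]] openin_subset[OF op[OF *(2)]] by auto
      then have "B1 \<times> B2 \<subseteq> topspace (prod_topology T' T')" by auto
      moreover have "B1 \<times> B2 \<subseteq> (\<lambda>(F, G). F \<union> G) -` B" using *(5) by auto
      ultimately have "B1 \<times> B2 \<subseteq> (\<lambda>(F, G). F \<union> G) -` B \<inter> topspace (prod_topology T' T')"
        by simp
      then show "\<exists>U V. openin T' U \<and> openin T' V \<and> F \<in> U \<and> G \<in> V \<and>
          U \<times> V \<subseteq> (\<lambda>(F, G). F \<union> G) -` B \<inter> topspace (prod_topology T' T')"
        using op[OF *(1)] op[OF *(2)] *(3,4) by blast
    qed
  next
    show "(\<lambda>(F, G). F \<union> G) ` topspace (prod_topology T' T') \<subseteq> \<Union>(insert ?C \<B>)"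
      using tT' fin_subsets_simps(2) by auto
  qed
  then have s: "topological_semilattice T' (\<union>)"
    unfolding topological_semilattice_def by auto
  have "continuous_map X T' (\<lambda>x. {x})"
    unfolding T'_def
  proof (rule continuous_on_generated_topo)
    fix B assume "B \<in> insert ?C \<B>"
    moreover have "(\<lambda>x. {x}) -` B \<inter> topspace X = {x \<in> topspace X. {x} \<in> B}" by auto
    moreover have "{x \<in> topspace X. {x} \<in> ?C} = topspace X" using fin_subsets_simps(1) by auto
    ultimately show "openin X ((\<lambda>x. {x}) -` B \<inter> topspace X)"
      using sing by (metis insertE openin_topspace)
  next
    show "(\<lambda>x. {x}) ` topspace X \<subseteq> \<Union>(insert ?C \<B>)" using fin_subsets_simps(1) by auto
  qed
  then show ?thesis using finest[OF s tT'] op B by blast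
qed

section \<open>Vietoris-type open sets, separation and pseudometric balls\<close>

lemma openin_T_subsets:
  assumes U: "openin X U" shows "openin T (fin_subsets U)"
proof (rule openin_T_subbase[where \<B> = "{fin_subsets U}"])
  have UX: "U \<subseteq> topspace X" using U openin_subset by blast
  then show "\<And>B. B \<in> {fin_subsets U} \<Longrightarrow> B \<subseteq> fin_subsets (topspace X)"
    by (auto simp: fin_subsets_def)
  have "{x \<in> topspace X. {x} \<in> fin_subsets U} = U" using UX by (auto simp: fin_subsets_def)
  then show "\<And>B. B \<in> {fin_subsets U} \<Longrightarrow> openin X {x \<in> topspace X. {x} \<in> B}" using U by simp
  fix B F G assume *: "B \<in> {fin_subsets U}" "F \<in> fin_subsets (topspace X)"
    "G \<in> fin_subsets (topspace X)" "F \<union> G \<in> B"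
  then have "F \<in> B" "G \<in> B" "\<forall>F'\<in>B. \<forall>G'\<in>B. F' \<union> G' \<in> B"
    by (auto simp: fin_subsets_def)
  then show "\<exists>B1\<in>insert (fin_subsets (topspace X)) {fin_subsets U}.
      \<exists>B2\<in>insert (fin_subsets (topspace X)) {fin_subsets U}.
        F \<in> B1 \<and> G \<in> B2 \<and> (\<forall>F'\<in>B1. \<forall>G'\<in>B2. F' \<union> G' \<in> B)" using *(1) by blast
qed simp

lemma openin_T_hits:
  assumes U: "openin X U" shows "openin T {F \<in> fin_subsets (topspace X). F \<inter> U \<noteq> {}}" (is "openin T ?H")
proof (rule openin_T_subbase[where \<B> = "{?H}"])
  have UX: "U \<subseteq> topspace X" using U openin_subset by blast
  have "{x \<in> topspace X. {x} \<in> ?H} = U" using UX by (auto simp: fin_subsets_def)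
  then show "\<And>B. B \<in> {?H} \<Longrightarrow> openin X {x \<in> topspace X. {x} \<in> B}" using U by simp
  fix B F G assume *: "B \<in> {?H}" "F \<in> fin_subsets (topspace X)"
    "G \<in> fin_subsets (topspace X)" "F \<union> G \<in> B"
  have 1: "\<forall>F'\<in>?H. \<forall>G'\<in>fin_subsets (topspace X). F' \<union> G' \<in> ?H \<and> G' \<union> F' \<in> ?H"
    using fin_subsets_simps(2) by blast
  have B: "B = ?H" using *(1) by simp
  have "F \<in> ?H \<or> G \<in> ?H" using * by auto
  then show "\<exists>B1\<in>insert (fin_subsets (topspace X)) {?H}. \<exists>B2\<in>insert (fin_subsets (topspace X)) {?H}.
        F \<in> B1 \<and> G \<in> B2 \<and> (\<forall>F'\<in>B1. \<forall>G'\<in>B2. F' \<union> G' \<in> B)"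
  proof
    assume "F \<in> ?H"
    with 1 *(3) have "F \<in> ?H \<and> G \<in> fin_subsets (topspace X) \<and>
        (\<forall>F'\<in>?H. \<forall>G'\<in>fin_subsets (topspace X). F' \<union> G' \<in> B)" unfolding B by simp
    then show ?thesis by (meson insertI1 insertI2)
  next
    assume "G \<in> ?H"
    with 1 *(2) have "F \<in> fin_subsets (topspace X) \<and> G \<in> ?H \<and>
        (\<forall>F'\<in>fin_subsets (topspace X). \<forall>G'\<in>?H. F' \<union> G' \<in> B)" unfolding B by simp
    then show ?thesis by (meson insertI1 insertI2)
  qed
qed auto

text \<open>If \<open>x\<close> lies in \<open>F\<close> but not in the finite set \<open>G\<close>,
  disjoint neighbourhoods of \<open>x\<close> and \<open>G\<close> separate the sets that hit the
  first from the sets contained in the second.\<close>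

lemma Hausdorff_T:
  assumes H: "Hausdorff_space X" shows "Hausdorff_space T"
  unfolding Hausdorff_space_def
proof (intro allI impI, elim conjE)
  have sep: "\<exists>U V. openin T U \<and> openin T V \<and> F \<in> U \<and> G \<in> V \<and> disjnt U V"
    if FG: "F \<in> fin_subsets (topspace X)" "G \<in> fin_subsets (topspace X)" and x: "x \<in> F" "x \<notin> G" for F G x
  proof -
    have "compactin X {x}" "compactin X G" "disjnt {x} G"
      using FG x by (auto simp: fin_subsets_def finite_imp_compactin)
    then obtain U V where UV: "openin X U" "openin X V" "x \<in> U" "G \<subseteq> V" "disjnt U V"
      using H unfolding Hausdorff_space_compact_sets by (metis insert_subset)
    have "F \<in> {F \<in> fin_subsets (topspace X). F \<inter> U \<noteq> {}}" using FG x UV by auto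
    moreover have "G \<in> fin_subsets V" using FG UV by (auto simp: fin_subsets_def)
    moreover have "disjnt {F \<in> fin_subsets (topspace X). F \<inter> U \<noteq> {}} (fin_subsets V)"
      using UV(5) by (auto simp: fin_subsets_def disjnt_def)
    ultimately show ?thesis using openin_T_hits[OF UV(1)] openin_T_subsets[OF UV(2)] by blast
  qed
  fix F G assume "F \<in> topspace T" "G \<in> topspace T" "F \<noteq> G"
  then have FG: "F \<in> fin_subsets (topspace X)" "G \<in> fin_subsets (topspace X)" and "F \<noteq> G"
    using topspace_T by auto
  then consider x where "x \<in> F" "x \<notin> G" | x where "x \<in> G" "x \<notin> F" by blast
  then show "\<exists>U V. openin T U \<and> openin T V \<and> F \<in> U \<and> G \<in> V \<and> disjnt U V"
    using sep FG by cases (blast, metis disjnt_sym)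
qed

text \<open>From an open cover of \<open>\<Union>C\<close> the sets
  \<open>fin_subsets (\<Union>\<F>)\<close> with finite \<open>\<F>\<close> form an open cover of
  \<open>C\<close>, precisely because the elements of \<open>C\<close> are finite.\<close>

lemma compactin_Union_T:
  assumes C: "compactin T C" shows "compactin X (\<Union>C)"
  unfolding compactin_def
proof (intro conjI allI impI)
  have CX: "F \<in> fin_subsets (topspace X)" if "F \<in> C" for F
    using that compactin_subset_topspace[OF C] topspace_T by blast
  then show "\<Union>C \<subseteq> topspace X" by (auto simp: fin_subsets_def)
  fix \<U> assume U: "(\<forall>U\<in>\<U>. openin X U) \<and> \<Union>C \<subseteq> \<Union>\<U>"
  define \<O> where "\<O> = {fin_subsets (\<Union>\<F>) |\<F>. finite \<F> \<and> \<F> \<subseteq> \<U>}"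
  have "openin T O'" if O': "O' \<in> \<O>" for O'
  proof -
    obtain \<F> where F: "O' = fin_subsets (\<Union>\<F>)" "\<F> \<subseteq> \<U>" using O' unfolding \<O>_def by blast
    then have "openin X (\<Union>\<F>)" using U by (intro openin_Union) auto
    then show ?thesis unfolding F(1) by (rule openin_T_subsets)
  qed
  moreover have "C \<subseteq> \<Union>\<O>"
  proof
    fix F assume F: "F \<in> C"
    then have "finite F" "F \<subseteq> \<Union>\<U>" using CX U by (auto simp: fin_subsets_def)
    then obtain \<F> where "finite \<F>" "\<F> \<subseteq> \<U>" "F \<subseteq> \<Union>\<F>" using finite_subset_Union by metis
    then have "F \<in> fin_subsets (\<Union>\<F>)" "fin_subsets (\<Union>\<F>) \<in> \<O>"
      using CX[OF F] by (auto simp: \<O>_def fin_subsets_def)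
    then show "F \<in> \<Union>\<O>" by blast
  qed
  ultimately obtain \<P> where P: "finite \<P>" "\<P> \<subseteq> \<O>" "C \<subseteq> \<Union>\<P>"
    using C unfolding compactin_def by metis
  have "\<forall>O'\<in>\<P>. \<exists>\<F>. finite \<F> \<and> \<F> \<subseteq> \<U> \<and> O' = fin_subsets (\<Union>\<F>)" using P(2) \<O>_def by blast
  then obtain f where f: "\<And>O'. O' \<in> \<P> \<Longrightarrow> finite (f O') \<and> f O' \<subseteq> \<U> \<and> O' = fin_subsets (\<Union>(f O'))" by metis
  have "\<Union>C \<subseteq> \<Union>(\<Union>(f ` \<P>))"
  proof
    fix x assume "x \<in> \<Union>C"
    then obtain F O' where "x \<in> F" "O' \<in> \<P>" "F \<in> O'" using P(3) by blast
    then have "F \<in> fin_subsets (\<Union>(f O'))" using f by blast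
    then have "x \<in> \<Union>(f O')" using \<open>x \<in> F\<close> by (auto simp: fin_subsets_def)
    then show "x \<in> \<Union>(\<Union>(f ` \<P>))" using \<open>O' \<in> \<P>\<close> by blast
  qed
  then show "\<exists>\<F>. finite \<F> \<and> \<F> \<subseteq> \<U> \<and> \<Union>C \<subseteq> \<Union>\<F>"
  proof (intro exI[of _ "\<Union>(f ` \<P>)"] conjI)
    show "finite (\<Union>(f ` \<P>))" using P(1) f by (intro finite_UN_I) auto
    show "\<Union>(f ` \<P>) \<subseteq> \<U>" using f by (intro UN_least) auto
  qed
qed

text \<open>The maximum exceeds \<open>a\<close> iff the finite set hits an open set, and stays
  below \<open>a\<close> iff it is contained in one.\<close>

lemma continuous_Max_T:
  fixes f :: "'a \<Rightarrow> real"
  assumes f: "continuous_map X euclideanreal f"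
  shows "continuous_map T euclideanreal (\<lambda>F. Max (f ` F))"
  unfolding continuous_map_upper_lower_semicontinuous_lt
proof (intro allI conjI)
  fix a
  have F: "finite F \<and> F \<noteq> {} \<and> F \<subseteq> topspace X" if "F \<in> topspace T" for F
    using that topspace_T by (auto simp: fin_subsets_def)
  have "openin X {x \<in> topspace X. f x > a}" "openin X {x \<in> topspace X. f x < a}"
    using f unfolding continuous_map_upper_lower_semicontinuous_lt by blast+
  note o = openin_T_hits[OF this(1)] openin_T_subsets[OF this(2)]
  have "{F \<in> topspace T. Max (f ` F) > a} = {F \<in> fin_subsets (topspace X). F \<inter> {x \<in> topspace X. f x > a} \<noteq> {}}"
    unfolding topspace_T[symmetric]
  proof (rule Collect_cong, rule conj_cong[OF refl])
    fix G assume "G \<in> topspace T"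
    from F[OF this] show "Max (f ` G) > a \<longleftrightarrow> G \<inter> {x \<in> topspace X. f x > a} \<noteq> {}"
      by (subst Max_gr_iff) auto
  qed
  then show "openin T {F \<in> topspace T. Max (f ` F) > a}" using o(1) by simp
  have "{F \<in> topspace T. Max (f ` F) < a} = fin_subsets {x \<in> topspace X. f x < a}"
  proof (intro equalityI subsetI)
    fix G assume "G \<in> {F \<in> topspace T. Max (f ` F) < a}"
    then have "finite G" "G \<noteq> {}" "G \<subseteq> topspace X" "Max (f ` G) < a" using F[of G] by auto
    then show "G \<in> fin_subsets {x \<in> topspace X. f x < a}"
      by (subst (asm) Max_less_iff) (auto simp: fin_subsets_def)
  next
    fix G assume "G \<in> fin_subsets {x \<in> topspace X. f x < a}"
    then have "finite G" "G \<noteq> {}" "G \<subseteq> topspace X" "\<forall>x\<in>G. f x < a" by (auto simp: fin_subsets_def)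
    then show "G \<in> {F \<in> topspace T. Max (f ` F) < a}"
      by (auto simp: topspace_T fin_subsets_def Max_less_iff)
  qed
  then show "openin T {F \<in> topspace T. Max (f ` F) < a}" using o(2) by simp
qed

text \<open>By \<open>un\<close> the union is 1-Lipschitz for the sum of the two distances, and
  therefore the balls satisfy the subbase criterion. Such balls can control how many disjoint open
  sets a finite set hits.\<close>

lemma openin_T_pseudometric_ball:
  fixes d :: "'a set \<Rightarrow> 'a set \<Rightarrow> real"
  assumes refl: "\<And>F. F \<in> fin_subsets (topspace X) \<Longrightarrow> d F F = 0"
    and tri: "\<And>F G H. F \<in> fin_subsets (topspace X) \<Longrightarrow> G \<in> fin_subsets (topspace X) \<Longrightarrow>
      H \<in> fin_subsets (topspace X) \<Longrightarrow> d F H \<le> d F G + d G H"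
    and un: "\<And>F F' G G'. F \<in> fin_subsets (topspace X) \<Longrightarrow> F' \<in> fin_subsets (topspace X) \<Longrightarrow>
      G \<in> fin_subsets (topspace X) \<Longrightarrow> G' \<in> fin_subsets (topspace X) \<Longrightarrow>
      d (F \<union> G) (F' \<union> G') \<le> d F F' + d G G'"
    and sing: "\<And>x e. x \<in> topspace X \<Longrightarrow> e > 0 \<Longrightarrow>
      \<exists>U. openin X U \<and> x \<in> U \<and> (\<forall>y\<in>U. d {x} {y} < e)"
    and H: "H \<in> fin_subsets (topspace X)"
  shows "openin T {F \<in> fin_subsets (topspace X). d H F < e}"
proof -
  let ?C = "fin_subsets (topspace X)"
  define ball where "ball H e = {F \<in> ?C. d H F < e}" for H e
  have "openin T (ball H e)"
  proof (rule openin_T_subbase[where \<B> = "{ball H e |H e. H \<in> ?C}"])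
    show "\<And>B. B \<in> {ball H e |H e. H \<in> ?C} \<Longrightarrow> B \<subseteq> ?C" by (auto simp: ball_def)
    show "ball H e \<in> {ball H e |H e. H \<in> ?C}" using H by auto
  next
    fix B F G assume *: "B \<in> {ball H e |H e. H \<in> ?C}" "F \<in> ?C" "G \<in> ?C" "F \<union> G \<in> B"
    then obtain K r where K: "K \<in> ?C" "B = ball K r" by blast
    \<comment> \<open>Half of the slack goes to each of the two sets whose union is moved.\<close>
    define s where "s = (r - d K (F \<union> G)) / 2"
    have "s > 0" using *(4) K by (auto simp: ball_def s_def)
    then have "F \<in> ball F s" "G \<in> ball G s" using * refl by (auto simp: ball_def)
    moreover have "F' \<union> G' \<in> B" if "F' \<in> ball F s" "G' \<in> ball G s" for F' G'
    proof -
      have C: "F' \<in> ?C" "G' \<in> ?C" "d F F' < s" "d G G' < s" using that by (auto simp: ball_def)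
      have "d K (F' \<union> G') \<le> d K (F \<union> G) + d (F \<union> G) (F' \<union> G')"
        by (rule tri) (use C * K fin_subsets_simps(2) in auto)
      also have "\<dots> \<le> d K (F \<union> G) + (d F F' + d G G')" using un C * by auto
      also have "\<dots> < r" using C by (simp add: s_def field_simps)
      finally show ?thesis using K(2) C fin_subsets_simps(2) by (auto simp: ball_def)
    qed
    ultimately show "\<exists>B1\<in>insert ?C {ball H e |H e. H \<in> ?C}. \<exists>B2\<in>insert ?C {ball H e |H e. H \<in> ?C}.
        F \<in> B1 \<and> G \<in> B2 \<and> (\<forall>F'\<in>B1. \<forall>G'\<in>B2. F' \<union> G' \<in> B)"
      using *(2,3) by blast
  next
    fix B assume "B \<in> {ball H e |H e. H \<in> ?C}"
    then obtain K r where K: "K \<in> ?C" "B = ball K r" by blast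
    show "openin X {x \<in> topspace X. {x} \<in> B}"
    proof (subst openin_subopen, intro ballI)
      fix x assume "x \<in> {x \<in> topspace X. {x} \<in> B}"
      then have x: "x \<in> topspace X" "d K {x} < r" using K by (auto simp: ball_def)
      then obtain U where U: "openin X U" "x \<in> U" "\<forall>y\<in>U. d {x} {y} < r - d K {x}"
        using sing[of x "r - d K {x}"] by auto
      have "y \<in> {x \<in> topspace X. {x} \<in> B}" if "y \<in> U" for y
      proof -
        have y: "y \<in> topspace X" using U that openin_subset by blast
        have "d K {y} \<le> d K {x} + d {x} {y}"
          by (rule tri) (use K x y fin_subsets_simps(1) in auto)
        then show ?thesis using U that y K fin_subsets_simps(1)[OF y] by (force simp: ball_def)
      qed
      then show "\<exists>U. openin X U \<and> x \<in> U \<and> U \<subseteq> {x \<in> topspace X. {x} \<in> B}" using U by blast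
    qed
  qed
  then show ?thesis by (simp add: ball_def)
qed

text \<open>The union of \<open>n + 1\<close> copies of \<open>{z}\<close> is \<open>{z}\<close>, so
  this is continuity of the iterated union at one point. \<open>U\<close> depends on
  \<open>n\<close>, which is why the fan chooses its second index after the first.\<close>

lemma small_subsets_nhd:
  assumes z: "z \<in> topspace X" and W: "openin T W" "{z} \<in> W"
  shows "\<exists>U. openin X U \<and> z \<in> U \<and> (\<forall>F. F \<subseteq> U \<and> F \<noteq> {} \<and> finite F \<and> card F \<le> Suc n \<longrightarrow> F \<in> W)"
  using W
proof (induction n arbitrary: W)
  case 0
  have "openin X {x \<in> topspace X. {x} \<in> W}"
    using openin_continuous_map_preimage[OF continuous_singleton 0(1)] .
  moreover have "F \<in> W" if F: "F \<subseteq> {x \<in> topspace X. {x} \<in> W}" "F \<noteq> {}" "finite F" "card F \<le> Suc 0" for F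
  proof -
    have "card F = 1" using F by (metis One_nat_def card_gt_0_iff le_antisym less_eq_Suc_le)
    then obtain x where "F = {x}" using card_1_singletonE by blast
    then show ?thesis using F by auto
  qed
  moreover have "z \<in> {x \<in> topspace X. {x} \<in> W}" using 0(2) z by simp
  ultimately show ?case by blast
next
  case (Suc n)
  have z': "{z} \<in> fin_subsets (topspace X)" by (rule fin_subsets_simps(1)[OF z])
  obtain W1 W2 where W12: "openin T W1" "openin T W2" "{z} \<in> W1" "{z} \<in> W2"
    "\<And>F' G'. F' \<in> W1 \<Longrightarrow> G' \<in> W2 \<Longrightarrow> F' \<union> G' \<in> W"
    using union_nhds[OF Suc.prems(1) _ z' z'] Suc.prems(2) by auto
  obtain U1 where U1: "openin X U1" "z \<in> U1" "\<And>F. F \<subseteq> U1 \<Longrightarrow> F \<noteq> {} \<Longrightarrow> finite F \<Longrightarrow> card F \<le> Suc n \<Longrightarrow> F \<in> W1"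
    using Suc.IH[OF W12(1,3)] by blast
  obtain U2 where U2: "openin X U2" "z \<in> U2" "\<And>F. F \<subseteq> U2 \<Longrightarrow> F \<noteq> {} \<Longrightarrow> finite F \<Longrightarrow> card F \<le> Suc n \<Longrightarrow> F \<in> W2"
    using Suc.IH[OF W12(2,4)] by blast
  have "F \<in> W" if F: "F \<subseteq> U1 \<inter> U2" "F \<noteq> {}" "finite F" "card F \<le> Suc (Suc n)" for F
  proof -
    obtain x where x: "x \<in> F" using F by blast
    have G: "{x} \<union> (F - {x}) = F" using x by blast
    show ?thesis
    proof (cases "F - {x} = {}")
      case True
      then have "F = {x}" using x by blast
      then have "F \<in> W1" "F \<in> W2" using U1(3)[of F] U2(3)[of F] F by auto
      then show ?thesis using W12(5)[of F F] by simp
    next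
      case False
      have "{x} \<in> W1" using U1(3)[of "{x}"] x F by auto
      moreover have "F - {x} \<in> W2"
      proof (rule U2(3)[OF _ False])
        show "card (F - {x}) \<le> Suc n" using F x by (simp add: card_Diff_singleton)
      qed (use F in auto)
      ultimately show ?thesis using W12(5) G by metis
    qed
  qed
  moreover have "openin X (U1 \<inter> U2)" "z \<in> U1 \<inter> U2" using U1 U2 by auto
  ultimately show ?case by blast
qed

end

section \<open>Exhausting the free semilattice\<close>

lemma compact_exhaustion_continuous_map:
  assumes K: "compact_exhaustion Y K" and H: "Hausdorff_space Y"
    and f: "\<And>n. continuous_map (subtopology Y (K n)) Z f"
  shows "continuous_map Y Z f"
  unfolding continuous_map_def
proof (intro conjI allI impI)
  note D = compact_exhaustionD[OF K]
  have tK: "topspace (subtopology Y (K n)) = K n" for n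
    using compactin_subset_topspace[OF D(1)] by auto
  show "f \<in> topspace Y \<rightarrow> topspace Z"
  proof
    fix y assume "y \<in> topspace Y"
    then obtain n where "y \<in> K n" unfolding D(3)[symmetric] by blast
    then show "f y \<in> topspace Z" using continuous_map_funspace[OF f[of n]] tK by auto
  qed
  fix U assume U: "openin Z U"
  show "openin Y {y \<in> topspace Y. f y \<in> U}"
  proof (rule compact_exhaustion_openin[OF K H])
    fix n
    have "{y \<in> topspace Y. f y \<in> U} \<inter> K n = {y \<in> topspace (subtopology Y (K n)). f y \<in> U}" by auto
    then show "openin (subtopology Y (K n)) ({y \<in> topspace Y. f y \<in> U} \<inter> K n)"
      using openin_continuous_map_preimage[OF f U] by simp
  qed auto
qed

text \<open>Functions separating along the stages are continuous on all of \<open>Y\<close> because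
  the stages determine its topology. This gives regularity of the semilattice over a piece, which
  cannot be read off from its open sets.\<close>

lemma compact_exhaustion_imp_regular_space:
  assumes K: "compact_exhaustion Y K" and H: "Hausdorff_space Y"
  shows "regular_space Y"
  unfolding regular_space_def
proof (intro allI impI, elim conjE)
  note D = compact_exhaustionD[OF K]
  fix C a assume C: "closedin Y C" and a: "a \<in> topspace Y - C"
  then have a': "a \<in> topspace Y" "a \<notin> C" by auto
  have "closedin Y (C \<inter> K n)" for n using C compactin_imp_closedin[OF H D(1)] by blast
  then obtain f :: "'a \<Rightarrow> real" where f: "\<And>n. continuous_map (subtopology Y (K n)) euclideanreal f"
    "\<And>n y. y \<in> C \<inter> K n \<Longrightarrow> f y = 0" "f a = 1"
    using separating_function_along_compacts[OF H D(1,2) _ a'] by metis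
  have "continuous_map Y euclideanreal f" by (rule compact_exhaustion_continuous_map[OF K H f(1)])
  then have "openin Y {y \<in> topspace Y. f y > 1/2}" "openin Y {y \<in> topspace Y. f y < 1/2}"
    unfolding continuous_map_upper_lower_semicontinuous_lt by blast+
  moreover have "a \<in> {y \<in> topspace Y. f y > 1/2}" using a f(3) by auto
  moreover have "C \<subseteq> {y \<in> topspace Y. f y < 1/2}"
  proof
    fix y assume y: "y \<in> C"
    then have "y \<in> topspace Y" using closedin_subset[OF C] by blast
    then obtain n where "y \<in> K n" unfolding D(3)[symmetric] by blast
    then show "y \<in> {y \<in> topspace Y. f y < 1/2}" using f(2)[of y n] y \<open>y \<in> topspace Y\<close> by simp
  qed
  moreover have "disjnt {y \<in> topspace Y. f y > 1/2} {y \<in> topspace Y. f y < 1/2}"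
    by (auto simp: disjnt_def)
  ultimately show "\<exists>U V. openin Y U \<and> openin Y V \<and> a \<in> U \<and> C \<subseteq> V \<and> disjnt U V"
    by blast
qed

text \<open>With the bound \<open>Suc n\<close> stage 0 consists of the singletons, and
  \<open>small_subsets n A\<close> is the image of the \<open>(n + 1)\<close>-fold power of
  \<open>A\<close> under union.\<close>

definition small_subsets :: "nat \<Rightarrow> 'a set \<Rightarrow> 'a set set" where
  "small_subsets n A = {F \<in> fin_subsets A. card F \<le> Suc n}"

text \<open>Image of the product of the listed sets under iterated union. Indexing by lists keeps
  the collection of these images countable when the sets come from a countable family.\<close>

definition chosen_sets :: "'a set list \<Rightarrow> 'a set set" where
  "chosen_sets Ns = {set xs |xs. list_all2 (\<in>) xs Ns}"

context free_fin_semilattice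
begin

lemma compactin_small_subsets:
  assumes C: "compactin X C" shows "compactin T (small_subsets n C)"
proof (induction n)
  case 0
  have "small_subsets 0 C = (\<lambda>x. {x}) ` C"
    unfolding small_subsets_def fin_subsets_def
  proof (intro equalityI subsetI)
    fix F assume "F \<in> {F \<in> {F. finite F \<and> F \<noteq> {} \<and> F \<subseteq> C}. card F \<le> Suc 0}"
    then have F: "finite F" "F \<noteq> {}" "F \<subseteq> C" "card F \<le> Suc 0" by auto
    then have "card F = 1" by (metis One_nat_def card_gt_0_iff le_antisym less_eq_Suc_le)
    then obtain x where "F = {x}" using card_1_singletonE by blast
    then show "F \<in> (\<lambda>x. {x}) ` C" using F by auto
  qed auto
  then show ?case using image_compactin[OF C continuous_singleton] by simp
next
  case (Suc n)
  let ?E = "small_subsets n C" and ?S = "(\<lambda>x. {x}) ` C"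
  have S: "compactin T ?S" by (rule image_compactin[OF C continuous_singleton])
  have "compactin (prod_topology T T) (?E \<times> ?S)" using Suc S by (simp add: compactin_Times)
  then have "compactin T ((\<lambda>(x, y). x \<union> y) ` (?E \<times> ?S))"
    by (rule image_compactin) (rule topological_semilatticeD(1)[OF semilattice_T])
  moreover have "(\<lambda>(x, y). x \<union> y) ` (?E \<times> ?S) = small_subsets (Suc n) C"
  proof (intro equalityI subsetI)
    fix H assume "H \<in> (\<lambda>(x, y). x \<union> y) ` (?E \<times> ?S)"
    then obtain F x where F: "F \<in> ?E" "x \<in> C" "H = F \<union> {x}" by auto
    have "card (F \<union> {x}) \<le> card F + 1" by (metis card_Un_le One_nat_def card.empty card_insert_disjoint empty_iff finite.emptyI)
    then show "H \<in> small_subsets (Suc n) C"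
      using F unfolding small_subsets_def fin_subsets_def by auto
  next
    fix H assume "H \<in> small_subsets (Suc n) C"
    then have H: "finite H" "H \<noteq> {}" "H \<subseteq> C" "card H \<le> Suc (Suc n)"
      unfolding small_subsets_def fin_subsets_def by auto
    then obtain x where x: "x \<in> H" by blast
    have xS: "{x} \<in> ?S" using x H by blast
    show "H \<in> (\<lambda>(x, y). x \<union> y) ` (?E \<times> ?S)"
    proof (cases "H = {x}")
      case True
      then have "H \<in> ?E" using H unfolding small_subsets_def fin_subsets_def by auto
      then show ?thesis using xS True by (intro image_eqI[of _ _ "(H, {x})"]) auto
    next
      case False
      then have "H - {x} \<noteq> {}" using x by blast
      moreover have "card (H - {x}) \<le> Suc n" using H x by (simp add: card_Diff_singleton)
      ultimately have "H - {x} \<in> ?E" using H unfolding small_subsets_def fin_subsets_def by auto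
      moreover have "H = (H - {x}) \<union> {x}" using x by blast
      ultimately show ?thesis using xS by (intro image_eqI[of _ _ "(H - {x}, {x})"]) auto
    qed
  qed
  ultimately show ?case by simp
qed

text \<open>Let \<open>Y\<close> carry the direct limit topology of the compact sets
  \<open>E n\<close>. Union maps \<open>E n \<times> E n\<close> into a later stage, and the square
  of \<open>Y\<close> is determined by these stages, so union is continuous on \<open>Y\<close>.
  Pulled back along a retraction of \<open>X\<close> onto the clopen set \<open>A\<close>, the open
  sets of \<open>Y\<close> satisfy the subbase criterion and are therefore open in \<open>T\<close>.
  Conversely, open sets of \<open>T\<close> have open traces on every stage.\<close>

lemma compact_exhaustion_T:
  assumes H: "Hausdorff_space X" and A: "openin X A" "closedin X A" "a0 \<in> A"
    and K: "compact_exhaustion (subtopology X A) K"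
  shows "compact_exhaustion (subtopology T (fin_subsets A)) (\<lambda>n. small_subsets n (K n))"
proof -
  let ?C = "fin_subsets A" and ?TC = "subtopology T (fin_subsets A)"
  define E where "E n = small_subsets n (K n)" for n
  have AX: "A \<subseteq> topspace X" using A(1) openin_subset by blast
  have tA: "topspace (subtopology X A) = A" using AX by auto
  note D = compact_exhaustionD[OF K, unfolded tA]
  have mono: "K m \<subseteq> K n" if "m \<le> n" for m n using D(2) that by (simp add: incseqD)
  have KX: "compactin X (K n)" and KA: "K n \<subseteq> A" for n
    using D(1)[of n] by (auto simp: compactin_subtopology)
  have CX: "?C \<subseteq> fin_subsets (topspace X)" using AX by (auto simp: fin_subsets_def)
  have EC: "E n \<subseteq> ?C" for n using KA[of n] by (auto simp: E_def small_subsets_def fin_subsets_def)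
  have oC: "openin T ?C" by (rule openin_T_subsets[OF A(1)])
  have cE: "compactin T (E n)" for n unfolding E_def by (rule compactin_small_subsets[OF KX])
  have HT: "Hausdorff_space T" by (rule Hausdorff_T[OF H])
  have Emono: "E m \<subseteq> E n" if "m \<le> n" for m n
    using mono[OF that] that by (auto simp: E_def small_subsets_def fin_subsets_def)
  have UE: "(\<Union>n. E n) = ?C"
  proof
    show "?C \<subseteq> (\<Union>n. E n)"
    proof
      fix F assume F: "F \<in> ?C"
      then have "finite F" by (auto simp: fin_subsets_def)
      have "\<forall>x\<in>F. \<exists>n. x \<in> K n" using F D(3) by (auto simp: fin_subsets_def)
      then obtain k where k: "\<And>x. x \<in> F \<Longrightarrow> x \<in> K (k x)" by metis
      \<comment> \<open>One index has to bound the cardinality of \<open>F\<close> and the stages of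
        all its points.\<close>
      define N where "N = card F + (\<Sum>x\<in>F. k x)"
      have "x \<in> K N" if "x \<in> F" for x
      proof -
        have "k x \<le> N" using member_le_sum[OF that, of k] \<open>finite F\<close> unfolding N_def by auto
        then show ?thesis using mono k[OF that] by blast
      qed
      then have "F \<in> E N" using F unfolding E_def small_subsets_def fin_subsets_def N_def by auto
      then show "F \<in> (\<Union>n. E n)" by blast
    qed
  qed (use EC in auto)
  define op where "op U \<longleftrightarrow> U \<subseteq> ?C \<and> (\<forall>n. openin (subtopology T (E n)) (U \<inter> E n))" for U
  have isop: "istopology op"
    unfolding istopology_def
  proof (intro conjI allI impI)
    fix U V assume UV: "op U" "op V"
    have "U \<inter> V \<inter> E n = (U \<inter> E n) \<inter> (V \<inter> E n)" for n by auto
    then show "op (U \<inter> V)" using UV unfolding op_def by auto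
  next
    fix \<U> assume U: "\<forall>U\<in>\<U>. op U"
    have "\<Union>\<U> \<inter> E n = \<Union>((\<lambda>U. U \<inter> E n) ` \<U>)" for n by auto
    moreover have "openin (subtopology T (E n)) (\<Union>((\<lambda>U. U \<inter> E n) ` \<U>))" for n
      by (rule openin_Union) (use U op_def in auto)
    ultimately show "op (\<Union>\<U>)" using U unfolding op_def by auto
  qed
  define Y where "Y = topology op"
  have opY: "openin Y = op" unfolding Y_def using isop by simp
  have finer: "openin Y (U \<inter> ?C)" if "openin T U" for U
  proof -
    have "openin (subtopology T (E n)) (U \<inter> ?C \<inter> E n)" for n
      using that oC by (intro openin_subtopology_Int) blast
    then show ?thesis unfolding opY op_def by auto
  qed
  have tT: "topspace T \<inter> ?C = ?C" using CX topspace_T by auto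
  have "openin Y ?C" using finer[OF openin_topspace] tT by simp
  then have tY: "topspace Y = ?C"
    using openin_subset[OF openin_topspace[of Y]] openin_subset[of Y ?C] opY op_def
    by (metis openin_topspace subset_antisym)
  have HY: "Hausdorff_space Y"
    unfolding Hausdorff_space_def
  proof (intro allI impI, elim conjE)
    fix F G assume FG: "F \<in> topspace Y" "G \<in> topspace Y" "F \<noteq> G"
    then have "F \<in> topspace T" "G \<in> topspace T" using tY CX topspace_T by auto
    then obtain U V where "openin T U" "openin T V" "F \<in> U" "G \<in> V" "disjnt U V"
      using HT FG(3) unfolding Hausdorff_space_def by metis
    then show "\<exists>U V. openin Y U \<and> openin Y V \<and> F \<in> U \<and> G \<in> V \<and> disjnt U V"
      using finer[of U] finer[of V] FG tY
      by (intro exI[of _ "U \<inter> ?C"] exI[of _ "V \<inter> ?C"]) (auto simp: disjnt_def)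
  qed
  have sub: "subtopology Y (E n) = subtopology T (E n)" for n
    unfolding topology_eq
  proof (intro allI iffI)
    fix V assume "openin (subtopology Y (E n)) V"
    then obtain U where "openin Y U" "V = U \<inter> E n" by (auto simp: openin_subtopology)
    then show "openin (subtopology T (E n)) V" unfolding opY op_def by blast
  next
    fix V assume "openin (subtopology T (E n)) V"
    then obtain U where U: "openin T U" "V = U \<inter> E n" by (auto simp: openin_subtopology)
    then have "V = (U \<inter> ?C) \<inter> E n" using EC by blast
    then show "openin (subtopology Y (E n)) V" using finer[OF U(1)] openin_subtopology by blast
  qed
  have exY: "compact_exhaustion Y E"
    unfolding compact_exhaustion_def
  proof (intro conjI allI impI)
    show "compactin Y (E n)" for n
      using cE[of n] EC[of n] tY unfolding compactin_subspace sub by auto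
    show "incseq E" using Emono by (auto simp: incseq_def)
    show "(\<Union>n. E n) = topspace Y" using UE tY by simp
    fix F assume F: "F \<subseteq> topspace Y \<and> (\<forall>n. closedin Y (F \<inter> E n))"
    have "op (?C - F)"
      unfolding op_def
    proof (intro conjI allI)
      fix n
      have "closedin (subtopology Y (E n)) (F \<inter> E n \<inter> E n)"
        using F by (meson closedin_subtopology)
      then have "openin (subtopology Y (E n)) (topspace (subtopology Y (E n)) - F \<inter> E n \<inter> E n)" by blast
      moreover have "topspace (subtopology Y (E n)) - F \<inter> E n \<inter> E n = (?C - F) \<inter> E n"
        using EC[of n] tY by auto
      ultimately show "openin (subtopology T (E n)) ((?C - F) \<inter> E n)" using sub by metis
    qed auto
    then show "closedin Y F" using F tY opY unfolding closedin_def by simp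
  qed
  have un: "\<exists>V1 V2. openin Y V1 \<and> openin Y V2 \<and> F \<in> V1 \<and> G \<in> V2 \<and> (\<forall>F'\<in>V1. \<forall>G'\<in>V2. F' \<union> G' \<in> U)"
    if U: "openin Y U" and FG: "F \<in> ?C" "G \<in> ?C" "F \<union> G \<in> U" for F G U
  proof -
    define W where "W = {z \<in> ?C \<times> ?C. fst z \<union> snd z \<in> U}"
    have "openin (prod_topology Y Y) W"
    proof (rule compact_exhaustion_prod_openin[OF exY HY])
      show "W \<subseteq> topspace Y \<times> topspace Y" unfolding W_def tY by auto
      fix n
      let ?P = "prod_topology (subtopology T (E n)) (subtopology T (E n))"
      have P: "?P = subtopology (prod_topology T T) (E n \<times> E n)" by (simp add: subtopology_Times)
      have tE: "topspace T \<inter> E n = E n" for n using EC[of n] tT by blast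
      have "continuous_map ?P T (\<lambda>(x, y). x \<union> y)"
        unfolding P by (rule continuous_map_from_subtopology) (rule topological_semilatticeD(1)[OF semilattice_T])
      \<comment> \<open>Two sets of at most \<open>n + 1\<close> points have a union of at most
        \<open>2 n + 2 = Suc (n + n + 1)\<close> points.\<close>
      moreover have "F \<union> G \<in> E (n + n + 1)" if "F \<in> E n" "G \<in> E n" for F G
      proof -
        have "card (F \<union> G) \<le> card F + card G" by (rule card_Un_le)
        then show ?thesis
          using that mono[of n "n+n+1"] unfolding E_def small_subsets_def fin_subsets_def by auto
      qed
      ultimately have c: "continuous_map ?P (subtopology T (E (n + n + 1))) (\<lambda>(x, y). x \<union> y)"
        unfolding continuous_map_in_subtopology by auto
      have "openin (subtopology T (E (n + n + 1))) (U \<inter> E (n + n + 1))"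
        using U unfolding opY op_def by blast
      from openin_continuous_map_preimage[OF c this]
      have "openin ?P {z \<in> topspace ?P. (\<lambda>(x, y). x \<union> y) z \<in> U \<inter> E (n + n + 1)}" .
      moreover have "{z \<in> topspace ?P. (\<lambda>(x, y). x \<union> y) z \<in> U \<inter> E (n + n + 1)} = W \<inter> E n \<times> E n"
        using \<open>\<And>G F. F \<in> E n \<Longrightarrow> G \<in> E n \<Longrightarrow> F \<union> G \<in> E (n + n + 1)\<close> EC[of n] tE[of n]
        unfolding W_def by auto
      ultimately show "openin (prod_topology (subtopology Y (E n)) (subtopology Y (E n))) (W \<inter> E n \<times> E n)"
        unfolding sub by simp
    qed
    moreover have "(F, G) \<in> W" using FG unfolding W_def by simp
    ultimately obtain V1 V2 where "openin Y V1" "openin Y V2" "F \<in> V1" "G \<in> V2" "V1 \<times> V2 \<subseteq> W"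
      unfolding openin_prod_topology_alt by meson
    then show ?thesis unfolding W_def by (intro exI[of _ V1] exI[of _ V2]) auto
  qed
  \<comment> \<open>A retraction onto \<open>A\<close>, continuous since \<open>A\<close> is clopen;
    all other points go to \<open>a0\<close>. The subbase criterion is about finite subsets of all
    of \<open>X\<close>, and images under \<open>r\<close> carry sets of finite subsets of
    \<open>A\<close> over to that carrier.\<close>
  define r where "r x = (if x \<in> A then x else a0)" for x
  have rA: "r ` F \<in> ?C" if "F \<in> fin_subsets (topspace X)" for F
    using that A(3) by (auto simp: fin_subsets_def r_def)
  have rid: "r ` F = F" if "F \<in> ?C" for F
    using that by (force simp: fin_subsets_def r_def)
  have opens: "openin T U" if U: "openin Y U" for U
  proof -
    define pre where "pre U = {F \<in> fin_subsets (topspace X). r ` F \<in> U}" for U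
    have "openin T (pre U)"
    proof (rule openin_T_subbase[where \<B> = "{pre U |U. openin Y U}"])
      show "\<And>B. B \<in> {pre U |U. openin Y U} \<Longrightarrow> B \<subseteq> fin_subsets (topspace X)" by (auto simp: pre_def)
      show "pre U \<in> {pre U |U. openin Y U}" using U by blast
    next
      fix B F G assume *: "B \<in> {pre U |U. openin Y U}" "F \<in> fin_subsets (topspace X)"
        "G \<in> fin_subsets (topspace X)" "F \<union> G \<in> B"
      then obtain U where U: "openin Y U" "B = pre U" by blast
      have "r ` F \<union> r ` G \<in> U" using *(4) unfolding U(2) pre_def by (simp add: image_Un)
      from un[OF U(1) rA[OF *(2)] rA[OF *(3)] this]
      obtain V1 V2 where V: "openin Y V1" "openin Y V2" "r ` F \<in> V1" "r ` G \<in> V2"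
        "\<And>F' G'. F' \<in> V1 \<Longrightarrow> G' \<in> V2 \<Longrightarrow> F' \<union> G' \<in> U" by blast
      have "F \<in> pre V1" "G \<in> pre V2" using V *(2,3) unfolding pre_def by auto
      moreover have "\<forall>F'\<in>pre V1. \<forall>G'\<in>pre V2. F' \<union> G' \<in> B"
        using V(5) unfolding U(2) pre_def by (simp add: image_Un fin_subsets_simps(2))
      moreover have "pre V1 \<in> insert (fin_subsets (topspace X)) {pre U |U. openin Y U}"
        "pre V2 \<in> insert (fin_subsets (topspace X)) {pre U |U. openin Y U}" using V(1,2) by blast+
      ultimately show "\<exists>B1\<in>insert (fin_subsets (topspace X)) {pre U |U. openin Y U}.
          \<exists>B2\<in>insert (fin_subsets (topspace X)) {pre U |U. openin Y U}.
            F \<in> B1 \<and> G \<in> B2 \<and> (\<forall>F'\<in>B1. \<forall>G'\<in>B2. F' \<union> G' \<in> B)" by meson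
    next
      fix B assume "B \<in> {pre U |U. openin Y U}"
      then obtain U where U: "openin Y U" "B = pre U" by blast
      have "openin (subtopology X A) {x \<in> A. {x} \<in> U}"
      proof (rule compact_exhaustion_openin[OF K])
        show "Hausdorff_space (subtopology X A)" using H Hausdorff_space_subtopology by blast
        show "{x \<in> A. {x} \<in> U} \<subseteq> topspace (subtopology X A)" using tA by auto
        fix n
        let ?S = "subtopology X (K n)"
        have tS: "topspace ?S = K n" using KA[of n] AX by auto
        have SE: "{x} \<in> E n" if "x \<in> K n" for x
          using that unfolding E_def small_subsets_def fin_subsets_def by auto
        have c: "continuous_map ?S (subtopology T (E n)) (\<lambda>x. {x})"
          unfolding continuous_map_in_subtopology
          using continuous_map_from_subtopology[OF continuous_singleton] SE tS by auto
        have "openin (subtopology T (E n)) (U \<inter> E n)" using U(1) unfolding opY op_def by blast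
        from openin_continuous_map_preimage[OF c this]
        have "openin ?S {x \<in> topspace ?S. {x} \<in> U \<inter> E n}" .
        moreover have "{x \<in> topspace ?S. {x} \<in> U \<inter> E n} = {x \<in> A. {x} \<in> U} \<inter> K n"
          using tS SE KA[of n] by auto
        moreover have "subtopology (subtopology X A) (K n) = ?S"
          using KA[of n] by (simp add: subtopology_subtopology Int_absorb1)
        ultimately show "openin (subtopology (subtopology X A) (K n)) ({x \<in> A. {x} \<in> U} \<inter> K n)" by simp
      qed
      then have 1: "openin X {x \<in> A. {x} \<in> U}" using A(1) openin_trans_full by blast
      have 2: "openin X (if {a0} \<in> U then topspace X - A else {})" using A(2) by auto
      have "{x \<in> topspace X. {x} \<in> B} =
          {x \<in> A. {x} \<in> U} \<union> (if {a0} \<in> U then topspace X - A else {})"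
      proof -
        have "{x} \<in> B \<longleftrightarrow> {r x} \<in> U" if "x \<in> topspace X" for x
          using that unfolding U(2) pre_def fin_subsets_def by simp
        then show ?thesis using AX unfolding r_def by (auto split: if_splits)
      qed
      then show "openin X {x \<in> topspace X. {x} \<in> B}" using openin_Un[OF 1 2] by metis
    qed
    then have "openin T (pre U \<inter> ?C)" using oC by blast
    moreover have "pre U \<inter> ?C = U"
    proof -
      have "U \<subseteq> ?C" using U unfolding opY op_def by blast
      then show ?thesis using rid CX unfolding pre_def by auto
    qed
    ultimately show ?thesis by simp
  qed
  have "Y = subtopology T ?C"
    unfolding topology_eq
  proof (intro allI iffI)
    fix U assume U: "openin Y U"
    then have "U = U \<inter> ?C" unfolding opY op_def by blast
    then show "openin (subtopology T ?C) U" using opens[OF U] openin_subtopology by blast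
  next
    fix U assume "openin (subtopology T ?C) U"
    then show "openin Y U" using finer by (auto simp: openin_subtopology)
  qed
  with exY show ?thesis unfolding E_def by simp
qed

text \<open>By continuity of the iterated union, a neighbourhood of a finite set contains every
  selection from suitable neighbourhoods of its points, and a network member can be put into each of
  these.\<close>

lemma network_T:
  assumes A: "openin X A" and N: "countable \<N>" "network_in (subtopology X A) \<N>"
  shows "network_in (subtopology T (fin_subsets A)) (chosen_sets ` (lists \<N> - {[]}))"
  unfolding network_in_def
proof (intro conjI allI impI ballI)
  have AX: "A \<subseteq> topspace X" using A openin_subset by blast
  then have CX: "fin_subsets A \<subseteq> topspace T" unfolding topspace_T by (auto simp: fin_subsets_def)
  have NA: "N \<subseteq> A" if "N \<in> \<N>" for N using N(2) that AX unfolding network_in_def by auto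
  have chA: "chosen_sets Ns \<subseteq> fin_subsets A" if Ns: "Ns \<in> lists \<N> - {[]}" for Ns
  proof
    fix F assume "F \<in> chosen_sets Ns"
    then obtain xs where xs: "list_all2 (\<in>) xs Ns" "F = set xs" unfolding chosen_sets_def by blast
    have "xs \<noteq> []" using xs Ns by auto
    moreover have "set xs \<subseteq> A"
    proof
      fix x assume "x \<in> set xs"
      then obtain i where i: "i < length xs" "x = xs ! i" by (metis in_set_conv_nth)
      then have "x \<in> Ns ! i" "Ns ! i \<in> set Ns" using xs(1) by (auto simp: list_all2_conv_all_nth)
      then show "x \<in> A" using NA Ns by auto
    qed
    ultimately show "F \<in> fin_subsets A" using xs by (auto simp: fin_subsets_def)
  qed
  then show "M \<subseteq> topspace (subtopology T (fin_subsets A))" if "M \<in> chosen_sets ` (lists \<N> - {[]})" for M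
    using that CX by auto
  fix F W assume FW: "openin (subtopology T (fin_subsets A)) W \<and> F \<in> W"
  then have W: "openin T W" "F \<in> W"
    using openin_trans_full[OF _ openin_T_subsets[OF A]] by blast+
  have "F \<in> fin_subsets A" using FW openin_subset by fastforce
  then have "\<exists>Ns\<in>lists \<N> - {[]}. F \<in> chosen_sets Ns \<and> chosen_sets Ns \<subseteq> W"
    using W
  proof (induction arbitrary: W rule: fin_subsets_induct)
    case (singleton x)
    have "openin X {y \<in> topspace X. {y} \<in> W}"
      by (rule openin_continuous_map_preimage[OF continuous_singleton singleton(2)])
    then have "openin (subtopology X A) ({y \<in> topspace X. {y} \<in> W} \<inter> A)"
      by (rule openin_subtopology_Int)
    moreover have "x \<in> {y \<in> topspace X. {y} \<in> W} \<inter> A" using singleton AX by auto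
    ultimately obtain N where N: "N \<in> \<N>" "x \<in> N" "N \<subseteq> {y \<in> topspace X. {y} \<in> W} \<inter> A"
      using N(2) unfolding network_in_def by meson
    have "chosen_sets [N] = (\<lambda>x. {x}) ` N"
      unfolding chosen_sets_def by (force simp: list_all2_Cons2)
    then have "{x} \<in> chosen_sets [N]" "chosen_sets [N] \<subseteq> W" using N by auto
    then show ?case using N(1) by (intro bexI[of _ "[N]"]) auto
  next
    case (union x G)
    have "{x} \<in> fin_subsets (topspace X)" "G \<in> fin_subsets (topspace X)"
      using union AX by (auto simp: fin_subsets_def)
    from union_nhds[OF union.prems this]
    obtain W1 W2 where W12: "openin T W1" "openin T W2" "{x} \<in> W1" "G \<in> W2"
      "\<And>F' G'. F' \<in> W1 \<Longrightarrow> G' \<in> W2 \<Longrightarrow> F' \<union> G' \<in> W" by metis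
    obtain Ns where Ns: "Ns \<in> lists \<N> - {[]}" "G \<in> chosen_sets Ns" "chosen_sets Ns \<subseteq> W2"
      using union.IH[OF W12(2,4)] by blast
    have "openin X {y \<in> topspace X. {y} \<in> W1}"
      by (rule openin_continuous_map_preimage[OF continuous_singleton W12(1)])
    then have "openin (subtopology X A) ({y \<in> topspace X. {y} \<in> W1} \<inter> A)"
      by (rule openin_subtopology_Int)
    moreover have "x \<in> {y \<in> topspace X. {y} \<in> W1} \<inter> A" using union W12 AX by auto
    ultimately obtain N where N: "N \<in> \<N>" "x \<in> N" "N \<subseteq> {y \<in> topspace X. {y} \<in> W1} \<inter> A"
      using N(2) unfolding network_in_def by meson
    have eq: "chosen_sets (N # Ns) = {{y} \<union> F |y F. y \<in> N \<and> F \<in> chosen_sets Ns}"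
    proof (intro equalityI subsetI)
      fix F assume "F \<in> chosen_sets (N # Ns)"
      then obtain y ys where "y \<in> N" "list_all2 (\<in>) ys Ns" "F = set (y # ys)"
        unfolding chosen_sets_def by (auto simp: list_all2_Cons2)
      then show "F \<in> {{y} \<union> F |y F. y \<in> N \<and> F \<in> chosen_sets Ns}"
        unfolding chosen_sets_def by auto
    next
      fix F assume "F \<in> {{y} \<union> F |y F. y \<in> N \<and> F \<in> chosen_sets Ns}"
      then obtain y ys where y: "y \<in> N" "list_all2 (\<in>) ys Ns" "F = {y} \<union> set ys"
        unfolding chosen_sets_def by auto
      then have "list_all2 (\<in>) (y # ys) (N # Ns)" "F = set (y # ys)" by auto
      then show "F \<in> chosen_sets (N # Ns)" unfolding chosen_sets_def by blast
    qed
    have "{x} \<union> G \<in> chosen_sets (N # Ns)" unfolding eq using N Ns by blast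
    moreover have "chosen_sets (N # Ns) \<subseteq> W" unfolding eq using N Ns W12(5) by blast
    ultimately show ?case using Ns(1) N(1) by (intro bexI[of _ "N # Ns"]) auto
  qed
  then show "\<exists>M\<in>chosen_sets ` (lists \<N> - {[]}). F \<in> M \<and> M \<subseteq> W" by blast
qed

lemma cosmic_k_omega_space_T:
  assumes H: "Hausdorff_space X" and A: "openin X A" "closedin X A"
    and cos: "cosmic_k_omega_space (subtopology X A)"
  shows "cosmic_k_omega_space (subtopology T (fin_subsets A))"
\<comment> \<open>The retraction behind \<open>compact_exhaustion_T\<close> needs a point of
  \<open>A\<close>, so the empty piece is checked by hand.\<close>
proof (cases "A = {}")
  case True
  then have "fin_subsets A = {}" by (auto simp: fin_subsets_def)
  then have "closedin (subtopology T (fin_subsets A)) F" if "F \<subseteq> {}" for F using that by simp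
  moreover have "topspace (subtopology T (fin_subsets A)) = {}" using \<open>fin_subsets A = {}\<close> by simp
  ultimately show ?thesis
    unfolding cosmic_k_omega_space_def cosmic_space_def regular_T1_space_def k_omega_space_def
      network_in_def
    using \<open>fin_subsets A = {}\<close>
    by (auto intro!: exI[of _ "{}"] simp: regular_space_def t1_space_def dest: openin_subset closedin_subset)
next
  case False
  then obtain a0 where a0: "a0 \<in> A" by blast
  obtain K where K: "compact_exhaustion (subtopology X A) K" using cos cosmic_k_omega_space_iff by blast
  note ex = compact_exhaustion_T[OF H A a0 K]
  have HS: "Hausdorff_space (subtopology T (fin_subsets A))"
    using Hausdorff_T[OF H] Hausdorff_space_subtopology by blast
  obtain \<N> where N: "countable \<N>" "network_in (subtopology X A) \<N>"
    using cos unfolding cosmic_k_omega_space_def cosmic_space_def by blast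
  have "countable (chosen_sets ` (lists \<N> - {[]}))" using N(1) by simp
  then have "cosmic_space (subtopology T (fin_subsets A))"
    using network_T[OF A(1) N] compact_exhaustion_imp_regular_space[OF ex HS]
      Hausdorff_imp_t1_space[OF HS]
    unfolding cosmic_space_def regular_T1_space_def by blast
  then show ?thesis using ex unfolding cosmic_k_omega_space_iff by blast
qed

end

text \<open>A finite set may meet several pieces, so the semilattice has to be controlled over
  finite unions of pieces.\<close>

lemma cosmic_k_omega_space_finite_union:
  assumes reg: "regular_T1_space X" and J: "finite J"
    and cos: "\<And>U. U \<in> J \<Longrightarrow> openin X U \<and> closedin X U \<and> cosmic_k_omega_space (subtopology X U)"
  shows "cosmic_k_omega_space (subtopology X (\<Union>J))"
proof -
  have UX: "U \<subseteq> topspace X" if "U \<in> J" for U using cos[OF that] openin_subset by blast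
  then have tJ: "topspace (subtopology X (\<Union>J)) = \<Union>J" by auto
  have "\<forall>U\<in>J. \<exists>\<N>. countable \<N> \<and> network_in (subtopology X U) \<N>"
    using cos unfolding cosmic_k_omega_space_def cosmic_space_def by blast
  then obtain \<N> where N: "\<And>U. U \<in> J \<Longrightarrow> countable (\<N> U) \<and> network_in (subtopology X U) (\<N> U)" by metis
  have "network_in (subtopology X (\<Union>J)) (\<Union>U\<in>J. \<N> U)"
    unfolding network_in_def
  proof (intro conjI allI impI ballI)
    fix M assume "M \<in> (\<Union>U\<in>J. \<N> U)"
    then obtain U where "U \<in> J" "M \<in> \<N> U" by blast
    then have "M \<subseteq> U" using N[of U] unfolding network_in_def by auto
    then show "M \<subseteq> topspace (subtopology X (\<Union>J))" using \<open>U \<in> J\<close> tJ by blast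
  next
    fix y V assume V: "openin (subtopology X (\<Union>J)) V \<and> y \<in> V"
    then have "y \<in> \<Union>J" using openin_subset[of "subtopology X (\<Union>J)" V] tJ by blast
    then obtain U where U: "U \<in> J" "y \<in> U" by blast
    obtain V' where "openin X V'" "V = V' \<inter> \<Union>J" using V by (auto simp: openin_subtopology)
    then have "V \<inter> U = V' \<inter> U" using U by blast
    then have "openin (subtopology X U) (V \<inter> U)"
      using \<open>openin X V'\<close> by (simp add: openin_subtopology_Int)
    moreover have "y \<in> V \<inter> U" using V U(2) by blast
    ultimately have "\<exists>M\<in>\<N> U. y \<in> M \<and> M \<subseteq> V \<inter> U"
      using N[OF U(1)] unfolding network_in_def by meson
    then show "\<exists>M\<in>\<Union>U\<in>J. \<N> U. y \<in> M \<and> M \<subseteq> V" using U(1) by blast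
  qed
  moreover have "countable (\<Union>U\<in>J. \<N> U)" using J N by (simp add: countable_finite)
  moreover have "regular_T1_space (subtopology X (\<Union>J))"
    using reg unfolding regular_T1_space_def
    by (simp add: regular_space_subtopology t1_space_subtopology)
  ultimately have 1: "cosmic_space (subtopology X (\<Union>J))" unfolding cosmic_space_def by blast
  have "\<forall>U\<in>J. \<exists>K. compact_exhaustion (subtopology X U) K"
    using cos unfolding cosmic_k_omega_space_iff by blast
  then obtain K where K: "\<And>U. U \<in> J \<Longrightarrow> compact_exhaustion (subtopology X U) (K U)" by metis
  have KU: "compactin X (K U n)" "K U n \<subseteq> U" if "U \<in> J" for U n
    using compact_exhaustionD(1)[OF K[OF that]] by (auto simp: compactin_subtopology)
  have "compact_exhaustion (subtopology X (\<Union>J)) (\<lambda>n. \<Union>U\<in>J. K U n)"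
    unfolding compact_exhaustion_def
  proof (intro conjI allI impI)
    fix n
    have "compactin X (\<Union>U\<in>J. K U n)" by (rule compactin_Union) (use J KU in auto)
    then show "compactin (subtopology X (\<Union>J)) (\<Union>U\<in>J. K U n)"
      unfolding compactin_subtopology using KU(2) by blast
  next
    have "K U m \<subseteq> K U n" if "U \<in> J" "m \<le> n" for U m n
      using compact_exhaustionD(2)[OF K[OF that(1)]] that(2) by (simp add: incseqD)
    then show "incseq (\<lambda>n. \<Union>U\<in>J. K U n)"
      unfolding incseq_def by (intro allI impI UN_mono) auto
  next
    have "(\<Union>n. K U n) = U" if "U \<in> J" for U
      using compact_exhaustionD(3)[OF K[OF that]] UX[OF that] by auto
    then have "(\<Union>U\<in>J. \<Union>n. K U n) = \<Union>J" by simp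
    moreover have "(\<Union>n. \<Union>U\<in>J. K U n) = (\<Union>U\<in>J. \<Union>n. K U n)" by (rule SUP_commute)
    ultimately show "(\<Union>n. \<Union>U\<in>J. K U n) = topspace (subtopology X (\<Union>J))" unfolding tJ by simp
  next
    fix F assume F: "F \<subseteq> topspace (subtopology X (\<Union>J)) \<and>
      (\<forall>n. closedin (subtopology X (\<Union>J)) (F \<inter> (\<Union>U\<in>J. K U n)))"
    have cJ: "closedin X (\<Union>J)" using J cos by (intro closedin_Union) auto
    have Fn: "closedin X (F \<inter> (\<Union>U\<in>J. K U n))" for n
      using F closedin_closed_subtopology[OF cJ] by blast
    have "closedin X (F \<inter> U)" if U: "U \<in> J" for U
    proof -
      have cU: "closedin X U" using cos U by blast
      have "closedin (subtopology X U) (F \<inter> U)"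
      proof (rule compact_exhaustionD(4)[OF K[OF U]])
        show "F \<inter> U \<subseteq> topspace (subtopology X U)" using UX[OF U] by auto
        fix n
        have "Hausdorff_space X" using reg regular_t1_imp_Hausdorff_space unfolding regular_T1_space_def by blast
        then have "closedin X (K U n)" using compactin_imp_closedin KU(1)[OF U] by blast
        then have "closedin X (F \<inter> (\<Union>U\<in>J. K U n) \<inter> K U n)" using Fn by blast
        moreover have "F \<inter> (\<Union>U\<in>J. K U n) \<inter> K U n = F \<inter> U \<inter> K U n" using KU(2)[OF U] U by blast
        ultimately show "closedin (subtopology X U) (F \<inter> U \<inter> K U n)"
          unfolding closedin_closed_subtopology[OF cU] by auto
      qed
      then show ?thesis using closedin_closed_subtopology[OF cU] by blast
    qed
    then have "closedin X (\<Union>U\<in>J. F \<inter> U)" using J by (intro closedin_Union) auto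
    moreover have "(\<Union>U\<in>J. F \<inter> U) = F" using F tJ by auto
    ultimately show "closedin (subtopology X (\<Union>J)) F"
      using F tJ closedin_closed_subtopology[OF cJ] by auto
  qed
  then show ?thesis using 1 unfolding cosmic_k_omega_space_iff by blast
qed

context free_fin_semilattice
begin

text \<open>Being contained in \<open>\<Union>J\<close> and hitting each member of the finite set
  \<open>J\<close> are open conditions, so the sets that meet exactly the pieces in \<open>J\<close>
  form an open set. Hitting a clopen piece is a closed condition too; this open set is therefore
  closed in the semilattice over \<open>\<Union>J\<close> and inherits its properties.\<close>

lemma cosmic_k_omega_partition_T:
  assumes reg: "regular_T1_space X" and P: "cosmic_k_omega_partition X \<U>"
  shows "\<exists>\<V>. cosmic_k_omega_partition T \<V>"
proof -
  note D = cosmic_k_omega_partitionD[OF P]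
  let ?C = "fin_subsets (topspace X)"
  have H: "Hausdorff_space X" using reg regular_t1_imp_Hausdorff_space unfolding regular_T1_space_def by blast
  define pcs where "pcs F = {U \<in> \<U>. F \<inter> U \<noteq> {}}" for F
  define S where "S J = {F \<in> ?C. pcs F = J}" for J
  have clo: "closedin X U" if "U \<in> \<U>" for U using D(6)[of "{U}"] that by simp
  have fin: "finite (pcs F)" if "F \<in> ?C" for F
  proof -
    have "pcs F \<subseteq> (\<lambda>x. THE U. U \<in> \<U> \<and> x \<in> U) ` F"
    proof
      fix U assume "U \<in> pcs F"
      then obtain x where x: "U \<in> \<U>" "x \<in> F" "x \<in> U" unfolding pcs_def by blast
      have "(THE U. U \<in> \<U> \<and> x \<in> U) = U"
        by (rule the_equality) (use x D(1) in \<open>auto simp: disjoint_def\<close>)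
      then show "U \<in> (\<lambda>x. THE U. U \<in> \<U> \<and> x \<in> U) ` F" using x(2) by force
    qed
    moreover have "finite F" using that by (simp add: fin_subsets_def)
    ultimately show ?thesis using finite_surj by blast
  qed
  have sub: "F \<subseteq> \<Union>(pcs F)" if "F \<in> ?C" for F
    using that D(2) unfolding pcs_def fin_subsets_def by blast
  have "cosmic_k_omega_partition T (S ` pcs ` ?C)"
    unfolding cosmic_k_omega_partition_def
  proof (intro conjI ballI)
    show "disjoint (S ` pcs ` ?C)" by (auto simp: disjoint_def S_def)
    show "\<Union>(S ` pcs ` ?C) = topspace T" by (auto simp: S_def topspace_T)
    show "{} \<notin> S ` pcs ` ?C" by (auto simp: S_def)
    fix V assume "V \<in> S ` pcs ` ?C"
    then obtain G where G: "G \<in> ?C" "V = S (pcs G)" by blast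
    define J where "J = pcs G"
    have J: "finite J" "J \<subseteq> \<U>" "J \<noteq> {}" using fin[OF G(1)] sub[OF G(1)] G(1)
      by (auto simp: J_def pcs_def fin_subsets_def)
    have oJ: "openin X (\<Union>J)" using J D(4) by (intro openin_Union) auto
    have cJ: "closedin X (\<Union>J)" using D(6) J by blast
    have S_eq: "S J = fin_subsets (\<Union>J) \<inter> (\<Inter>U\<in>J. {F \<in> ?C. F \<inter> U \<noteq> {}})"
    proof (intro equalityI subsetI)
      fix F assume "F \<in> S J"
      then have F: "F \<in> ?C" "pcs F = J" by (auto simp: S_def)
      then have "F \<in> fin_subsets (\<Union>J)" using sub[OF F(1)] by (auto simp: fin_subsets_def)
      moreover have "F \<inter> U \<noteq> {}" if "U \<in> J" for U using that F(2) unfolding pcs_def by blast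
      ultimately show "F \<in> fin_subsets (\<Union>J) \<inter> (\<Inter>U\<in>J. {F \<in> ?C. F \<inter> U \<noteq> {}})" using F by blast
    next
      fix F assume F: "F \<in> fin_subsets (\<Union>J) \<inter> (\<Inter>U\<in>J. {F \<in> ?C. F \<inter> U \<noteq> {}})"
      have "\<Union>J \<subseteq> topspace X" using J(2) D(2) by blast
      then have FC: "F \<in> ?C" using F unfolding fin_subsets_def by blast
      have "J \<subseteq> pcs F" using F J(2) unfolding pcs_def by blast
      moreover have "pcs F \<subseteq> J"
      proof
        fix U assume "U \<in> pcs F"
        then obtain x where x: "U \<in> \<U>" "x \<in> F" "x \<in> U" unfolding pcs_def by blast
        then obtain U' where "U' \<in> J" "x \<in> U'" using F by (auto simp: fin_subsets_def)
        then have "U = U'" using disjointD[OF D(1), of U U'] x J(2) by blast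
        then show "U \<in> J" using \<open>U' \<in> J\<close> by simp
      qed
      ultimately show "F \<in> S J" using FC unfolding S_def by blast
    qed
    have "openin T (\<Inter>U\<in>J. {F \<in> ?C. F \<inter> U \<noteq> {}})"
      by (rule openin_Inter) (use J D(4) openin_T_hits in auto)
    then show "openin T V"
      unfolding G(2) J_def[symmetric] S_eq using openin_T_subsets[OF oJ] by blast
    have clh: "closedin T {F \<in> ?C. F \<inter> U \<noteq> {}}" if "U \<in> J" for U
    proof -
      have "openin T (fin_subsets (topspace X - U))"
        by (rule openin_T_subsets) (use clo that J in blast)
      moreover have "topspace T - {F \<in> ?C. F \<inter> U \<noteq> {}} = fin_subsets (topspace X - U)"
        unfolding topspace_T fin_subsets_def by auto
      ultimately show ?thesis unfolding closedin_def topspace_T by auto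
    qed
    have "closedin T (\<Inter>U\<in>J. {F \<in> ?C. F \<inter> U \<noteq> {}})"
      by (rule closedin_Inter) (use J clh in auto)
    then have "closedin (subtopology T (fin_subsets (\<Union>J))) (S J)"
      unfolding S_eq closedin_subtopology by blast
    moreover have "cosmic_k_omega_space (subtopology T (fin_subsets (\<Union>J)))"
      by (intro cosmic_k_omega_space_T[OF H oJ cJ] cosmic_k_omega_space_finite_union[OF reg J(1)])
        (use J D clo in blast)
    ultimately have "cosmic_k_omega_space (subtopology (subtopology T (fin_subsets (\<Union>J))) (S J))"
      by (metis cosmic_k_omega_space_closed_subtopology)
    moreover have "S J \<subseteq> fin_subsets (\<Union>J)" unfolding S_eq by blast
    ultimately show "cosmic_k_omega_space (subtopology T V)"
      unfolding G(2) J_def[symmetric] by (simp add: subtopology_subtopology Int_absorb1)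
  qed
  then show ?thesis by blast
qed

end

section \<open>Strong fans from shrinking non-compact sets\<close>

lemma completely_regular_imp_R_open:
  assumes "completely_regular_space X" and U: "openin X U"
  shows "R_open_in X U"
  unfolding R_open_in_def
proof (intro conjI ballI)
  show "U \<subseteq> topspace X" by (rule openin_subset[OF U])
  fix y assume y: "y \<in> U"
  have "closedin X (topspace X - U)" "y \<in> topspace X - (topspace X - U)"
    using U y openin_subset[OF U] by auto
  then obtain f :: "'a \<Rightarrow> real" where f: "continuous_map X (top_of_set {0..1}) f" "f y = 0"
    "f ` (topspace X - U) \<subseteq> {1}"
    using assms(1) unfolding completely_regular_space_def by metis
  have "continuous_map X euclideanreal (\<lambda>x. 1 - f x)"
    using f(1) by (intro continuous_map_diff) (auto simp: continuous_map_in_subtopology)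
  moreover have "1 - f x \<in> {0..1}" if "x \<in> topspace X" for x
    using continuous_map_funspace[OF f(1)] that by (auto simp: Pi_iff)
  ultimately have "continuous_map X (top_of_set {0..1}) (\<lambda>x. 1 - f x)"
    unfolding continuous_map_in_subtopology by auto
  moreover have "1 - f y = 1" using f(2) by simp
  moreover have "(\<lambda>x. 1 - f x) ` (topspace X - U) \<subseteq> {0}" using f(3) by auto
  ultimately show "\<exists>f :: 'a \<Rightarrow> real. continuous_map X (top_of_set {0..1}) f \<and> f y = 1 \<and> f ` (topspace X - U) \<subseteq> {0}"
    by (intro exI[of _ "\<lambda>x. 1 - f x"]) simp
qed

lemma locally_finite_seq_compactin:
  assumes U: "locally_finite_seq X U" and C: "compactin X C"
  shows "finite {n. U n \<inter> C \<noteq> {}}"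
proof -
  have "\<forall>y\<in>C. \<exists>V. openin X V \<and> y \<in> V \<and> finite {n. U n \<inter> V \<noteq> {}}"
    using U compactin_subset_topspace[OF C] unfolding locally_finite_seq_def by blast
  then obtain V where V: "\<And>y. y \<in> C \<Longrightarrow> openin X (V y) \<and> y \<in> V y \<and> finite {n. U n \<inter> V y \<noteq> {}}" by metis
  then have "(\<forall>B\<in>V ` C. openin X B) \<and> C \<subseteq> \<Union>(V ` C)" by blast
  then obtain \<F> where "finite \<F>" "\<F> \<subseteq> V ` C" "C \<subseteq> \<Union>\<F>"
    using C unfolding compactin_def by meson
  then obtain D where D: "finite D" "D \<subseteq> C" "C \<subseteq> \<Union>(V ` D)" by (metis finite_subset_image)
  have "{n. U n \<inter> C \<noteq> {}} \<subseteq> (\<Union>y\<in>D. {n. U n \<inter> V y \<noteq> {}})" using D(3) by blast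
  moreover have "finite (\<Union>y\<in>D. {n. U n \<inter> V y \<noteq> {}})" using D V by blast
  ultimately show ?thesis using finite_subset by blast
qed

text \<open>A closed non-compact set is unbounded, so some infinite locally finite family of open
  sets meets it. Repeatedly choosing a point of \<open>R\<close> in a member, cutting the member
  down to a neighbourhood that meets finitely many others, and discarding those others yields
  disjoint sets.\<close>

lemma noncompact_closed_locally_finite_seq:
  assumes mu: "mu_complete_space X" and R: "closedin X R" "\<not> compactin X R"
  obtains x U where "\<And>i::nat. x i \<in> R \<inter> U i" and "\<And>i. openin X (U i)"
    and "disjoint_family U" and "locally_finite_seq X U"
proof -
  have "\<not> bounded_in X R" using mu R unfolding mu_complete_space_def by blast
  then obtain \<O> where \<O>: "locally_finite_in X \<O>" "\<And>U. U \<in> \<O> \<Longrightarrow> openin X U \<and> U \<inter> R \<noteq> {}" "infinite \<O>"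
    using closedin_subset[OF R(1)] unfolding bounded_in_def by blast
  \<comment> \<open>A state records the chosen point, its open set, the member of
    \<open>\<O>\<close> containing that set, and the members still available, all of which miss
    it.\<close>
  define P where "P s \<longleftrightarrow> (case s of (x, U, B, \<Q>) \<Rightarrow> x \<in> R \<inter> U \<and> openin X U \<and> U \<subseteq> B \<and> B \<in> \<O> \<and>
      \<Q> \<subseteq> \<O> \<and> infinite \<Q> \<and> (\<forall>Q\<in>\<Q>. Q \<inter> U = {}))" for s
  define Q where "Q s t \<longleftrightarrow> (case s of (x, U, B, \<Q>) \<Rightarrow> case t of (x', U', B', \<Q>') \<Rightarrow> B' \<in> \<Q> \<and> \<Q>' \<subseteq> \<Q>)"
    for s t :: "'a \<times> 'a set \<times> 'a set \<times> 'a set set"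
  have step: "\<exists>x U B \<Q>'. P (x, U, B, \<Q>') \<and> B \<in> \<Q> \<and> \<Q>' \<subseteq> \<Q>" if Q: "\<Q> \<subseteq> \<O>" "infinite \<Q>" for \<Q>
  proof -
    obtain B where B: "B \<in> \<Q>" using Q(2) by (metis ex_in_conv finite.emptyI)
    then obtain x where x: "x \<in> B" "x \<in> R" using \<O>(2) Q(1) by blast
    have xX: "x \<in> topspace X" using closedin_subset[OF R(1)] x by blast
    obtain V where V: "openin X V" "x \<in> V" "finite {U \<in> \<O>. U \<inter> V \<noteq> {}}"
      using \<O>(1) xX unfolding locally_finite_in_def by blast
    define \<Q>' where "\<Q>' = \<Q> - {U \<in> \<O>. U \<inter> V \<noteq> {}}"
    have "infinite \<Q>'" unfolding \<Q>'_def using V(3) Q(2) by (simp add: Diff_infinite_finite)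
    moreover have "\<forall>Q\<in>\<Q>'. Q \<inter> (B \<inter> V) = {}" using Q(1) unfolding \<Q>'_def by blast
    moreover have "openin X (B \<inter> V)" using V(1) \<O>(2) B Q(1) by blast
    moreover have "\<Q>' \<subseteq> \<Q>" "\<Q>' \<subseteq> \<O>" "B \<in> \<O>" using B Q(1) unfolding \<Q>'_def by blast+
    ultimately have "P (x, B \<inter> V, B, \<Q>')" unfolding P_def using x V by auto
    then show ?thesis using B \<open>\<Q>' \<subseteq> \<Q>\<close> by blast
  qed
  have "\<exists>s. \<forall>n::nat. P (s n) \<and> Q (s n) (s (Suc n))"
  proof (rule dependent_nat_choice)
    show "\<exists>s. P s" using step[OF subset_refl \<O>(3)] by blast
  next
    fix s and n :: nat assume Ps: "P s"
    obtain x U B \<Q> where s: "s = (x, U, B, \<Q>)" by (cases s) auto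
    then have "\<Q> \<subseteq> \<O>" "infinite \<Q>" using Ps unfolding P_def by auto
    from step[OF this] obtain x' U' B' \<Q>' where "P (x', U', B', \<Q>')" "B' \<in> \<Q>" "\<Q>' \<subseteq> \<Q>" by blast
    then show "\<exists>t. P t \<and> Q s t" unfolding Q_def s by (intro exI[of _ "(x', U', B', \<Q>')"]) simp
  qed
  then obtain s where s: "\<And>n. P (s n)" "\<And>n. Q (s n) (s (Suc n))" by blast
  define x where "x n = fst (s n)" for n
  define U where "U n = fst (snd (s n))" for n
  define B where "B n = fst (snd (snd (s n)))" for n
  define q where "q n = snd (snd (snd (s n)))" for n
  have s_eq: "s n = (x n, U n, B n, q n)" for n unfolding x_def U_def B_def q_def by simp
  have p: "x n \<in> R \<inter> U n" "openin X (U n)" "U n \<subseteq> B n" "B n \<in> \<O>" "\<And>A. A \<in> q n \<Longrightarrow> A \<inter> U n = {}" for n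
    using s(1)[of n] unfolding s_eq P_def by auto
  have qq: "B (Suc n) \<in> q n" "q (Suc n) \<subseteq> q n" for n
    using s(2)[of n] unfolding s_eq Q_def by auto
  have qmono: "q n \<subseteq> q m" if "m \<le> n" for m n
    using lift_Suc_antimono_le[of q, OF qq(2) that] .
  have Bq: "B n \<in> q m" if "m < n" for m n
  proof -
    obtain k where k: "n = Suc k" "m \<le> k" using less_imp_Suc_add[OF \<open>m < n\<close>] by auto
    then show ?thesis using qq(1)[of k] qmono[OF k(2)] by auto
  qed
  have disj: "B n \<inter> U m = {}" if "m < n" for m n using p(5) Bq that by blast
  have "disjoint_family U"
    unfolding disjoint_family_on_def
  proof (intro ballI impI)
    fix m n :: nat assume "m \<noteq> n"
    then have "m < n \<or> n < m" by linarith
    then show "U m \<inter> U n = {}" using disj[of m n] disj[of n m] p(3) by blast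
  qed
  \<comment> \<open>Local finiteness of \<open>\<O>\<close> counts sets; it bounds indices because
    distinct indices use distinct members.\<close>
  moreover have injB: "inj B"
  proof (rule injI, rule ccontr)
    fix m n assume "B m = B n" "m \<noteq> n"
    then have "m < n \<or> n < m" by linarith
    then show False
      using disj[of m n] disj[of n m] p(1)[of m] p(1)[of n] p(3)[of m] p(3)[of n] \<open>B m = B n\<close> by blast
  qed
  have "locally_finite_seq X U"
    unfolding locally_finite_seq_def
  proof
    fix y assume "y \<in> topspace X"
    then obtain V where V: "openin X V" "y \<in> V" "finite {U \<in> \<O>. U \<inter> V \<noteq> {}}"
      using \<O>(1) unfolding locally_finite_in_def by blast
    have "{n. U n \<inter> V \<noteq> {}} \<subseteq> B -` {U \<in> \<O>. U \<inter> V \<noteq> {}}"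
    proof
      fix n assume "n \<in> {n. U n \<inter> V \<noteq> {}}"
      then show "n \<in> B -` {U \<in> \<O>. U \<inter> V \<noteq> {}}" using p(3)[of n] p(4)[of n] by blast
    qed
    then have "finite {n. U n \<inter> V \<noteq> {}}"
      using finite_vimageI[OF V(3) injB] finite_subset by blast
    then show "\<exists>V. openin X V \<and> y \<in> V \<and> finite {n. U n \<inter> V \<noteq> {}}" using V by blast
  qed
  ultimately show thesis using that p(1,2) by blast
qed

context free_fin_semilattice
begin

text \<open>The pseudometric sums, over all levels \<open>l\<close>, the \<open>\<ell>\<^sub>1\<close>-distances of the vectors
  \<open>(max\<^sub>F f\<^sub>l\<^sub>j)\<^sub>j\<close> with weight \<open>2\<^sup>-\<^sup>l\<close>; disjoint supports keep it finite and continuous on singletons,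
  while sets hitting \<open>4\<^sup>l\<close> members of level \<open>l\<close> escape to infinity.\<close>

lemma compactin_T_hits_bounded:
  fixes N :: "nat \<Rightarrow> nat"
  assumes cr: "completely_regular_space X" and C: "compactin T C"
    and H: "\<And>l::nat. H l \<in> C"
    and U: "\<And>l j. j < N l \<Longrightarrow> openin X (U l j) \<and> H l \<inter> U l j \<noteq> {}"
    and disj: "\<And>l. disjoint_family_on (U l) {..<N l}"
    and N: "\<And>l. 4 ^ l \<le> N l"
  shows False
proof -
  let ?C = "fin_subsets (topspace X)"
  have CC: "C \<subseteq> ?C" using compactin_subset_topspace[OF C] topspace_T by simp
  have fin: "finite F" "F \<noteq> {}" "F \<subseteq> topspace X" if "F \<in> ?C" for F
    using that by (auto simp: fin_subsets_def)
  have "\<exists>f :: 'a \<Rightarrow> real. continuous_map X (top_of_set {0..1}) f \<and> (\<exists>h\<in>H l. f h = 1) \<and>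
      f ` (topspace X - U l j) \<subseteq> {0}" if j: "j < N l" for l j
  proof -
    obtain h where h: "h \<in> H l" "h \<in> U l j" using U[OF j] by blast
    have "R_open_in X (U l j)" by (rule completely_regular_imp_R_open[OF cr]) (use U[OF j] in blast)
    then show ?thesis using h unfolding R_open_in_def by blast
  qed
  note ex_f = this
  define f where "f l j = (SOME f :: 'a \<Rightarrow> real. continuous_map X (top_of_set {0..1}) f \<and>
      (\<exists>h\<in>H l. f h = 1) \<and> f ` (topspace X - U l j) \<subseteq> {0})" for l j
  have f: "continuous_map X (top_of_set {0..1}) (f l j) \<and> (\<exists>h\<in>H l. f l j h = 1) \<and>
      f l j ` (topspace X - U l j) \<subseteq> {0}" if "j < N l" for l j
    unfolding f_def by (rule someI_ex[OF ex_f[OF that]])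
  have fc: "continuous_map X euclideanreal (f l j)" if "j < N l" for l j
    using f[OF that] by (simp add: continuous_map_in_subtopology)
  have f01: "0 \<le> f l j x" "f l j x \<le> 1" if "j < N l" "x \<in> topspace X" for l j x
    using funcset_mem[OF continuous_map_funspace[OF f[OF that(1), THEN conjunct1]], of x] that(2) by auto
  have f0: "f l j x = 0" if "j < N l" "x \<in> topspace X" "x \<notin> U l j" for l j x
    using f[OF that(1)] that(2,3) by blast
  \<comment> \<open>At each point at most one function of level \<open>l\<close> is nonzero. The
    bound does not involve \<open>N l\<close>, so the coordinate sums in \<open>m_card\<close> are
    controlled by cardinality alone and the weighted series converges however fast \<open>N\<close>
    grows.\<close>
  have fsum: "(\<Sum>j<N l. f l j x) \<le> 1" if x: "x \<in> topspace X" for l x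
  proof (cases "\<exists>i<N l. x \<in> U l i")
    case True
    then obtain i where i: "i < N l" "x \<in> U l i" by blast
    have "f l j x = 0" if "j \<in> {..<N l} - {i}" for j
    proof -
      have "U l j \<inter> U l i = {}" using disj[of l] that i unfolding disjoint_family_on_def by blast
      then show ?thesis using f0 x that i(2) by blast
    qed
    then have "(\<Sum>j<N l. f l j x) = f l i x"
      using i(1) by (subst sum.remove[of _ i]) auto
    then show ?thesis using f01(2)[OF i(1) x] by simp
  next
    case False
    then have "(\<Sum>j<N l. f l j x) = 0" using f0 x by (intro sum.neutral) auto
    then show ?thesis by simp
  qed
  define m where "m l j F = Max (f l j ` F)" for l j F
  have m_ge: "f l j x \<le> m l j F" if "F \<in> ?C" "x \<in> F" for l j F x
    unfolding m_def using fin[OF that(1)] that(2) by simp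
  have m0: "0 \<le> m l j F" if F: "F \<in> ?C" and j: "j < N l" for l j F
  proof -
    obtain x where "x \<in> F" using fin[OF F] by blast
    then show ?thesis using m_ge[OF F, of x l j] f01(1)[OF j, of x] fin(3)[OF F] by force
  qed
  have m_le: "m l j F \<le> (\<Sum>x\<in>F. f l j x)" if F: "F \<in> ?C" and j: "j < N l" for l j F
  proof -
    have "m l j F \<in> f l j ` F" unfolding m_def using fin[OF F] by (intro Max_in) auto
    then obtain x where "x \<in> F" "m l j F = f l j x" by blast
    then show ?thesis using fin[OF F] f01(1)[OF j] by (auto intro!: member_le_sum)
  qed
  have m_card: "(\<Sum>j<N l. m l j F) \<le> real (card F)" if F: "F \<in> ?C" for l F
  proof -
    have "(\<Sum>j<N l. m l j F) \<le> (\<Sum>j<N l. \<Sum>x\<in>F. f l j x)" using m_le[OF F] by (intro sum_mono) auto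
    also have "\<dots> = (\<Sum>x\<in>F. \<Sum>j<N l. f l j x)" by (rule sum.swap)
    also have "\<dots> \<le> (\<Sum>x\<in>F. 1)" using fsum fin(3)[OF F] by (intro sum_mono) auto
    finally show ?thesis by simp
  qed
  define s where "s l F G = (\<Sum>j<N l. \<bar>m l j F - m l j G\<bar>)" for l F G
  have s0: "0 \<le> s l F G" for l F G unfolding s_def by (intro sum_nonneg) auto
  have s_card: "s l F G \<le> real (card F) + real (card G)" if "F \<in> ?C" "G \<in> ?C" for l F G
  proof -
    have "s l F G \<le> (\<Sum>j<N l. m l j F + m l j G)"
      unfolding s_def
    proof (rule sum_mono)
      fix j assume "j \<in> {..<N l}"
      then have "0 \<le> m l j F" "0 \<le> m l j G" using m0 that by auto
      then show "\<bar>m l j F - m l j G\<bar> \<le> m l j F + m l j G" by linarith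
    qed
    also have "\<dots> \<le> real (card F) + real (card G)"
      using m_card[OF that(1), of l] m_card[OF that(2), of l] by (simp add: sum.distrib)
    finally show ?thesis .
  qed
  have s_tri: "s l F K \<le> s l F G + s l G K" for l F G K
    unfolding s_def sum.distrib[symmetric] by (intro sum_mono) linarith
  have m_un: "m l j (F \<union> G) = max (m l j F) (m l j G)" if "F \<in> ?C" "G \<in> ?C" for l j F G
    unfolding m_def image_Un using fin[OF that(1)] fin[OF that(2)] by (intro Max_Un) auto
  have s_un: "s l (F \<union> G) (F' \<union> G') \<le> s l F F' + s l G G'"
    if "F \<in> ?C" "F' \<in> ?C" "G \<in> ?C" "G' \<in> ?C" for l F F' G G'
    unfolding s_def sum.distrib[symmetric]
  proof (rule sum_mono)
    fix j assume "j \<in> {..<N l}"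
    show "\<bar>m l j (F \<union> G) - m l j (F' \<union> G')\<bar> \<le> \<bar>m l j F - m l j F'\<bar> + \<bar>m l j G - m l j G'\<bar>"
      using that by (simp add: m_un)
  qed
  define t where "t l F G = (1/2)^l * s l F G" for l F G
  have t0: "0 \<le> t l F G" for l F G unfolding t_def using s0 by simp
  have t_le: "t l F G \<le> (real (card F) + real (card G)) * (1/2)^l" if "F \<in> ?C" "G \<in> ?C" for l F G
    unfolding t_def using s_card[OF that, of l] by (simp add: mult.commute mult_right_mono)
  have geo: "summable (\<lambda>l. c * (1/2::real)^l)" for c
    by (intro summable_mult summable_geometric) simp
  have summ: "summable (\<lambda>l. t l F G)" if "F \<in> ?C" "G \<in> ?C" for F G
    by (rule summable_comparison_test'[OF geo[of "real (card F) + real (card G)"], of 0])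
      (use t_le[OF that] t0 in auto)
  define d where "d F G = (\<Sum>l. t l F G)" for F G
  have ball: "openin T {F \<in> ?C. d G F < e}" if G: "G \<in> ?C" for G e
  proof (rule openin_T_pseudometric_ball[OF _ _ _ _ G])
    show "d F F = 0" for F unfolding d_def t_def s_def by simp
  next
    fix F G K assume *: "F \<in> ?C" "G \<in> ?C" "K \<in> ?C"
    have "t l F K \<le> t l F G + t l G K" for l
      unfolding t_def distrib_left[symmetric] using s_tri by (intro mult_left_mono) auto
    then have "d F K \<le> (\<Sum>l. t l F G + t l G K)"
      unfolding d_def using * by (intro suminf_le summ summable_add) auto
    then show "d F K \<le> d F G + d G K" unfolding d_def using * by (simp add: suminf_add summ)
  next
    fix F F' G G' assume *: "F \<in> ?C" "F' \<in> ?C" "G \<in> ?C" "G' \<in> ?C"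
    have "t l (F \<union> G) (F' \<union> G') \<le> t l F F' + t l G G'" for l
      unfolding t_def distrib_left[symmetric] using s_un * by (intro mult_left_mono) auto
    then have "d (F \<union> G) (F' \<union> G') \<le> (\<Sum>l. t l F F' + t l G G')"
      unfolding d_def using * by (intro suminf_le summ summable_add) (auto intro: fin_subsets_simps)
    then show "d (F \<union> G) (F' \<union> G') \<le> d F F' + d G G'" unfolding d_def using * by (simp add: suminf_add summ)
  next
    fix x and e :: real assume x: "x \<in> topspace X" and e: "e > 0"
    \<comment> \<open>Two singletons are at distance at most 2 on every level, so the levels from
      \<open>L\<close> on contribute at most \<open>2 * (1/2)^L * 2\<close>. The finitely many
      earlier levels form a continuous function of \<open>y\<close>.\<close>
    have "(\<lambda>L. 4 * (1/2::real)^L) \<longlonglongrightarrow> 4 * 0" by (intro tendsto_mult_left LIMSEQ_power_zero) simp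
    then have "eventually (\<lambda>L. 4 * (1/2::real)^L < e / 2) sequentially"
      by (rule order_tendstoD(2)) (use e in simp)
    then obtain L where L: "4 * (1/2::real)^L < e / 2" by (auto simp: eventually_sequentially)
    define g where "g y = (\<Sum>l<L. t l {x} {y})" for y
    have "continuous_map X euclideanreal g"
      unfolding g_def t_def s_def m_def
      by (intro continuous_map_sum continuous_map_real_mult_left continuous_map_real_abs
          continuous_map_diff) (auto simp: fc)
    then have "openin X {y \<in> topspace X. g y < e / 2}"
      unfolding continuous_map_upper_lower_semicontinuous_lt by blast
    moreover have "g x = 0" unfolding g_def t_def s_def by simp
    moreover have "d {x} {y} < e" if y: "y \<in> topspace X" "g y < e / 2" for y
    proof -
      have xy: "{x} \<in> ?C" "{y} \<in> ?C" using x y fin_subsets_simps(1) by auto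
      have "d {x} {y} = (\<Sum>l. t (l + L) {x} {y}) + g y"
        unfolding d_def g_def by (rule suminf_split_initial_segment[OF summ[OF xy]])
      also have "(\<Sum>l. t (l + L) {x} {y}) \<le> (\<Sum>l. (2 * (1/2)^L) * (1/2)^l)"
      proof (rule suminf_le)
        show "t (l + L) {x} {y} \<le> (2 * (1/2)^L) * (1/2)^l" for l
          using t_le[OF xy, of "l + L"] by (simp add: power_add mult.commute mult.left_commute)
        show "summable (\<lambda>l. t (l + L) {x} {y})" using summ[OF xy] by (rule summable_ignore_initial_segment)
      qed (rule geo)
      also have "\<dots> = 4 * (1/2)^L"
        by (subst suminf_mult) (auto simp: suminf_geometric summable_geometric)
      finally show ?thesis using L y(2) by simp
    qed
    ultimately show "\<exists>U. openin X U \<and> x \<in> U \<and> (\<forall>y\<in>U. d {x} {y} < e)"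
      using x e by (intro exI[of _ "{y \<in> topspace X. g y < e / 2}"]) auto
  qed
  have "\<forall>B\<in>(\<lambda>G. {F \<in> ?C. d G F < 1}) ` C. openin T B" using ball CC by blast
  moreover have "C \<subseteq> \<Union>((\<lambda>G. {F \<in> ?C. d G F < 1}) ` C)"
  proof
    fix G assume "G \<in> C"
    moreover have "d G G = 0" unfolding d_def t_def s_def by simp
    ultimately have "G \<in> {F \<in> ?C. d G F < 1}" using CC by auto
    then show "G \<in> \<Union>((\<lambda>G. {F \<in> ?C. d G F < 1}) ` C)" using \<open>G \<in> C\<close> by blast
  qed
  ultimately obtain \<F> where F: "finite \<F>" "\<F> \<subseteq> (\<lambda>G. {F \<in> ?C. d G F < 1}) ` C" "C \<subseteq> \<Union>\<F>"
    using C unfolding compactin_def by meson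
  obtain D where "D \<subseteq> C" "finite D" "\<F> = (\<lambda>G. {F \<in> ?C. d G F < 1}) ` D"
    using finite_subset_image[OF F(1,2)] by auto
  with F(3) have D: "finite D" "D \<subseteq> C" "C \<subseteq> \<Union>((\<lambda>G. {F \<in> ?C. d G F < 1}) ` D)" by auto
  \<comment> \<open>\<open>l\<close> exceeds the cardinality of every centre of the finite subcover,
    so the coordinates of whichever centre is close to \<open>H l\<close> add up to less than
    \<open>l\<close> on level \<open>l\<close>.\<close>
  define l where "l = Suc (\<Sum>G\<in>D. card G)"
  obtain G where G: "G \<in> D" "d G (H l) < 1" using D(3) H[of l] by blast
  have GC: "G \<in> ?C" "H l \<in> ?C" using G D(2) CC H by auto
  have "card G \<le> (\<Sum>G\<in>D. card G)" by (rule member_le_sum) (use G D in auto)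
  then have cG: "card G < l" unfolding l_def by simp
  have "t l G (H l) \<le> d G (H l)"
    unfolding d_def using sum_le_suminf[OF summ[OF GC], of "{l}"] t0 by simp
  then have "(1/2)^l * s l G (H l) < 1" using G(2) unfolding t_def by simp
  then have 1: "s l G (H l) < 2 ^ l" by (simp add: field_simps power_divide)
  have "1 \<le> m l j (H l)" if j: "j < N l" for j
  proof -
    obtain h where "h \<in> H l" "f l j h = 1" using f[OF j] by blast
    then show ?thesis using m_ge[OF GC(2), of h l j] by simp
  qed
  \<comment> \<open>All \<open>N l\<close> coordinates of \<open>H l\<close> are at least 1, its
    level distance to \<open>G\<close> is below \<open>2 ^ l\<close>, and the coordinates of
    \<open>G\<close> add up to less than \<open>l < 2 ^ l\<close>. Hence
    \<open>4 ^ l \<le> N l < 2 * 2 ^ l\<close>, which is impossible for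
    \<open>l \<ge> 1\<close>.\<close>
  then have "real (N l) \<le> (\<Sum>j<N l. m l j (H l))"
    using sum_mono[of "{..<N l}" "\<lambda>_. 1" "\<lambda>j. m l j (H l)"] by simp
  also have "\<dots> \<le> (\<Sum>j<N l. \<bar>m l j G - m l j (H l)\<bar> + m l j G)" by (intro sum_mono) linarith
  also have "\<dots> = s l G (H l) + (\<Sum>j<N l. m l j G)" unfolding s_def by (simp add: sum.distrib)
  also have "\<dots> < 2 ^ l + real l" using 1 m_card[OF GC(1), of l] cG by linarith
  also have "real l < 2 ^ l" using of_nat_less_two_power by blast
  finally have "real (N l) < 2 * 2 ^ l" by simp
  moreover have "real (4 ^ l) \<le> real (N l)" using N[of l] by (simp only: of_nat_le_iff)
  moreover have "(4::real) ^ l = 2 ^ l * 2 ^ l" by (simp add: power_mult_distrib[symmetric])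
  moreover have "(2::real) \<le> 2 ^ l" unfolding l_def by simp
  then have "2 * 2 ^ l \<le> (2::real) ^ l * 2 ^ l" by (intro mult_right_mono) auto
  ultimately show False by simp
qed

text \<open>The witness is a product of maxima of bump functions for the \<open>U i\<close>: it is 1
  at the given finite set and vanishes as soon as one \<open>U i\<close> is missed.\<close>

lemma R_open_in_hits:
  assumes cr: "completely_regular_space X" and U: "\<And>i. i \<in> I \<Longrightarrow> openin X (U i)" and I: "finite I"
  shows "R_open_in T {F \<in> fin_subsets (topspace X). \<forall>i\<in>I. F \<inter> U i \<noteq> {}}"
  unfolding R_open_in_def
proof (intro conjI ballI)
  show "{F \<in> fin_subsets (topspace X). \<forall>i\<in>I. F \<inter> U i \<noteq> {}} \<subseteq> topspace T" by (auto simp: topspace_T)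
  fix H assume "H \<in> {F \<in> fin_subsets (topspace X). \<forall>i\<in>I. F \<inter> U i \<noteq> {}}"
  then have H: "H \<in> fin_subsets (topspace X)" "\<And>i. i \<in> I \<Longrightarrow> H \<inter> U i \<noteq> {}" by auto
  have "\<exists>f :: 'a \<Rightarrow> real. continuous_map X (top_of_set {0..1}) f \<and> (\<exists>h\<in>H. f h = 1) \<and>
      f ` (topspace X - U i) \<subseteq> {0}" if i: "i \<in> I" for i
  proof -
    obtain h where h: "h \<in> H" "h \<in> U i" using H(2)[OF i] by blast
    have "R_open_in X (U i)" by (rule completely_regular_imp_R_open[OF cr U[OF i]])
    then show ?thesis using h unfolding R_open_in_def by blast
  qed
  then obtain f :: "_ \<Rightarrow> 'a \<Rightarrow> real" where f: "\<And>i. i \<in> I \<Longrightarrow> continuous_map X (top_of_set {0..1}) (f i) \<and>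
      (\<exists>h\<in>H. f i h = 1) \<and> f i ` (topspace X - U i) \<subseteq> {0}" by metis
  have fc: "continuous_map X euclideanreal (f i)" if "i \<in> I" for i
    using f[OF that] by (simp add: continuous_map_in_subtopology)
  have f01: "0 \<le> f i x" "f i x \<le> 1" if "i \<in> I" "x \<in> topspace X" for i x
    using funcset_mem[OF continuous_map_funspace[OF f[OF that(1), THEN conjunct1]], of x] that(2) by auto
  define g where "g F = (\<Prod>i\<in>I. Max (f i ` F))" for F
  have fin: "finite F" "F \<noteq> {}" "F \<subseteq> topspace X" if "F \<in> topspace T" for F
    using that by (auto simp: fin_subsets_def topspace_T)
  have M: "Max (f i ` F) \<in> f i ` F" if "F \<in> topspace T" for i F
    using fin[OF that] by (intro Max_in) auto
  have M01: "0 \<le> Max (f i ` F) \<and> Max (f i ` F) \<le> 1" if "F \<in> topspace T" "i \<in> I" for i F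
    using M[OF that(1), of i] f01[OF that(2)] fin(3)[OF that(1)] by auto
  have "continuous_map T euclideanreal g"
    unfolding g_def using I by (intro continuous_map_prod) (auto intro: continuous_Max_T fc)
  moreover have "0 \<le> g F \<and> g F \<le> 1" if "F \<in> topspace T" for F
    unfolding g_def using M01[OF that] by (auto intro: prod_nonneg prod_le_1)
  ultimately have "continuous_map T (top_of_set {0..1}) g"
    unfolding continuous_map_in_subtopology by auto
  moreover have "g H = 1"
  proof -
    have HT: "H \<in> topspace T" using H(1) topspace_T by simp
    have "Max (f i ` H) = 1" if i: "i \<in> I" for i
    proof -
      obtain h where "h \<in> H" "f i h = 1" using f[OF i] by blast
      then have "1 \<le> Max (f i ` H)" using fin(1)[OF HT] Max_ge[of "f i ` H" "f i h"] by simp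
      then show ?thesis using M01[OF HT i] by linarith
    qed
    then show ?thesis unfolding g_def by simp
  qed
  moreover have "g ` (topspace T - {F \<in> fin_subsets (topspace X). \<forall>i\<in>I. F \<inter> U i \<noteq> {}}) \<subseteq> {0}"
  proof (rule image_subsetI)
    fix F assume "F \<in> topspace T - {F \<in> fin_subsets (topspace X). \<forall>i\<in>I. F \<inter> U i \<noteq> {}}"
    then have F: "F \<in> topspace T" "F \<notin> {F \<in> fin_subsets (topspace X). \<forall>i\<in>I. F \<inter> U i \<noteq> {}}" by auto
    then obtain i where i: "i \<in> I" "F \<inter> U i = {}" using topspace_T by blast
    have "f i x = 0" if "x \<in> F" for x using f[OF i(1)] i(2) that fin(3)[OF F(1)] by blast
    then have "Max (f i ` F) = 0" using M[OF F(1), of i] by auto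
    then have "g F = 0" unfolding g_def using I i(1) by (intro prod_zero) auto
    then show "g F \<in> {0}" by simp
  qed
  ultimately show "\<exists>g :: 'a set \<Rightarrow> real. continuous_map T (top_of_set {0..1}) g \<and> g H = 1 \<and>
      g ` (topspace T - {F \<in> fin_subsets (topspace X). \<forall>i\<in>I. F \<inter> U i \<noteq> {}}) \<subseteq> {0}" by blast
qed

text \<open>Both parts of \<open>P n i\<close> serve compact-finiteness. For fixed \<open>n\<close>
  the sets \<open>U n i\<close> are locally finite in \<open>i\<close>; unboundedly many
  \<open>n\<close> would give a compact set whose elements hit \<open>4 ^ l\<close> members of a
  disjoint family for every \<open>l\<close>, against \<open>compactin_T_hits_bounded\<close>. The
  fan accumulates at \<open>{z}\<close> because the \<open>R n\<close> shrink to
  \<open>z\<close>.\<close>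

lemma strong_fan_T:
  assumes cr: "completely_regular_space X" and mu: "mu_complete_space X" and z: "z \<in> topspace X"
    and R: "\<And>n::nat. closedin X (R n)" "\<And>n. \<not> compactin X (R n)" "decseq R"
    and conv: "\<And>W. openin X W \<Longrightarrow> z \<in> W \<Longrightarrow> \<exists>n. R n \<subseteq> W"
  shows "\<exists>F. strong_Fin_omega_fan T F"
proof -
  let ?C = "fin_subsets (topspace X)"
  have "\<forall>n. \<exists>x U. (\<forall>i::nat. x i \<in> R n \<inter> U i) \<and> (\<forall>i. openin X (U i)) \<and> disjoint_family U \<and>
      locally_finite_seq X U"
  proof
    fix n
    show "\<exists>x U. (\<forall>i::nat. x i \<in> R n \<inter> U i) \<and> (\<forall>i. openin X (U i)) \<and> disjoint_family U \<and>
      locally_finite_seq X U"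
      by (rule noncompact_closed_locally_finite_seq[OF mu R(1,2)[of n]]) blast
  qed
  then obtain x U where xU: "\<And>n i. x n i \<in> R n \<inter> U n i" "\<And>n i. openin X (U n i)"
    "\<And>n. disjoint_family (U n)" "\<And>n. locally_finite_seq X (U n)"
    by metis
  have xX: "x n i \<in> topspace X" for n i using xU(1) closedin_subset[OF R(1)] by blast
  define P where "P n i = insert (x n i) (x i ` {..n})" for n i
  define V where "V n i = {F \<in> ?C. F \<inter> U n i \<noteq> {} \<and> (\<forall>j\<in>{..n}. F \<inter> U i j \<noteq> {})}" for n i
  \<comment> \<open>A fan is a sequence of finite subsets of the semilattice; each member here has
    the single element \<open>P n i\<close>, with the pair coded as a number.\<close>
  define F where "F p = {P (fst (prod_decode p)) (snd (prod_decode p))}" for p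
  define W where "W p = V (fst (prod_decode p)) (snd (prod_decode p))" for p
  have PV: "P n i \<in> V n i" for n i
    unfolding P_def V_def fin_subsets_def using xX xU(1) by auto
  have cfV: "finite {(n, i). V n i \<inter> C \<noteq> {}}" if C: "compactin T C" for C
  proof (rule ccontr)
    assume inf: "infinite {(n, i). V n i \<inter> C \<noteq> {}}"
    have cC: "compactin X (\<Union>C)" by (rule compactin_Union_T[OF C])
    have fin_i: "finite {i. V n i \<inter> C \<noteq> {}}" for n
    proof -
      have "{i. V n i \<inter> C \<noteq> {}} \<subseteq> {i. U n i \<inter> \<Union>C \<noteq> {}}" unfolding V_def by blast
      then show ?thesis using locally_finite_seq_compactin[OF xU(4) cC] finite_subset by blast
    qed
    \<comment> \<open>Each \<open>n\<close> occurs with finitely many \<open>i\<close>, so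
      infinitely many pairs have unbounded first coordinate; this permits a choice with
      \<open>n \<ge> 4 ^ l\<close> for every \<open>l\<close>.\<close>
    have "\<exists>n i. k \<le> n \<and> V n i \<inter> C \<noteq> {}" for k
    proof (rule ccontr)
      assume "\<nexists>n i. k \<le> n \<and> V n i \<inter> C \<noteq> {}"
      then have "{(n, i). V n i \<inter> C \<noteq> {}} \<subseteq> Sigma {..<k} (\<lambda>n. {i. V n i \<inter> C \<noteq> {}})"
        by (auto simp: not_le)
      moreover have "finite (Sigma {..<k} (\<lambda>n. {i. V n i \<inter> C \<noteq> {}}))" using fin_i by blast
      ultimately show False using inf finite_subset by blast
    qed
    then have "\<forall>l. \<exists>n i H. 4 ^ l \<le> n \<and> H \<in> V n i \<inter> C" by blast
    then obtain N i H where NH: "\<And>l. 4 ^ l \<le> N l" "\<And>l. H l \<in> V (N l) (i l) \<inter> C" by metis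
    show False
    proof (rule compactin_T_hits_bounded[OF cr C, where H = H and N = N and U = "\<lambda>l. U (i l)"])
      show "H l \<in> C" for l using NH(2) by blast
      show "openin X (U (i l) j) \<and> H l \<inter> U (i l) j \<noteq> {}" if "j < N l" for l j
        using NH(2)[of l] xU(2) that unfolding V_def by auto
      show "disjoint_family_on (U (i l)) {..<N l}" for l
        using xU(3)[of "i l"] unfolding disjoint_family_on_def by blast
    qed (rule NH(1))
  qed
  have cfW: "compact_finite_seq T W"
    unfolding compact_finite_seq_def
  proof (intro allI impI)
    fix C assume "compactin T C"
    from cfV[OF this] have "finite (prod_encode ` {(n, i). V n i \<inter> C \<noteq> {}})" by simp
    moreover have "{p. W p \<inter> C \<noteq> {}} \<subseteq> prod_encode ` {(n, i). V n i \<inter> C \<noteq> {}}"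
    proof
      fix p assume "p \<in> {p. W p \<inter> C \<noteq> {}}"
      then have "prod_decode p \<in> {(n, i). V n i \<inter> C \<noteq> {}}" unfolding W_def by (auto simp: case_prod_unfold)
      then have "prod_encode (prod_decode p) \<in> prod_encode ` {(n, i). V n i \<inter> C \<noteq> {}}" by (rule imageI)
      then show "p \<in> prod_encode ` {(n, i). V n i \<inter> C \<noteq> {}}" by simp
    qed
    ultimately show "finite {p. W p \<inter> C \<noteq> {}}" using finite_subset by blast
  qed
  have FW: "F p \<subseteq> W p" for p unfolding F_def W_def using PV by simp
  have "R_open_in T (W p)" for p
  proof -
    obtain n i where p: "prod_decode p = (n, i)" by fastforce
    \<comment> \<open>The condition for \<open>U n i\<close> takes index 0 and those for
      \<open>U i j\<close> are shifted by one, so that one finite index set covers both.\<close>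
    define A where "A k = (if k = 0 then U n i else U i (k - 1))" for k :: nat
    have "R_open_in T {F \<in> ?C. \<forall>k\<in>{..Suc n}. F \<inter> A k \<noteq> {}}"
      by (rule R_open_in_hits[OF cr]) (use xU(2) A_def in auto)
    moreover have "{F \<in> ?C. \<forall>k\<in>{..Suc n}. F \<inter> A k \<noteq> {}} = V n i"
      unfolding V_def A_def atMost_Suc_eq_insert_0 by auto
    ultimately show ?thesis unfolding W_def p by simp
  qed
  moreover have "\<not> locally_finite_seq T F"
  proof
    assume lf: "locally_finite_seq T F"
    have zC: "{z} \<in> ?C" by (rule fin_subsets_simps(1)[OF z])
    then obtain O' where O': "openin T O'" "{z} \<in> O'" "finite {p. F p \<inter> O' \<noteq> {}}"
      using lf topspace_T unfolding locally_finite_seq_def by metis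
    \<comment> \<open>Here \<open>{z}\<close> is split as \<open>{z} \<union> {z}\<close>:
      \<open>W1\<close> takes the points \<open>x n i\<close> for all \<open>n \<ge> n0\<close> at
      once, \<open>W2\<close> the at most \<open>n + 1\<close> points of \<open>R i\<close>, with
      \<open>i\<close> chosen depending on \<open>n\<close>.\<close>
    obtain W1 W2 where W12: "openin T W1" "openin T W2" "{z} \<in> W1" "{z} \<in> W2"
      "\<And>F' G'. F' \<in> W1 \<Longrightarrow> G' \<in> W2 \<Longrightarrow> F' \<union> G' \<in> O'"
      using union_nhds[OF O'(1) _ zC zC] O'(2) by auto
    have "openin X {y \<in> topspace X. {y} \<in> W1}"
      by (rule openin_continuous_map_preimage[OF continuous_singleton W12(1)])
    then obtain n0 where n0: "R n0 \<subseteq> {y \<in> topspace X. {y} \<in> W1}"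
      using conv[of "{y \<in> topspace X. {y} \<in> W1}"] z W12(3) by auto
    have "\<exists>i. P n i \<in> O'" if n: "n0 \<le> n" for n
    proof -
      obtain Q where Q: "openin X Q" "z \<in> Q"
        "\<And>F. F \<subseteq> Q \<Longrightarrow> F \<noteq> {} \<Longrightarrow> finite F \<Longrightarrow> card F \<le> Suc n \<Longrightarrow> F \<in> W2"
        using small_subsets_nhd[OF z W12(2,4), of n] by blast
      obtain i where i: "R i \<subseteq> Q" using conv[OF Q(1,2)] by blast
      have "x i ` {..n} \<in> W2"
      proof (rule Q(3))
        show "x i ` {..n} \<subseteq> Q" using xU(1)[of i] i by blast
        show "card (x i ` {..n}) \<le> Suc n" using card_image_le[of "{..n}" "x i"] by simp
      qed auto
      moreover have "{x n i} \<in> W1" using n0 xU(1)[of n i] decseqD[OF R(3) n] by blast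
      ultimately have "{x n i} \<union> x i ` {..n} \<in> O'" using W12(5) by blast
      then show ?thesis unfolding P_def by auto
    qed
    then obtain k where k: "\<And>n. n0 \<le> n \<Longrightarrow> P n (k n) \<in> O'" by metis
    \<comment> \<open>Different \<open>n\<close> have different codes whatever \<open>k n\<close>
      is, so infinitely many members of the fan meet \<open>O'\<close>.\<close>
    have "(\<lambda>n. prod_encode (n, k n)) ` {n0..} \<subseteq> {p. F p \<inter> O' \<noteq> {}}"
      using k unfolding F_def by auto
    then have "finite ((\<lambda>n. prod_encode (n, k n)) ` {n0..})" using O'(3) finite_subset by blast
    moreover have "inj_on (\<lambda>n. prod_encode (n, k n)) {n0..}" by (auto simp: inj_on_def)
    ultimately show False using finite_imageD infinite_Ici by blast
  qed
  moreover have "compact_finite_seq T F"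
    unfolding compact_finite_seq_def
  proof (intro allI impI)
    fix C assume "compactin T C"
    then have "finite {p. W p \<inter> C \<noteq> {}}" using cfW unfolding compact_finite_seq_def by blast
    moreover have "{p. F p \<inter> C \<noteq> {}} \<subseteq> {p. W p \<inter> C \<noteq> {}}" using FW by blast
    ultimately show "finite {p. F p \<inter> C \<noteq> {}}" using finite_subset by blast
  qed
  moreover have "finite (F p) \<and> F p \<subseteq> topspace T" for p
    using PV unfolding F_def V_def topspace_T by auto
  ultimately have "strong_Fin_omega_fan T F"
    unfolding strong_Fin_omega_fan_def Fin_omega_fan_def using FW cfW by blast
  then show ?thesis by blast
qed

end

section \<open>Compact-countable networks and the equivalences\<close>

text \<open>A finite intersection meets \<open>K\<close> only if all its members do, so
  compact-countability survives because a countable set has countably many finite subsets. Closure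
  under intersection makes the decreasing sets \<open>Q n\<close> of the next lemma finite unions of
  network members.\<close>

lemma aleph_bar_k_space_Int_closed:
  assumes "aleph_bar_k_space Y"
  obtains \<N> where "k_network_in Y \<N>" "compact_countable_in Y \<N>" "\<And>N. N \<in> \<N> \<Longrightarrow> closedin Y N"
    "\<And>A B. A \<in> \<N> \<Longrightarrow> B \<in> \<N> \<Longrightarrow> A \<inter> B \<in> \<N>"
proof -
  obtain \<M> where M: "k_network_in Y \<M>" "compact_countable_in Y \<M>" "\<And>N. N \<in> \<M> \<Longrightarrow> closedin Y N"
    using assms unfolding aleph_bar_k_space_def by blast
  define \<N> where "\<N> = Inter ` {\<G>. finite \<G> \<and> \<G> \<noteq> {} \<and> \<G> \<subseteq> \<M>}"
  have MN: "\<M> \<subseteq> \<N>"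
  proof
    fix A assume "A \<in> \<M>"
    then have "A = \<Inter>{A}" "{A} \<in> {\<G>. finite \<G> \<and> \<G> \<noteq> {} \<and> \<G> \<subseteq> \<M>}" by auto
    then show "A \<in> \<N>" unfolding \<N>_def by (rule image_eqI)
  qed
  have cl: "closedin Y N" if "N \<in> \<N>" for N
    using that M(3) unfolding \<N>_def by (auto intro!: closedin_Inter)
  have "k_network_in Y \<N>"
    unfolding k_network_in_def
  proof (intro conjI allI impI ballI)
    show "N \<subseteq> topspace Y" if "N \<in> \<N>" for N using cl[OF that] closedin_subset by blast
    fix U K assume "openin Y U \<and> compactin Y K \<and> K \<subseteq> U"
    then obtain \<F> where "finite \<F>" "\<F> \<subseteq> \<M>" "K \<subseteq> \<Union>\<F>" "\<Union>\<F> \<subseteq> U"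
      using M(1) unfolding k_network_in_def by meson
    then show "\<exists>\<F>. finite \<F> \<and> \<F> \<subseteq> \<N> \<and> K \<subseteq> \<Union>\<F> \<and> \<Union>\<F> \<subseteq> U"
      using MN by (intro exI[of _ \<F>]) auto
  qed
  moreover have "compact_countable_in Y \<N>"
    unfolding compact_countable_in_def
  proof (intro allI impI)
    fix K assume "compactin Y K"
    then have c: "countable {N \<in> \<M>. N \<inter> K \<noteq> {}}" using M(2) unfolding compact_countable_in_def by blast
    have "{N \<in> \<N>. N \<inter> K \<noteq> {}} \<subseteq> Inter ` {\<G>. finite \<G> \<and> \<G> \<subseteq> {N \<in> \<M>. N \<inter> K \<noteq> {}}}"
    proof
      fix N assume "N \<in> {N \<in> \<N>. N \<inter> K \<noteq> {}}"
      then obtain \<G> where G: "finite \<G>" "\<G> \<subseteq> \<M>" "N = \<Inter>\<G>" "\<Inter>\<G> \<inter> K \<noteq> {}"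
        unfolding \<N>_def by blast
      then have "\<G> \<subseteq> {N \<in> \<M>. N \<inter> K \<noteq> {}}" by blast
      then show "N \<in> Inter ` {\<G>. finite \<G> \<and> \<G> \<subseteq> {N \<in> \<M>. N \<inter> K \<noteq> {}}}" using G by blast
    qed
    moreover have "countable (Inter ` {\<G>. finite \<G> \<and> \<G> \<subseteq> {N \<in> \<M>. N \<inter> K \<noteq> {}}})"
      using c by (intro countable_image) (rule countable_Collect_finite_subset)
    ultimately show "countable {N \<in> \<N>. N \<inter> K \<noteq> {}}" using countable_subset by blast
  qed
  moreover have "A \<inter> B \<in> \<N>" if AB: "A \<in> \<N>" "B \<in> \<N>" for A B
  proof -
    obtain \<G> \<H> where "finite \<G>" "\<G> \<noteq> {}" "\<G> \<subseteq> \<M>" "A = \<Inter>\<G>" "finite \<H>" "\<H> \<noteq> {}" "\<H> \<subseteq> \<M>" "B = \<Inter>\<H>"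
      using AB unfolding \<N>_def by blast
    then have "A \<inter> B = \<Inter>(\<G> \<union> \<H>)" "\<G> \<union> \<H> \<in> {\<G>. finite \<G> \<and> \<G> \<noteq> {} \<and> \<G> \<subseteq> \<M>}" by auto
    then show ?thesis unfolding \<N>_def by (rule image_eqI)
  qed
  ultimately show thesis using cl by (intro that)
qed

text \<open>Only countably many members of \<open>\<N>\<close> meet \<open>K\<close>; the finite intersections \<open>Q n\<close> of their finite unions
  covering \<open>K\<close> shrink to \<open>K\<close> without being neighbourhoods of \<open>K\<close>. As no \<open>Q n\<close> is compact, the failure
  of compactness localises at some \<open>z \<in> K\<close>.\<close>

lemma k_network_noncompact_convergence:
  assumes reg: "regular_space Y" and t1: "t1_space Y"
    and \<N>: "k_network_in Y \<N>" "compact_countable_in Y \<N>" "\<And>N. N \<in> \<N> \<Longrightarrow> closedin Y N"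
      "\<And>A B. A \<in> \<N> \<Longrightarrow> B \<in> \<N> \<Longrightarrow> A \<inter> B \<in> \<N>"
    and K: "compactin Y K" and U: "openin Y U" "K \<subseteq> U"
    and none: "\<And>\<F>. finite \<F> \<Longrightarrow> \<F> \<subseteq> {N \<in> \<N>. compactin Y N} \<Longrightarrow> K \<subseteq> \<Union>\<F> \<Longrightarrow> \<not> \<Union>\<F> \<subseteq> U"
  obtains z and R :: "nat \<Rightarrow> 'a set" where "z \<in> topspace Y" "\<And>n. closedin Y (R n)"
    "\<And>n. \<not> compactin Y (R n)" "decseq R"
    "\<And>W. openin Y W \<Longrightarrow> z \<in> W \<Longrightarrow> \<exists>n. R n \<subseteq> W"
proof -
  have KY: "K \<subseteq> topspace Y" using K compactin_subset_topspace by blast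
  define \<A> where "\<A> = {N \<in> \<N>. N \<inter> K \<noteq> {}}"
  have cA: "countable \<A>" using \<N>(2) K unfolding compact_countable_in_def \<A>_def by blast
  define \<FF> where "\<FF> = {\<F>. (finite \<F> \<and> \<F> \<subseteq> \<A>) \<and> K \<subseteq> \<Union>\<F> \<and> \<Union>\<F> \<subseteq> U}"
  have "countable {\<F>. finite \<F> \<and> \<F> \<subseteq> \<A>}" using cA by (rule countable_Collect_finite_subset)
  then have cF: "countable \<FF>" by (rule countable_subset[rotated]) (auto simp: \<FF>_def)
  have exF: "\<exists>\<F>\<in>\<FF>. \<Union>\<F> \<subseteq> W" if W: "openin Y W" "K \<subseteq> W" for W
  proof -
    have "openin Y (W \<inter> U)" "K \<subseteq> W \<inter> U" using W U by auto
    then obtain \<F> where F: "finite \<F>" "\<F> \<subseteq> \<N>" "K \<subseteq> \<Union>\<F>" "\<Union>\<F> \<subseteq> W \<inter> U"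
      using \<N>(1) K unfolding k_network_in_def by meson
    \<comment> \<open>Members that miss \<open>K\<close> are dropped; this keeps the subfamilies
      inside the countable family \<open>\<A>\<close>.\<close>
    have "K \<subseteq> \<Union>{N \<in> \<F>. N \<inter> K \<noteq> {}}" using F(3) by blast
    then have "{N \<in> \<F>. N \<inter> K \<noteq> {}} \<in> \<FF>" using F unfolding \<FF>_def \<A>_def by auto
    moreover have "\<Union>{N \<in> \<F>. N \<inter> K \<noteq> {}} \<subseteq> W" using F(4) by blast
    ultimately show ?thesis by blast
  qed
  then have neF: "\<FF> \<noteq> {}" using U by blast
  define e where "e = from_nat_into \<FF>"
  have e: "range e = \<FF>" unfolding e_def using cF neF by (simp add: range_from_nat_into)
  then have eF: "e n \<in> \<FF>" for n by blast
  define Q where "Q n = (\<Inter>k\<le>n. \<Union>(e k))" for n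
  \<comment> \<open>This form of \<open>Q n\<close> is what excludes compactness: the closed members
    of \<open>\<Q>\<close> would be compact too, and \<open>\<Q>\<close> would contradict
    \<open>none\<close>.\<close>
  have Qfin: "\<exists>\<Q>. finite \<Q> \<and> \<Q> \<subseteq> \<N> \<and> \<Union>\<Q> = Q n" for n
  proof (induction n)
    case 0
    have "finite (e 0) \<and> e 0 \<subseteq> \<N> \<and> \<Union>(e 0) = Q 0"
      using eF[of 0] unfolding \<FF>_def \<A>_def Q_def by auto
    then show ?case by (rule exI)
  next
    case (Suc n)
    then obtain \<Q> where Q: "finite \<Q>" "\<Q> \<subseteq> \<N>" "\<Union>\<Q> = Q n" by auto
    have E: "finite (e (Suc n))" "e (Suc n) \<subseteq> \<N>" using eF[of "Suc n"] unfolding \<FF>_def \<A>_def by auto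
    have "Q (Suc n) = Q n \<inter> \<Union>(e (Suc n))" unfolding Q_def by (auto simp: atMost_Suc)
    then have "\<Union>((\<lambda>(A, B). A \<inter> B) ` (\<Q> \<times> e (Suc n))) = Q (Suc n)"
      unfolding Q(3)[symmetric] by auto
    moreover have "(\<lambda>(A, B). A \<inter> B) ` (\<Q> \<times> e (Suc n)) \<subseteq> \<N>" using Q(2) E(2) \<N>(4) by auto
    ultimately show ?case using Q(1) E(1) by (intro exI[of _ "(\<lambda>(A, B). A \<inter> B) ` (\<Q> \<times> e (Suc n))"]) simp
  qed
  have Qdec: "Q n \<subseteq> Q m" if "m \<le> n" for m n unfolding Q_def using that by (intro INF_superset_mono) auto
  have KQ: "K \<subseteq> Q n" and QU: "Q n \<subseteq> U" for n
  proof -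
    have *: "K \<subseteq> \<Union>(e k)" "\<Union>(e k) \<subseteq> U" for k using eF[of k] unfolding \<FF>_def by simp_all
    show "K \<subseteq> Q n" unfolding Q_def by (rule INT_greatest) (rule *(1))
    have "Q n \<subseteq> \<Union>(e 0)" unfolding Q_def by (rule INT_lower) simp
    then show "Q n \<subseteq> U" using *(2)[of 0] by (rule order_trans)
  qed
  have Qcl: "closedin Y (Q n)" for n
  proof -
    obtain \<Q> where Q: "finite \<Q>" "\<Q> \<subseteq> \<N>" "\<Union>\<Q> = Q n" using Qfin[of n] by meson
    show ?thesis unfolding Q(3)[symmetric] by (rule closedin_Union) (use Q \<N>(3) in auto)
  qed
  have Qnc: "\<not> compactin Y (Q n)" for n
  proof
    assume c: "compactin Y (Q n)"
    obtain \<Q> where Q: "finite \<Q>" "\<Q> \<subseteq> \<N>" "\<Union>\<Q> = Q n" using Qfin[of n] by meson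
    have "\<Q> \<subseteq> {N \<in> \<N>. compactin Y N}"
    proof
      fix N assume N: "N \<in> \<Q>"
      then have "N \<subseteq> Q n" "closedin Y N" using Q \<N>(3) by auto
      then have "compactin Y N" using closed_compactin[OF c] by blast
      then show "N \<in> {N \<in> \<N>. compactin Y N}" using N Q(2) by blast
    qed
    then show False using none[OF Q(1)] KQ[of n] QU[of n] Q(3) by simp
  qed
  have Qconv: "\<exists>n. Q n \<subseteq> W" if W: "openin Y W" "K \<subseteq> W" for W
  proof -
    obtain \<F> where F: "\<F> \<in> \<FF>" "\<Union>\<F> \<subseteq> W" using exF[OF W] by (rule bexE)
    obtain n where n: "\<F> = e n" using F(1) unfolding e[symmetric] by (rule rangeE)
    have "Q n \<subseteq> \<Union>(e n)" unfolding Q_def by (rule INT_lower) simp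
    then show ?thesis using F(2) n by (intro exI[of _ n]) simp
  qed
  \<comment> \<open>Otherwise finitely many neighbourhoods cover \<open>K\<close> and hence a late
    \<open>Q n\<close>; that \<open>Q n\<close> is then a finite union of compact sets.\<close>
  have "\<exists>z\<in>K. \<forall>W n. openin Y W \<and> z \<in> W \<longrightarrow> \<not> compactin Y (Y closure_of W \<inter> Q n)"
  proof (rule ccontr)
    assume "\<not> ?thesis"
    then have "\<forall>z\<in>K. \<exists>W n. openin Y W \<and> z \<in> W \<and> compactin Y (Y closure_of W \<inter> Q n)" by blast
    then obtain W where "\<forall>z\<in>K. \<exists>n. openin Y (W z) \<and> z \<in> W z \<and> compactin Y (Y closure_of (W z) \<inter> Q n)"
      by (rule bchoice[THEN exE])
    then obtain k where "\<forall>z\<in>K. openin Y (W z) \<and> z \<in> W z \<and> compactin Y (Y closure_of (W z) \<inter> Q (k z))"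
      by (rule bchoice[THEN exE])
    then have Wk: "openin Y (W z)" "z \<in> W z" "compactin Y (Y closure_of (W z) \<inter> Q (k z))" if "z \<in> K" for z
      using that by auto
    have "(\<forall>B\<in>W ` K. openin Y B) \<and> K \<subseteq> \<Union>(W ` K)" using Wk(1,2) by blast
    then obtain \<G> where "finite \<G>" "\<G> \<subseteq> W ` K" "K \<subseteq> \<Union>\<G>" using K unfolding compactin_def by meson
    then obtain D where D: "finite D" "D \<subseteq> K" "K \<subseteq> \<Union>(W ` D)" by (metis finite_subset_image)
    have "openin Y (\<Union>(W ` D))" by (rule openin_Union) (use Wk(1) D(2) in auto)
    then obtain n0 where n0: "Q n0 \<subseteq> \<Union>(W ` D)" using Qconv D(3) by blast
    define n where "n = n0 + (\<Sum>z\<in>D. k z)"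
    have "k z \<le> n" if "z \<in> D" for z
      using member_le_sum[OF that, of k] D(1) unfolding n_def by simp
    then have Qk: "Q n \<subseteq> Q (k z)" if "z \<in> D" for z using Qdec that by blast
    have "Q n \<subseteq> Q n0" by (rule Qdec) (simp add: n_def)
    then have QnW: "Q n \<subseteq> \<Union>(W ` D)" using n0 by (rule order_trans)
    have "Q n \<subseteq> (\<Union>z\<in>D. Y closure_of (W z) \<inter> Q n)"
    proof
      fix y assume y: "y \<in> Q n"
      then have "y \<in> \<Union>(W ` D)" using QnW by (rule subsetD[rotated])
      then obtain z where z: "z \<in> D" "y \<in> W z" by (rule UN_E)
      have "z \<in> K" using D(2) z(1) by (rule subsetD)
      from closure_of_subset[OF openin_subset[OF Wk(1)[OF this]]]
      have "y \<in> Y closure_of (W z)" using z(2) by (rule subsetD)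
      then show "y \<in> (\<Union>z\<in>D. Y closure_of (W z) \<inter> Q n)" using y z(1) by (intro UN_I[of z] IntI)
    qed
    then have "Q n = (\<Union>z\<in>D. Y closure_of (W z) \<inter> Q n)" by blast
    moreover have "compactin Y (\<Union>z\<in>D. Y closure_of (W z) \<inter> Q n)"
    proof (rule compactin_Union)
      fix B assume "B \<in> (\<lambda>z. Y closure_of (W z) \<inter> Q n) ` D"
      then obtain z where z: "z \<in> D" "B = Y closure_of (W z) \<inter> Q n" by blast
      have zK: "z \<in> K" using z(1) D(2) by blast
      have "B \<subseteq> Y closure_of (W z) \<inter> Q (k z)" using z Qk by blast
      moreover have "closedin Y B" unfolding z(2) by (intro closedin_Int closedin_closure_of Qcl)
      ultimately show "compactin Y B" by (rule closed_compactin[OF Wk(3)[OF zK]])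
    qed (use D(1) in simp)
    ultimately show False using Qnc by metis
  qed
  then obtain z where z: "z \<in> K"
    and znc: "\<And>W n. openin Y W \<Longrightarrow> z \<in> W \<Longrightarrow> \<not> compactin Y (Y closure_of W \<inter> Q n)" by metis
  have zY: "z \<in> topspace Y" using z KY by blast
  \<comment> \<open>Each point of \<open>K\<close> other than \<open>z\<close> lies in a network
    member avoiding \<open>z\<close>, so these countably many closed sets cover
    \<open>K - {z}\<close>. Separating them from \<open>z\<close> one after another makes the
    closures of \<open>W n\<close> shrink to \<open>z\<close> within \<open>K\<close>. The empty set
    is adjoined for the enumeration.\<close>
  define \<A>z where "\<A>z = insert {} {N \<in> \<A>. z \<notin> N}"
  have "countable \<A>z" unfolding \<A>z_def using cA by simp
  moreover have "\<A>z \<noteq> {}" unfolding \<A>z_def by blast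
  ultimately obtain M :: "nat \<Rightarrow> 'a set" where M: "range M = \<A>z"
    using range_from_nat_into by metis
  have "\<exists>V. openin Y V \<and> z \<in> V \<and> Y closure_of V \<inter> M n = {}" for n
  proof -
    have "M n \<in> \<A>z" using M by blast
    then have "closedin Y (M n)" "z \<in> topspace Y - M n"
      using \<N>(3) zY unfolding \<A>z_def \<A>_def by auto
    then show ?thesis using reg unfolding regular_space disjnt_def by (metis inf_commute)
  qed
  then obtain V where V: "\<And>n. openin Y (V n)" "\<And>n. z \<in> V n" "\<And>n. Y closure_of (V n) \<inter> M n = {}"
    by metis
  define W where "W n = (\<Inter>k\<le>n. V k)" for n
  have W: "openin Y (W n)" "z \<in> W n" for n unfolding W_def using V by auto
  have Wdec: "Y closure_of (W n) \<subseteq> Y closure_of (W m)" if "m \<le> n" for m n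
    unfolding W_def using that by (intro closure_of_mono INF_superset_mono) auto
  have WV: "Y closure_of (W n) \<subseteq> Y closure_of (V n)" for n
    unfolding W_def by (intro closure_of_mono) auto
  define R where "R n = Y closure_of (W n) \<inter> Q n" for n
  have Rdec: "R n \<subseteq> R m" if "m \<le> n" for m n
    unfolding R_def using Wdec[OF that] Qdec[OF that] by blast
  have "\<exists>n. R n \<subseteq> G" if G: "openin Y G" "z \<in> G" for G
  proof -
    have "K - G \<subseteq> (\<Union>m. topspace Y - Y closure_of (W m))"
    proof
      fix y assume y: "y \<in> K - G"
      then have "y \<noteq> z" using G by blast
      have "openin Y (topspace Y - {z})" using t1 zY by (simp add: t1_space_openin_delete)
      moreover have "compactin Y {y}" "{y} \<subseteq> topspace Y - {z}" using y KY \<open>y \<noteq> z\<close> by auto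
      ultimately obtain \<F> where F: "\<F> \<subseteq> \<N>" "{y} \<subseteq> \<Union>\<F>" "\<Union>\<F> \<subseteq> topspace Y - {z}"
        using \<N>(1) unfolding k_network_in_def by meson
      then obtain N where N: "N \<in> \<N>" "y \<in> N" "z \<notin> N" by blast
      then have "N \<in> \<A>z" using y unfolding \<A>z_def \<A>_def by blast
      then obtain m where m: "N = M m" using M by blast
      then have "y \<notin> Y closure_of (W m)" using V(3)[of m] WV[of m] N(2) by blast
      then show "y \<in> (\<Union>m. topspace Y - Y closure_of (W m))" using y KY by blast
    qed
    moreover have "compactin Y (K - G)"
    proof -
      have "compactin Y (K \<inter> (topspace Y - G))"
        by (rule compact_Int_closedin[OF K]) (use G(1) in blast)
      moreover have "K \<inter> (topspace Y - G) = K - G" using KY by blast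
      ultimately show ?thesis by simp
    qed
    moreover have "\<forall>B\<in>range (\<lambda>m. topspace Y - Y closure_of (W m)). openin Y B"
      by (auto intro: openin_diff)
    ultimately obtain \<G> where "finite \<G>" "\<G> \<subseteq> range (\<lambda>m. topspace Y - Y closure_of (W m))" "K - G \<subseteq> \<Union>\<G>"
      unfolding compactin_def by meson
    then obtain D where D: "finite D" "K - G \<subseteq> (\<Union>m\<in>D. topspace Y - Y closure_of (W m))"
      by (metis finite_subset_image)
    define m where "m = Max (insert 0 D)"
    have "topspace Y - Y closure_of (W i) \<subseteq> topspace Y - Y closure_of (W m)" if "i \<in> D" for i
    proof -
      have "i \<le> m" unfolding m_def using that D(1) by simp
      then show ?thesis using Wdec by blast
    qed
    then have KG: "K \<subseteq> G \<union> (topspace Y - Y closure_of (W m))" using D(2) by blast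
    have "openin Y (G \<union> (topspace Y - Y closure_of (W m)))"
      using G(1) by (intro openin_Un openin_diff) auto
    then obtain n where n: "Q n \<subseteq> G \<union> (topspace Y - Y closure_of (W m))" using Qconv[OF _ KG] by blast
    have "R (m + n) \<subseteq> Y closure_of (W m) \<inter> Q n"
      unfolding R_def using Wdec[of m "m+n"] Qdec[of n "m+n"] by auto
    then show ?thesis using n by blast
  qed
  moreover have "closedin Y (R n)" for n unfolding R_def by (intro closedin_Int closedin_closure_of Qcl)
  moreover have "\<not> compactin Y (R n)" for n unfolding R_def by (rule znc[OF W])
  moreover have "decseq R" unfolding decseq_def using Rdec by blast
  ultimately show thesis using zY by (intro that)
qed

section \<open>Chain components of a compact-countable family of compact sets\<close>

lemma countable_rtrancl_Image:
  assumes "\<And>x. countable (r `` {x})"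
  shows "countable (r\<^sup>* `` {x})"
proof -
  have "countable ((r ^^ n) `` {x})" for n
  proof (induction n)
    case (Suc n)
    have "(r ^^ Suc n) `` {x} = (\<Union>y\<in>(r ^^ n) `` {x}. r `` {y})" by auto
    then show ?case using Suc assms by simp
  qed simp
  moreover have "r\<^sup>* `` {x} = (\<Union>n. (r ^^ n) `` {x})" unfolding rtrancl_is_UN_relpow by blast
  ultimately show ?thesis by simp
qed

text \<open>A compact set is covered by finitely many network members, each of which belongs to a
  given component or is disjoint from its union. A function continuous on the members of a component
  may therefore be continued by 0 and stays continuous on compact sets, hence on \<open>X\<close>.
  The constant 1 shows that the component is open, and separating functions give the k_omega
  property.\<close>

lemma cosmic_k_omega_partition_compact_k_network:
  assumes reg: "regular_T1_space X" and kR: "k_R_space X"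
    and \<N>: "compact_countable_in X \<N>" "\<And>N. N \<in> \<N> \<Longrightarrow> compactin X N"
    and net: "k_network_in X \<N>"
  shows "\<exists>\<U>. cosmic_k_omega_partition X \<U>"
proof -
  have H: "Hausdorff_space X" using reg regular_t1_imp_Hausdorff_space unfolding regular_T1_space_def by blast
  define \<C> where "\<C> = \<N> - {{}}"
  have comp: "compactin X N" if "N \<in> \<C>" for N using that \<N>(2) unfolding \<C>_def by blast
  have clos: "closedin X N" if "N \<in> \<C>" for N by (rule compactin_imp_closedin[OF H comp[OF that]])
  have ne: "N \<noteq> {}" if "N \<in> \<C>" for N using that unfolding \<C>_def by blast
  have netC: "\<exists>\<F>. finite \<F> \<and> \<F> \<subseteq> \<C> \<and> K \<subseteq> \<Union>\<F> \<and> \<Union>\<F> \<subseteq> U"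
    if KU: "compactin X K" "openin X U" "K \<subseteq> U" for K U
  proof -
    obtain \<F> where "finite \<F>" "\<F> \<subseteq> \<N>" "K \<subseteq> \<Union>\<F>" "\<Union>\<F> \<subseteq> U"
      using net KU unfolding k_network_in_def by meson
    then show ?thesis unfolding \<C>_def by (intro exI[of _ "\<F> - {{}}"]) auto
  qed
  define r where "r = {(A, B). A \<in> \<C> \<and> B \<in> \<C> \<and> A \<inter> B \<noteq> {}}"
  have "countable (r `` {A})" for A
  proof (cases "A \<in> \<C>")
    case True
    have "r `` {A} \<subseteq> {N \<in> \<N>. N \<inter> A \<noteq> {}}" unfolding r_def \<C>_def by blast
    moreover have "countable {N \<in> \<N>. N \<inter> A \<noteq> {}}"
      using \<N>(1) comp[OF True] unfolding compact_countable_in_def by blast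
    ultimately show ?thesis by (rule countable_subset)
  next
    case False
    then have "r `` {A} = {}" unfolding r_def by blast
    then show ?thesis by simp
  qed
  then have cnt: "countable (r\<^sup>* `` {A})" for A by (rule countable_rtrancl_Image)
  have "sym r" unfolding r_def sym_def by blast
  then have symr: "sym (r\<^sup>*)" by (rule sym_rtrancl)
  have clsC: "r\<^sup>* `` {A} \<subseteq> \<C>" if "A \<in> \<C>" for A
  proof
    fix B assume "B \<in> r\<^sup>* `` {A}"
    then have "(A, B) \<in> r\<^sup>*" by blast
    then show "B \<in> \<C>" using that by (induction rule: rtrancl_induct) (auto simp: r_def)
  qed
  define P where "P A = \<Union>(r\<^sup>* `` {A})" for A
  have AP: "A \<subseteq> P A" for A unfolding P_def by blast
  have meet: "B \<in> r\<^sup>* `` {A}" if AB: "A \<in> \<C>" "B \<in> \<C>" "B \<inter> P A \<noteq> {}" for A B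
  proof -
    obtain A' where A': "(A, A') \<in> r\<^sup>*" "B \<inter> A' \<noteq> {}" using AB(3) unfolding P_def by blast
    then have "A' \<in> \<C>" using clsC[OF AB(1)] by blast
    then have "(A', B) \<in> r" using A'(2) AB(2) unfolding r_def by blast
    then show ?thesis using A'(1) by (meson ImageI rtrancl.rtrancl_into_rtrancl singletonI)
  qed
  have PX: "P A \<subseteq> topspace X" if "A \<in> \<C>" for A
    unfolding P_def using clsC[OF that] comp compactin_subset_topspace by blast
  have split: "closedin X (C \<inter> P A) \<and> closedin X (C - P A) \<and> (\<exists>\<F>. finite \<F> \<and> \<F> \<subseteq> r\<^sup>* `` {A} \<and> C \<inter> P A \<subseteq> \<Union>\<F>)"
    if A: "A \<in> \<C>" and C: "compactin X C" for A C
  proof -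
    obtain \<F> where F: "finite \<F>" "\<F> \<subseteq> \<C>" "C \<subseteq> \<Union>\<F>"
      using netC[OF C openin_topspace compactin_subset_topspace[OF C]] by meson
    define \<F>1 where "\<F>1 = \<F> \<inter> r\<^sup>* `` {A}"
    define \<F>2 where "\<F>2 = \<F> - r\<^sup>* `` {A}"
    have 1: "\<Union>\<F>1 \<subseteq> P A" unfolding \<F>1_def P_def by blast
    have 2: "\<Union>\<F>2 \<inter> P A = {}" unfolding \<F>2_def using meet[OF A] F(2) by blast
    have U: "\<Union>\<F> = \<Union>\<F>1 \<union> \<Union>\<F>2" unfolding \<F>1_def \<F>2_def by blast
    have e1: "C \<inter> P A = C \<inter> \<Union>\<F>1" and e2: "C - P A = C \<inter> \<Union>\<F>2" using F(3) 1 2 U by blast+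
    have cC: "closedin X C" by (rule compactin_imp_closedin[OF H C])
    have "closedin X (\<Union>\<F>1)" by (rule closedin_Union) (use F clos in \<open>auto simp: \<F>1_def\<close>)
    moreover have "closedin X (\<Union>\<F>2)" by (rule closedin_Union) (use F clos in \<open>auto simp: \<F>2_def\<close>)
    ultimately have "closedin X (C \<inter> P A)" "closedin X (C - P A)" unfolding e1 e2 using cC by auto
    moreover have "finite \<F>1" "\<F>1 \<subseteq> r\<^sup>* `` {A}" "C \<inter> P A \<subseteq> \<Union>\<F>1"
      using F(1) e1 unfolding \<F>1_def by auto
    ultimately show ?thesis by blast
  qed
  have glue: "continuous_map X euclideanreal (\<lambda>y. if y \<in> P A then f y else 0)"
    if A: "A \<in> \<C>" and f: "\<And>N. N \<in> r\<^sup>* `` {A} \<Longrightarrow> continuous_map (subtopology X N) euclideanreal f"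
    for A and f :: "'a \<Rightarrow> real"
  proof -
    define g where "g = (\<lambda>y. if y \<in> P A then f y else 0)"
    have "continuous_map (subtopology X C) euclideanreal g" if C: "compactin X C" for C
    proof -
      obtain \<F> where F: "finite \<F>" "\<F> \<subseteq> r\<^sup>* `` {A}" "C \<inter> P A \<subseteq> \<Union>\<F>"
        using split[OF A C] by blast
      have cC: "closedin X C" by (rule compactin_imp_closedin[OF H C])
      \<comment> \<open>The index \<open>None\<close> stands for the part of \<open>C\<close>
        outside the component, \<open>Some N\<close> for the trace of a network member.\<close>
      show ?thesis
      proof (rule pasting_lemma_closed[where I = "insert None (Some ` \<F>)" and
            T = "\<lambda>i. case i of None \<Rightarrow> C - P A | Some N \<Rightarrow> C \<inter> N" and
            f = "\<lambda>i. case i of None \<Rightarrow> (\<lambda>_. 0) | Some N \<Rightarrow> f"])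
        show "finite (insert None (Some ` \<F>))" using F(1) by simp
      next
        fix i assume i: "i \<in> insert None (Some ` \<F>)"
        have clN: "closedin X (C \<inter> N)" if "N \<in> \<F>" for N
          using clos clsC[OF A] F(2) that cC by blast
        have "closedin X (case i of None \<Rightarrow> C - P A | Some N \<Rightarrow> C \<inter> N)"
          using i split[OF A C] clN by (cases i) auto
        then show "closedin (subtopology X C) (case i of None \<Rightarrow> C - P A | Some N \<Rightarrow> C \<inter> N)"
          unfolding closedin_closed_subtopology[OF cC] by (auto split: option.splits)
        show "continuous_map (subtopology (subtopology X C) (case i of None \<Rightarrow> C - P A | Some N \<Rightarrow> C \<inter> N))
            euclideanreal (case i of None \<Rightarrow> (\<lambda>_. 0) | Some N \<Rightarrow> f)"
        proof (cases i)
          case (Some N)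
          then have "N \<in> r\<^sup>* `` {A}" using i F(2) by auto
          from f[OF this] show ?thesis unfolding Some option.case
            by (simp add: subtopology_subtopology) (rule continuous_map_from_subtopology_mono, auto)
        qed simp
      next
        fix i j x assume "i \<in> insert None (Some ` \<F>)" "j \<in> insert None (Some ` \<F>)"
          "x \<in> topspace (subtopology X C) \<inter> (case i of None \<Rightarrow> C - P A | Some N \<Rightarrow> C \<inter> N) \<inter>
            (case j of None \<Rightarrow> C - P A | Some N \<Rightarrow> C \<inter> N)"
        moreover have "N \<subseteq> P A" if "N \<in> \<F>" for N using F(2) that unfolding P_def by blast
        ultimately show "(case i of None \<Rightarrow> (\<lambda>_. 0) | Some N \<Rightarrow> f) x = (case j of None \<Rightarrow> (\<lambda>_. 0) | Some N \<Rightarrow> f) x"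
          by (auto split: option.splits)
      next
        fix x assume "x \<in> topspace (subtopology X C)"
        then have x: "x \<in> C" by simp
        show "\<exists>j. j \<in> insert None (Some ` \<F>) \<and> x \<in> (case j of None \<Rightarrow> C - P A | Some N \<Rightarrow> C \<inter> N) \<and>
            g x = (case j of None \<Rightarrow> (\<lambda>_. 0) | Some N \<Rightarrow> f) x"
        proof (cases "x \<in> P A")
          case True
          then obtain N where "N \<in> \<F>" "x \<in> N" using x F(3) by blast
          then show ?thesis using x True by (intro exI[of _ "Some N"]) (simp add: g_def)
        next
          case False
          then show ?thesis using x by (intro exI[of _ None]) (simp add: g_def)
        qed
      qed
    qed
    then show ?thesis using kR unfolding k_R_space_def g_def by blast
  qed
  have oP: "openin X (P A)" if A: "A \<in> \<C>" for A
  proof -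
    have "continuous_map X euclideanreal (\<lambda>y. if y \<in> P A then 1 else 0)" by (rule glue[OF A]) simp
    then have "openin X {y \<in> topspace X. (if y \<in> P A then 1 else 0) > (1/2 :: real)}"
      unfolding continuous_map_upper_lower_semicontinuous_lt by blast
    moreover have "{y \<in> topspace X. (if y \<in> P A then 1 else 0) > (1/2 :: real)} = P A"
      using PX[OF A] by (auto split: if_splits)
    ultimately show ?thesis by simp
  qed
  have "cosmic_k_omega_partition X (P ` \<C>)"
    unfolding cosmic_k_omega_partition_def
  proof (intro conjI ballI)
    show "disjoint (P ` \<C>)"
    proof (rule disjointI)
      fix U V assume UV: "U \<in> P ` \<C>" "V \<in> P ` \<C>" "U \<noteq> V"
      then obtain A B where AB: "A \<in> \<C>" "B \<in> \<C>" "U = P A" "V = P B" by blast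
      show "U \<inter> V = {}"
      proof (rule ccontr)
        assume "U \<inter> V \<noteq> {}"
        then obtain B' where B': "(B, B') \<in> r\<^sup>*" "B' \<inter> P A \<noteq> {}"
          unfolding AB(3,4) P_def[of B] by blast
        then have "B' \<in> \<C>" using clsC[OF AB(2)] by blast
        then have "(A, B') \<in> r\<^sup>*" using meet[OF AB(1) _ B'(2)] by blast
        then have "(A, B) \<in> r\<^sup>*" "(B, A) \<in> r\<^sup>*"
          using B'(1) symr unfolding sym_def by (meson rtrancl_trans)+
        then have "r\<^sup>* `` {A} = r\<^sup>* `` {B}" by (auto intro: rtrancl_trans)
        then show False using UV(3) AB unfolding P_def by simp
      qed
    qed
    show "\<Union>(P ` \<C>) = topspace X"
    proof
      show "\<Union>(P ` \<C>) \<subseteq> topspace X" using PX by blast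
      show "topspace X \<subseteq> \<Union>(P ` \<C>)"
      proof
        fix x assume x: "x \<in> topspace X"
        then have "compactin X {x}" "{x} \<subseteq> topspace X" by auto
        from netC[OF this(1) openin_topspace this(2)]
        obtain \<F> where "\<F> \<subseteq> \<C>" "{x} \<subseteq> \<Union>\<F>" by meson
        then obtain N where "N \<in> \<C>" "x \<in> N" by blast
        then show "x \<in> \<Union>(P ` \<C>)" using AP[of N] by blast
      qed
    qed
    show "{} \<notin> P ` \<C>" using ne AP by blast
    fix U assume "U \<in> P ` \<C>"
    then obtain A where A: "A \<in> \<C>" "U = P A" by blast
    show oU: "openin X U" unfolding A(2) by (rule oP[OF A(1)])
    let ?Z = "subtopology X U"
    have tZ: "topspace ?Z = U" using PX[OF A(1)] A(2) by auto
    have "network_in ?Z (r\<^sup>* `` {A})"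
      unfolding network_in_def tZ
    proof (intro conjI ballI allI impI)
      show "N \<subseteq> U" if "N \<in> r\<^sup>* `` {A}" for N using that unfolding A(2) P_def by blast
      fix y O' assume O': "openin ?Z O' \<and> y \<in> O'"
      then have oX: "openin X O'" using oU openin_trans_full by blast
      have yU: "y \<in> U" using O' openin_subset[of ?Z O'] tZ by blast
      have "compactin X {y}" using yU PX[OF A(1)] A(2) by auto
      moreover have "{y} \<subseteq> O'" using O' by simp
      ultimately obtain \<F> where F: "\<F> \<subseteq> \<C>" "{y} \<subseteq> \<Union>\<F>" "\<Union>\<F> \<subseteq> O'" using netC[OF _ oX] by meson
      from F(2) obtain N where "N \<in> \<F>" "y \<in> N" by auto
      then have N: "N \<in> \<C>" "y \<in> N" "N \<subseteq> O'" using F(1,3) by auto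
      then have "N \<in> r\<^sup>* `` {A}" using meet[OF A(1)] yU A(2) by blast
      then show "\<exists>N\<in>r\<^sup>* `` {A}. y \<in> N \<and> N \<subseteq> O'" using N by blast
    qed
    then have cos: "cosmic_space ?Z"
      using cnt reg unfolding cosmic_space_def regular_T1_space_def
      by (meson regular_space_subtopology t1_space_subtopology)
    have "r\<^sup>* `` {A} \<noteq> {}" by blast
    then obtain e :: "nat \<Rightarrow> 'a set" where e: "range e = r\<^sup>* `` {A}" using cnt range_from_nat_into by metis
    have eC: "e n \<in> \<C>" "e n \<in> r\<^sup>* `` {A}" for n using e clsC[OF A(1)] by blast+
    define K where "K n = (\<Union>k\<le>n. e k)" for n
    have cK: "compactin X (K n)" for n unfolding K_def
      by (rule compactin_Union) (use comp eC in auto)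
    have incK: "incseq K" unfolding K_def incseq_def by (intro allI impI UN_mono) auto
    have "(\<Union>n. K n) = \<Union>(range e)" unfolding K_def by blast
    then have UK: "(\<Union>n. K n) = U" unfolding e A(2) P_def .
    have "compact_exhaustion ?Z K"
      unfolding compact_exhaustion_def tZ
    proof (intro conjI allI impI)
      show "compactin ?Z (K n)" for n using cK UK by (auto simp: compactin_subtopology)
    next
      fix F assume F: "F \<subseteq> U \<and> (\<forall>n. closedin ?Z (F \<inter> K n))"
      have FK: "closedin X (F \<inter> K n)" for n
      proof -
        obtain E where "closedin X E" "F \<inter> K n = E \<inter> U" using F unfolding closedin_subtopology by meson
        then have "F \<inter> K n = E \<inter> K n" using UK by blast
        then show ?thesis using closedin_Int[OF \<open>closedin X E\<close> compactin_imp_closedin[OF H cK]] by simp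
      qed
      \<comment> \<open>A function separating \<open>x\<close> from \<open>F\<close> along the
        \<open>K n\<close> is continued by 0; the set where it is positive is a neighbourhood of
        \<open>x\<close> inside \<open>U - F\<close>.\<close>
      have "openin X (U - F)"
      proof (subst openin_subopen, intro ballI)
        fix x assume x: "x \<in> U - F"
        then have "x \<in> topspace X" "x \<notin> F" using openin_subset[OF oU] by auto
        then obtain f :: "'a \<Rightarrow> real" where f: "\<And>n. continuous_map (subtopology X (K n)) euclideanreal f"
          "\<And>n y. y \<in> F \<inter> K n \<Longrightarrow> f y = 0" "f x = 1"
          using separating_function_along_compacts[OF H cK incK FK, of x] by metis
        have "continuous_map X euclideanreal (\<lambda>y. if y \<in> P A then f y else 0)"
        proof (rule glue[OF A(1)])
          fix N assume "N \<in> r\<^sup>* `` {A}"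
          then obtain n where "N = e n" using e by blast
          then have "N \<subseteq> K n" unfolding K_def by blast
          then show "continuous_map (subtopology X N) euclideanreal f"
            using f(1) continuous_map_from_subtopology_mono by blast
        qed
        then have o: "openin X {y \<in> topspace X. (if y \<in> P A then f y else 0) > 0}"
          unfolding continuous_map_upper_lower_semicontinuous_lt by blast
        have "x \<in> {y \<in> topspace X. (if y \<in> P A then f y else 0) > 0}"
          using x f(3) A(2) \<open>x \<in> topspace X\<close> by simp
        moreover have "{y \<in> topspace X. (if y \<in> P A then f y else 0) > 0} \<subseteq> U - F"
        proof
          fix y assume "y \<in> {y \<in> topspace X. (if y \<in> P A then f y else 0) > 0}"
          then have y: "y \<in> U" "f y > 0" using A(2) by (auto split: if_splits)
          then obtain n where "y \<in> K n" using UK by blast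
          then have "y \<notin> F" using f(2)[of y n] y(2) by auto
          then show "y \<in> U - F" using y(1) by blast
        qed
        ultimately show "\<exists>G. openin X G \<and> x \<in> G \<and> G \<subseteq> U - F" using o by blast
      qed
      then have "openin ?Z (U - F)" using oU by (simp add: openin_open_subtopology)
      then show "closedin ?Z F" unfolding closedin_def tZ using F by simp
    qed (use incK UK in auto)
    then show "cosmic_k_omega_space ?Z" using cos unfolding cosmic_k_omega_space_iff by blast
  qed
  then show ?thesis by blast
qed

section \<open>From partitions to networks and k-spaces; absence and transport of fans\<close>

text \<open>A compact set meets finitely many pieces, and its trace on each of them is absorbed by
  one stage of the exhaustion, where \<open>compact_countable_k_network\<close> applies. Collecting
  the countable families over all pieces and stages thus keeps compact-countability.\<close>

lemma cosmic_k_omega_partition_imp_aleph_bar_k_space: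
  assumes reg: "regular_T1_space X" and P: "cosmic_k_omega_partition X \<U>"
  shows "aleph_bar_k_space X"
proof -
  note D = cosmic_k_omega_partitionD[OF P]
  have clo: "closedin X U" if "U \<in> \<U>" for U using D(6)[of "{U}"] that by simp
  have tU: "topspace (subtopology X U) = U" if "U \<in> \<U>" for U using openin_subset[OF D(4)[OF that]] by auto
  have "\<forall>U\<in>\<U>. \<exists>K. compact_exhaustion (subtopology X U) K"
    using D(5) unfolding cosmic_k_omega_space_iff by blast
  then obtain K where K: "\<And>U. U \<in> \<U> \<Longrightarrow> compact_exhaustion (subtopology X U) (K U)" by metis
  have cos: "cosmic_space (subtopology X U)" if "U \<in> \<U>" for U
    using D(5)[OF that] unfolding cosmic_k_omega_space_iff by blast
  define good where "good U n \<M> \<longleftrightarrow> countable \<M> \<and> (\<forall>M\<in>\<M>. closedin (subtopology X U) M) \<and>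
    (\<forall>C W. compactin (subtopology X U) C \<and> C \<subseteq> K U n \<and> openin (subtopology X U) W \<and> C \<subseteq> W \<longrightarrow>
      (\<exists>\<F>. finite \<F> \<and> \<F> \<subseteq> \<M> \<and> C \<subseteq> \<Union>\<F> \<and> \<Union>\<F> \<subseteq> W))" for U n \<M>
  have "\<exists>\<M>. good U n \<M>" if U: "U \<in> \<U>" for U n
  proof -
    obtain \<M> where m: "countable \<M>" "\<And>M. M \<in> \<M> \<Longrightarrow> closedin (subtopology X U) M"
      "\<And>C W. compactin (subtopology X U) C \<Longrightarrow> C \<subseteq> K U n \<Longrightarrow> openin (subtopology X U) W \<Longrightarrow> C \<subseteq> W \<Longrightarrow>
        \<exists>\<F>. finite \<F> \<and> \<F> \<subseteq> \<M> \<and> C \<subseteq> \<Union>\<F> \<and> \<Union>\<F> \<subseteq> W"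
      using compact_countable_k_network[OF cos[OF U] compact_exhaustionD(1)[OF K[OF U], of n]] by metis
    have "good U n \<M>"
      unfolding good_def by (intro conjI ballI allI impI, rule m(1), erule m(2), elim conjE, rule m(3))
    then show ?thesis by (rule exI)
  qed
  then obtain \<M> where M: "\<And>U n. U \<in> \<U> \<Longrightarrow> good U n (\<M> U n)" by metis
  define \<N> where "\<N> = (\<Union>U\<in>\<U>. \<Union>n. \<M> U n)"
  have clN: "closedin X N" if "N \<in> \<N>" for N
  proof -
    obtain U n where "U \<in> \<U>" "N \<in> \<M> U n" using \<open>N \<in> \<N>\<close> unfolding \<N>_def by blast
    then have "closedin (subtopology X U) N" using M[of U n] unfolding good_def by simp
    then show ?thesis using closedin_closed_subtopology[OF clo] \<open>U \<in> \<U>\<close> by blast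
  qed
  have fin: "\<exists>J. finite J \<and> J \<subseteq> \<U> \<and> C \<subseteq> \<Union>J" if C: "compactin X C" for C
  proof -
    have "(\<forall>U\<in>\<U>. openin X U) \<and> C \<subseteq> \<Union>\<U>" using D(2,4) compactin_subset_topspace[OF C] by simp
    then show ?thesis using C unfolding compactin_def by meson
  qed
  have "compact_countable_in X \<N>"
    unfolding compact_countable_in_def
  proof (intro allI impI)
    fix C assume "compactin X C"
    from fin[OF this] obtain J where J: "finite J" "J \<subseteq> \<U>" "C \<subseteq> \<Union>J" by meson
    have "{N \<in> \<N>. N \<inter> C \<noteq> {}} \<subseteq> (\<Union>U\<in>J. \<Union>n. \<M> U n)"
    proof
      fix N assume "N \<in> {N \<in> \<N>. N \<inter> C \<noteq> {}}"
      then obtain U n y where N: "U \<in> \<U>" "N \<in> \<M> U n" "y \<in> N" "y \<in> C" unfolding \<N>_def by blast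
      then have "closedin (subtopology X U) N" using M[of U n] unfolding good_def by blast
      then have "y \<in> U" using N(3) closedin_subset tU[OF N(1)] by blast
      obtain V where V: "V \<in> J" "y \<in> V" using N(4) J(3) by blast
      have "U = V" using disjointD[OF D(1) N(1), of V] V J(2) \<open>y \<in> U\<close> by blast
      then show "N \<in> (\<Union>U\<in>J. \<Union>n. \<M> U n)" using N(2) V(1) by blast
    qed
    moreover have "countable (\<Union>U\<in>J. \<Union>n. \<M> U n)"
    proof (rule countable_UN[OF countable_finite[OF J(1)]])
      fix U assume "U \<in> J"
      then have "U \<in> \<U>" using J(2) by blast
      then show "countable (\<Union>n. \<M> U n)" using M unfolding good_def by (intro countable_UN) auto
    qed
    ultimately show "countable {N \<in> \<N>. N \<inter> C \<noteq> {}}" by (rule countable_subset)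
  qed
  moreover have "k_network_in X \<N>"
    unfolding k_network_in_def
  proof (intro conjI allI impI ballI)
    show "N \<subseteq> topspace X" if "N \<in> \<N>" for N using clN[OF that] closedin_subset by blast
    fix W C assume "openin X W \<and> compactin X C \<and> C \<subseteq> W"
    then have W: "openin X W" and C: "compactin X C" and CW: "C \<subseteq> W" by auto
    obtain J where J: "finite J" "J \<subseteq> \<U>" "C \<subseteq> \<Union>J" using fin[OF C] by meson
    have "\<exists>\<F>. finite \<F> \<and> \<F> \<subseteq> \<N> \<and> C \<inter> U \<subseteq> \<Union>\<F> \<and> \<Union>\<F> \<subseteq> W" if "U \<in> J" for U
    proof -
      have U: "U \<in> \<U>" using that J(2) by blast
      have CU: "compactin (subtopology X U) (C \<inter> U)"
        unfolding compactin_subtopology using compact_Int_closedin[OF C clo[OF U]] by simp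
      obtain n where n: "C \<inter> U \<subseteq> K U n"
        by (rule compact_exhaustion_absorbs[OF K[OF U] cosmic_space_imp_Hausdorff[OF cos[OF U]] CU])
      have "openin (subtopology X U) (W \<inter> U)" using W by (rule openin_subtopology_Int)
      moreover have "C \<inter> U \<subseteq> W \<inter> U" using CW by blast
      ultimately have "\<exists>\<F>. finite \<F> \<and> \<F> \<subseteq> \<M> U n \<and> C \<inter> U \<subseteq> \<Union>\<F> \<and> \<Union>\<F> \<subseteq> W \<inter> U"
        using M[OF U, of n] CU n unfolding good_def by meson
      moreover have "\<M> U n \<subseteq> \<N>" using U unfolding \<N>_def by blast
      ultimately show ?thesis by (meson le_inf_iff order_trans)
    qed
    then obtain \<F> where F: "\<And>U. U \<in> J \<Longrightarrow> finite (\<F> U) \<and> \<F> U \<subseteq> \<N> \<and> C \<inter> U \<subseteq> \<Union>(\<F> U) \<and> \<Union>(\<F> U) \<subseteq> W"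
      by metis
    show "\<exists>\<F>. finite \<F> \<and> \<F> \<subseteq> \<N> \<and> C \<subseteq> \<Union>\<F> \<and> \<Union>\<F> \<subseteq> W"
    proof (intro exI[of _ "\<Union>U\<in>J. \<F> U"] conjI)
      show "finite (\<Union>U\<in>J. \<F> U)" using J(1) F by blast
      show "(\<Union>U\<in>J. \<F> U) \<subseteq> \<N>" using F by blast
      show "\<Union>(\<Union>U\<in>J. \<F> U) \<subseteq> W" using F by blast
      show "C \<subseteq> \<Union>(\<Union>U\<in>J. \<F> U)"
      proof
        fix y assume "y \<in> C"
        moreover then obtain U where "U \<in> J" "y \<in> U" using J(3) by blast
        ultimately have "y \<in> \<Union>(\<F> U)" using F[of U] by blast
        then show "y \<in> \<Union>(\<Union>U\<in>J. \<F> U)" using \<open>U \<in> J\<close> by blast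
      qed
    qed
  qed
  ultimately show ?thesis using reg clN unfolding aleph_bar_k_space_def by blast
qed

lemma cosmic_k_omega_partition_imp_k_space:
  assumes H: "Hausdorff_space Y" and P: "cosmic_k_omega_partition Y \<U>"
  shows "k_space Y"
  unfolding k_space
proof (intro allI impI, elim conjE)
  note D = cosmic_k_omega_partitionD[OF P]
  fix A assume A: "A \<subseteq> topspace Y" "\<forall>K. compactin Y K \<longrightarrow> closedin (subtopology Y K) (K \<inter> A)"
  have "openin Y (U - A)" if U: "U \<in> \<U>" for U
  proof -
    have tU: "topspace (subtopology Y U) = U" using openin_subset[OF D(4)[OF U]] by auto
    obtain K where K: "compact_exhaustion (subtopology Y U) K"
      using D(5)[OF U] unfolding cosmic_k_omega_space_iff by blast
    have "closedin (subtopology Y U) (A \<inter> U)"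
    proof (rule compact_exhaustionD(4)[OF K])
      show "A \<inter> U \<subseteq> topspace (subtopology Y U)" using tU by simp
      fix n
      have c: "compactin Y (K n)" "K n \<subseteq> U"
        using compact_exhaustionD(1)[OF K] by (auto simp: compactin_subtopology)
      then have "closedin (subtopology Y (K n)) (K n \<inter> A)" using A(2) by blast
      then have "closedin Y (K n \<inter> A)"
        using closedin_closed_subtopology[OF compactin_imp_closedin[OF H c(1)]] by blast
      moreover have "A \<inter> U \<inter> K n = (K n \<inter> A) \<inter> U" using c(2) by blast
      ultimately show "closedin (subtopology Y U) (A \<inter> U \<inter> K n)"
        unfolding closedin_subtopology by blast
    qed
    then have "openin (subtopology Y U) (U - A \<inter> U)" unfolding closedin_def tU by blast
    moreover have "U - A \<inter> U = U - A" by blast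
    ultimately show ?thesis using D(4)[OF U] openin_trans_full by metis
  qed
  then have "openin Y (\<Union>U\<in>\<U>. U - A)" by blast
  moreover have "(\<Union>U\<in>\<U>. U - A) = topspace Y - A" using D(2) by blast
  ultimately show "closedin Y A" using A(1) unfolding closedin_def by simp
qed

text \<open>The union of those \<open>F n\<close> that miss \<open>y\<close> has finite trace on
  every compact set, so it is closed in a k-space. Its complement is a neighbourhood of
  \<open>y\<close> that meets only members containing \<open>y\<close>, and these are finitely many
  because \<open>{y}\<close> is compact.\<close>

lemma k_space_no_Fin_omega_fan:
  assumes t1: "t1_space Y" and k: "k_space Y"
  shows "\<not> Fin_omega_fan Y F"
proof
  assume F: "Fin_omega_fan Y F"
  then have fin: "\<And>n. finite (F n)" "\<And>n. F n \<subseteq> topspace Y"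
    and cf: "\<And>K. compactin Y K \<Longrightarrow> finite {n. F n \<inter> K \<noteq> {}}"
    unfolding Fin_omega_fan_def compact_finite_seq_def by blast+
  have "locally_finite_seq Y F"
    unfolding locally_finite_seq_def
  proof
    fix y assume y: "y \<in> topspace Y"
    define E where "E = (\<Union>n\<in>{n. y \<notin> F n}. F n)"
    have EY: "E \<subseteq> topspace Y" unfolding E_def using fin(2) by blast
    have "closedin (subtopology Y K) (K \<inter> E)" if K: "compactin Y K" for K
    proof -
      have "K \<inter> E \<subseteq> (\<Union>n\<in>{n. F n \<inter> K \<noteq> {}}. F n)" unfolding E_def by blast
      then have "finite (K \<inter> E)" using cf[OF K] fin(1) finite_subset by blast
      moreover have "t1_space (subtopology Y K)" by (rule t1_space_subtopology[OF t1])
      moreover have "K \<inter> E \<subseteq> topspace (subtopology Y K)" using EY by auto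
      ultimately show ?thesis using t1_space_closedin_finite by blast
    qed
    then have "closedin Y E" using k EY unfolding k_space by blast
    then have "openin Y (topspace Y - E)" by blast
    moreover have "y \<in> topspace Y - E" using y unfolding E_def by blast
    moreover have "finite {n. F n \<inter> (topspace Y - E) \<noteq> {}}"
    proof (rule finite_subset)
      show "{n. F n \<inter> (topspace Y - E) \<noteq> {}} \<subseteq> {n. F n \<inter> {y} \<noteq> {}}" unfolding E_def by blast
      show "finite {n. F n \<inter> {y} \<noteq> {}}" using cf[of "{y}"] y by simp
    qed
    ultimately show "\<exists>V. openin Y V \<and> y \<in> V \<and> finite {n. F n \<inter> V \<noteq> {}}" by blast
  qed
  then show False using F unfolding Fin_omega_fan_def by blast
qed

lemma homeomorphic_strong_Fin_omega_fan:
  assumes h: "Y homeomorphic_space Z" and F: "strong_Fin_omega_fan Y F"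
  shows "\<exists>G. strong_Fin_omega_fan Z G"
proof -
  obtain f g where fg: "homeomorphic_maps Y Z f g" using h homeomorphic_space_def by blast
  then have cf: "continuous_map Y Z f" and cg: "continuous_map Z Y g"
    and gf: "\<And>y. y \<in> topspace Y \<Longrightarrow> g (f y) = y" and fg': "\<And>z. z \<in> topspace Z \<Longrightarrow> f (g z) = z"
    unfolding homeomorphic_maps_def by auto
  have fZ: "f y \<in> topspace Z" if "y \<in> topspace Y" for y using continuous_map_funspace[OF cf] that by blast
  have gY: "g z \<in> topspace Y" if "z \<in> topspace Z" for z using continuous_map_funspace[OF cg] that by blast
  obtain U where U: "\<And>n. R_open_in Y (U n)" "\<And>n. F n \<subseteq> U n" "compact_finite_seq Y U"
    using F unfolding strong_Fin_omega_fan_def by blast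
  have UY: "U n \<subseteq> topspace Y" for n using U(1) unfolding R_open_in_def by blast
  have FF: "\<And>n. finite (F n)" "\<And>n. F n \<subseteq> topspace Y" "compact_finite_seq Y F" "\<not> locally_finite_seq Y F"
    using F unfolding strong_Fin_omega_fan_def Fin_omega_fan_def by blast+
  have hit: "A \<inter> g ` K \<noteq> {}" if AK: "f ` A \<inter> K \<noteq> {}" "A \<subseteq> topspace Y" for A K
  proof -
    obtain a where "a \<in> A" "f a \<in> K" using AK(1) by blast
    then have "g (f a) \<in> g ` K" "g (f a) = a" using gf AK(2) by auto
    then show ?thesis using \<open>a \<in> A\<close> by auto
  qed
  have cfin: "compact_finite_seq Z (\<lambda>n. f ` A n)" if A: "compact_finite_seq Y A" "\<And>n. A n \<subseteq> topspace Y" for A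
    unfolding compact_finite_seq_def
  proof (intro allI impI)
    fix K assume "compactin Z K"
    then have "compactin Y (g ` K)" using image_compactin cg by blast
    then have "finite {n. A n \<inter> g ` K \<noteq> {}}" using A(1) unfolding compact_finite_seq_def by blast
    moreover have "{n. f ` A n \<inter> K \<noteq> {}} \<subseteq> {n. A n \<inter> g ` K \<noteq> {}}" using hit A(2) by blast
    ultimately show "finite {n. f ` A n \<inter> K \<noteq> {}}" using finite_subset by blast
  qed
  have "\<not> locally_finite_seq Z (\<lambda>n. f ` F n)"
  proof
    assume lf: "locally_finite_seq Z (\<lambda>n. f ` F n)"
    have "locally_finite_seq Y F"
      unfolding locally_finite_seq_def
    proof
      fix y assume y: "y \<in> topspace Y"
      obtain V where V: "openin Z V" "f y \<in> V" "finite {n. f ` F n \<inter> V \<noteq> {}}"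
        using lf fZ[OF y] unfolding locally_finite_seq_def by blast
      have "openin Y {x \<in> topspace Y. f x \<in> V}" by (rule openin_continuous_map_preimage[OF cf V(1)])
      moreover have "{n. F n \<inter> {x \<in> topspace Y. f x \<in> V} \<noteq> {}} \<subseteq> {n. f ` F n \<inter> V \<noteq> {}}" by blast
      then have "finite {n. F n \<inter> {x \<in> topspace Y. f x \<in> V} \<noteq> {}}" using V(3) finite_subset by blast
      ultimately show "\<exists>V. openin Y V \<and> y \<in> V \<and> finite {n. F n \<inter> V \<noteq> {}}"
        using y V(2) by (intro exI[of _ "{x \<in> topspace Y. f x \<in> V}"]) simp
    qed
    then show False using FF(4) by blast
  qed
  moreover have "R_open_in Z (f ` U n)" for n
    unfolding R_open_in_def
  proof (intro conjI ballI)
    show "f ` U n \<subseteq> topspace Z" using fZ UY by blast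
    fix z assume "z \<in> f ` U n"
    then obtain y where y: "y \<in> U n" "z = f y" by blast
    obtain p :: "_ \<Rightarrow> real" where p: "continuous_map Y (top_of_set {0..1}) p" "p y = 1" "p ` (topspace Y - U n) \<subseteq> {0}"
      using U(1)[of n] y(1) unfolding R_open_in_def by blast
    have "continuous_map Z (top_of_set {0..1}) (p \<circ> g)" by (rule continuous_map_compose[OF cg p(1)])
    moreover have "(p \<circ> g) z = 1" using y p(2) gf[of y] UY[of n] by auto
    moreover have "(p \<circ> g) ` (topspace Z - f ` U n) \<subseteq> {0}"
    proof (rule image_subsetI)
      fix w assume w: "w \<in> topspace Z - f ` U n"
      then have "g w \<notin> U n" using fg' by (metis DiffD1 DiffD2 imageI)
      then show "(p \<circ> g) w \<in> {0}" using p(3) gY w by auto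
    qed
    ultimately show "\<exists>q :: _ \<Rightarrow> real. continuous_map Z (top_of_set {0..1}) q \<and> q z = 1 \<and>
        q ` (topspace Z - f ` U n) \<subseteq> {0}" by blast
  qed
  moreover have "finite (f ` F n) \<and> f ` F n \<subseteq> topspace Z" for n using FF(1,2) fZ by blast
  moreover have "f ` F n \<subseteq> f ` U n" for n using U(2) by blast
  ultimately have "strong_Fin_omega_fan Z (\<lambda>n. f ` F n)"
    unfolding strong_Fin_omega_fan_def Fin_omega_fan_def
    using cfin[OF FF(3,2)] cfin[OF U(3) UY] by (intro conjI allI exI[of _ "\<lambda>n. f ` U n"]) auto
  then show ?thesis by blast
qed

context free_fin_semilattice
begin

lemma cosmic_k_omega_partition_of_T:
  assumes H: "Hausdorff_space X" and P: "cosmic_k_omega_partition T \<V>"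
  shows "\<exists>\<U>. cosmic_k_omega_partition X \<U>"
proof -
  note D = cosmic_k_omega_partitionD[OF P]
  define C where "C = (\<lambda>x. {x}) ` topspace X"
  have CT: "C \<subseteq> topspace T" unfolding C_def topspace_T using fin_subsets_simps(1) by auto
  \<comment> \<open>A set with two points hits two disjoint open sets, which no singleton
    does.\<close>
  have "openin T (topspace T - C)"
  proof (subst openin_subopen, intro ballI)
    fix F assume F: "F \<in> topspace T - C"
    then have FC: "F \<in> fin_subsets (topspace X)" using topspace_T by blast
    then obtain x where x: "x \<in> F" "x \<in> topspace X" by (auto simp: fin_subsets_def)
    have "F \<noteq> {x}" using F x(2) unfolding C_def by blast
    then obtain y where y: "y \<in> F" "y \<noteq> x" using x(1) by blast
    have "y \<in> topspace X" using FC y(1) by (auto simp: fin_subsets_def)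
    then obtain U V where UV: "openin X U" "openin X V" "x \<in> U" "y \<in> V" "disjnt U V"
      using H x(2) y(2) unfolding Hausdorff_space_def by metis
    define W where "W = {F \<in> fin_subsets (topspace X). F \<inter> U \<noteq> {}} \<inter> {F \<in> fin_subsets (topspace X). F \<inter> V \<noteq> {}}"
    have "openin T W" unfolding W_def using openin_T_hits UV(1,2) by blast
    moreover have "F \<in> W" using FC x(1) y(1) UV unfolding W_def by blast
    moreover have "W \<subseteq> topspace T - C"
      using UV(5) unfolding W_def C_def topspace_T disjnt_def by auto
    ultimately show "\<exists>W. openin T W \<and> F \<in> W \<and> W \<subseteq> topspace T - C" by blast
  qed
  then have clC: "closedin T C" using CT unfolding closedin_def by blast
  have "homeomorphic_map X (subtopology T C) (\<lambda>x. {x})"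
  proof (rule bijective_open_imp_homeomorphic_map)
    show "continuous_map X (subtopology T C) (\<lambda>x. {x})"
      unfolding continuous_map_in_subtopology using continuous_singleton C_def by blast
    show "open_map X (subtopology T C) (\<lambda>x. {x})"
      unfolding open_map_def
    proof (intro allI impI)
      fix U assume U: "openin X U"
      have "(\<lambda>x. {x}) ` U = fin_subsets U \<inter> C"
        using openin_subset[OF U] unfolding C_def fin_subsets_def by auto
      then show "openin (subtopology T C) ((\<lambda>x. {x}) ` U)"
        using openin_T_subsets[OF U] openin_subtopology_Int by metis
    qed
    show "(\<lambda>x. {x}) ` topspace X = topspace (subtopology T C)" using CT unfolding C_def by auto
  qed auto
  then have hom: "subtopology T C homeomorphic_space X"
    using homeomorphic_space homeomorphic_space_sym by blast
  have "cosmic_k_omega_partition (subtopology T C) ((\<lambda>V. V \<inter> C) ` \<V> - {{}})"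
    unfolding cosmic_k_omega_partition_def
  proof (intro conjI ballI)
    show "disjoint ((\<lambda>V. V \<inter> C) ` \<V> - {{}})"
    proof (rule disjointI)
      fix A B assume "A \<in> (\<lambda>V. V \<inter> C) ` \<V> - {{}}" "B \<in> (\<lambda>V. V \<inter> C) ` \<V> - {{}}" "A \<noteq> B"
      then obtain V W where "V \<in> \<V>" "W \<in> \<V>" "A = V \<inter> C" "B = W \<inter> C" "V \<noteq> W" by blast
      then show "A \<inter> B = {}" using disjointD[OF D(1), of V W] by blast
    qed
    show "\<Union>((\<lambda>V. V \<inter> C) ` \<V> - {{}}) = topspace (subtopology T C)"
      unfolding topspace_subtopology D(2)[symmetric] by blast
    fix A assume "A \<in> (\<lambda>V. V \<inter> C) ` \<V> - {{}}"
    then obtain V where V: "V \<in> \<V>" "A = V \<inter> C" by blast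
    show "openin (subtopology T C) A" unfolding V(2) by (rule openin_subtopology_Int[OF D(4)[OF V(1)]])
    have "closedin (subtopology T V) (V \<inter> C)" using clC unfolding closedin_subtopology by blast
    from cosmic_k_omega_space_closed_subtopology[OF D(5)[OF V(1)] this]
    show "cosmic_k_omega_space (subtopology (subtopology T C) A)"
      unfolding V(2) subtopology_subtopology by (simp add: Int_left_absorb Int_commute Int_left_commute)
  qed auto
  then show ?thesis using homeomorphic_cosmic_k_omega_partition[OF hom] by blast
qed

lemma no_fan_imp_cosmic_k_omega_partition:
  assumes mu: "mu_complete_space X" and Ty: "Tychonoff_space X" and kR: "k_R_space X"
    and al: "aleph_bar_k_space X" and nofan: "\<nexists>F. strong_Fin_omega_fan T F"
  shows "\<exists>\<U>. cosmic_k_omega_partition X \<U>"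
proof -
  have cr: "completely_regular_space X" and t1: "t1_space X" using Ty unfolding Tychonoff_space_def by auto
  then have reg: "regular_space X" using completely_regular_imp_regular_space by blast
  obtain \<N> where N: "k_network_in X \<N>" "compact_countable_in X \<N>" "\<And>N. N \<in> \<N> \<Longrightarrow> closedin X N"
    "\<And>A B. A \<in> \<N> \<Longrightarrow> B \<in> \<N> \<Longrightarrow> A \<inter> B \<in> \<N>"
    using aleph_bar_k_space_Int_closed[OF al] by metis
  let ?N = "{N \<in> \<N>. compactin X N}"
  have "k_network_in X ?N"
    unfolding k_network_in_def
  proof (intro conjI allI impI ballI)
    show "N \<subseteq> topspace X" if "N \<in> ?N" for N using that compactin_subset_topspace by blast
    fix U K assume "openin X U \<and> compactin X K \<and> K \<subseteq> U"
    then have U: "openin X U" "K \<subseteq> U" and K: "compactin X K" by auto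
    show "\<exists>\<F>. finite \<F> \<and> \<F> \<subseteq> ?N \<and> K \<subseteq> \<Union>\<F> \<and> \<Union>\<F> \<subseteq> U"
    proof (rule ccontr)
      assume "\<not> ?thesis"
      then have none: "\<not> \<Union>\<F> \<subseteq> U" if "finite \<F>" "\<F> \<subseteq> ?N" "K \<subseteq> \<Union>\<F>" for \<F> using that by simp
      show False
      proof (rule k_network_noncompact_convergence[OF reg t1 N K U none])
        fix z and R :: "nat \<Rightarrow> 'a set"
        assume "z \<in> topspace X" "\<And>n. closedin X (R n)" "\<And>n. \<not> compactin X (R n)" "decseq R"
          "\<And>W. openin X W \<Longrightarrow> z \<in> W \<Longrightarrow> \<exists>n. R n \<subseteq> W"
        from strong_fan_T[OF cr mu this] show False using nofan by blast
      qed
    qed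
  qed
  moreover have "compact_countable_in X ?N"
    unfolding compact_countable_in_def
  proof (intro allI impI)
    fix K assume "compactin X K"
    then have "countable {N \<in> \<N>. N \<inter> K \<noteq> {}}" using N(2) unfolding compact_countable_in_def by blast
    then show "countable {N \<in> ?N. N \<inter> K \<noteq> {}}" by (rule countable_subset[rotated]) blast
  qed
  moreover have "regular_T1_space X" using reg t1 unfolding regular_T1_space_def by blast
  ultimately show ?thesis using cosmic_k_omega_partition_compact_k_network[OF _ kR] by blast
qed

end

theorem theorem1p20:
  fixes X :: "'a topology"
    and S :: "'s topology" and m :: "'s \<Rightarrow> 's \<Rightarrow> 's" and \<delta> :: "'a \<Rightarrow> 's"
  assumes "mu_complete_space X" and "Tychonoff_space X" and "k_R_space X"
    and "free_topological_semilattice X S m \<delta>"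
  shows "(topological_sum_of cosmic_k_omega_space X \<longleftrightarrow> topological_sum_of cosmic_k_omega_space S) \<and>
         (topological_sum_of cosmic_k_omega_space X \<longleftrightarrow> aleph_bar_k_space X \<and> k_space S) \<and>
         (topological_sum_of cosmic_k_omega_space X \<longleftrightarrow>
            aleph_bar_k_space X \<and> \<not> (\<exists>F. strong_Fin_omega_fan S F))"
proof -
  obtain T where T: "free_fin_semilattice X T" and hom: "S homeomorphic_space T"
    by (rule free_topological_semilattice_homeomorphic[OF assms(4)])
  interpret free_fin_semilattice X T by (rule T)
  have hom': "T homeomorphic_space S" using hom homeomorphic_space_sym by blast
  have reg: "regular_T1_space X"
    using assms(2) completely_regular_imp_regular_space
    unfolding Tychonoff_space_def regular_T1_space_def by blast
  have H: "Hausdorff_space X" using reg regular_t1_imp_Hausdorff_space unfolding regular_T1_space_def by blast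
  have HT: "Hausdorff_space T" by (rule Hausdorff_T[OF H])
  have t1S: "t1_space S" using Hausdorff_imp_t1_space[OF HT] homeomorphic_t1_space[OF hom] by blast
  let ?X = "\<exists>\<U>. cosmic_k_omega_partition X \<U>" and ?S = "\<exists>\<V>. cosmic_k_omega_partition S \<V>"
    and ?T = "\<exists>\<V>. cosmic_k_omega_partition T \<V>"
  have ST: "?S \<longleftrightarrow> ?T"
    using homeomorphic_cosmic_k_omega_partition[OF hom] homeomorphic_cosmic_k_omega_partition[OF hom'] by blast
  have XT: "?X \<longleftrightarrow> ?T"
    using cosmic_k_omega_partition_T[OF reg] cosmic_k_omega_partition_of_T[OF H] by blast
  have Xal: "aleph_bar_k_space X" if ?X
    using that cosmic_k_omega_partition_imp_aleph_bar_k_space[OF reg] by blast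
  have Xk: "k_space S" if ?X
    using that XT cosmic_k_omega_partition_imp_k_space[OF HT] homeomorphic_k_space[OF hom] by blast
  have kfan: "\<nexists>F. strong_Fin_omega_fan S F" if "k_space S"
    using k_space_no_Fin_omega_fan[OF t1S that] unfolding strong_Fin_omega_fan_def by blast
  have fanX: ?X if "aleph_bar_k_space X" "\<nexists>F. strong_Fin_omega_fan S F"
    using no_fan_imp_cosmic_k_omega_partition[OF assms(1-3) that(1)]
      homeomorphic_strong_Fin_omega_fan[OF hom'] that(2) by blast
  show ?thesis
    unfolding topological_sum_of_cosmic_k_omega_iff
    using ST XT Xal Xk kfan fanX by blast
qed

end
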